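(* Let $0<\varepsilon<\frac14$ and let $G$ be an $(n,d,\lambda)$-graph with $\lambda<d^{1-\varepsilon}/320$ and $d^\varepsilon\ge 5$. Let $S\subseteq V(G)$ be any set of vertices with $|N_G(x)\cap S|\le d/4$ for every $x\in V(G)$. Let $P=\{\{a_i,b_i\}\}$ be a collection of at most $\frac{\varepsilon n\log d}{480\log n}$ pairwise disjoint pairs of vertices from $S$. Then there exists a polynomial time algorithm which finds vertex-disjoint paths in $G$ between every pair $\{a_i,b_i\}$, such that all the paths have the same length, which is less than $5\frac{\log n}{\varepsilon\log d}$. Furthermore, the algorithm works online: the pairs $(a_i,b_i)$ are given one by one, the next pair being revealed only after the connection for the previous one has been made, and established connections cannot be changed.
   Context: A $d$-regular graph $G$ on $n$ vertices is an $(n,d,\lambda)$-graph if all eigenvalues of its adjacency matrix, except the largest one, are at most $\lambda$ in absolute value. $N_G(x)$ denotes the neighborhood of $x$ in $G$; $\log$ is the natural logarithm. *)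

theory Defs
  imports Complex_Main "Jordan_Normal_Form.Char_Poly"
begin

section \<open>Graphs\<close>

text \<open>Graphs have vertex set \<open>{..<n}\<close>, so that they can be handed to an algorithm; an undirected
  edge is a pair of opposite arcs. The empty graph is excluded, since it would be regular of every
  degree.\<close>

definition simple_graph :: "nat \<Rightarrow> (nat \<times> nat) set \<Rightarrow> bool" where
  "simple_graph n E \<longleftrightarrow> 0 < n \<and> E \<subseteq> {..<n} \<times> {..<n} \<and> sym E \<and> irrefl E"

definition nbhd :: "(nat \<times> nat) set \<Rightarrow> nat \<Rightarrow> nat set" where
  "nbhd E x = {y. (x, y) \<in> E}"

definition regular_graph :: "nat \<Rightarrow> (nat \<times> nat) set \<Rightarrow> nat \<Rightarrow> bool" where
  "regular_graph n E d \<longleftrightarrow> simple_graph n E \<and> (\<forall>x<n. card (nbhd E x) = d)"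

definition adj_mat :: "nat \<Rightarrow> (nat \<times> nat) set \<Rightarrow> real mat" where
  "adj_mat n E = mat n n (\<lambda>(i, j). if (i, j) \<in> E then 1 else 0)"

text \<open>The eigenvalues with their (algebraic) multiplicities. The adjacency matrix is real symmetric,
  so all its \<open>n\<close> eigenvalues are real roots of the characteristic polynomial.\<close>

definition spectrum_mset :: "nat \<Rightarrow> (nat \<times> nat) set \<Rightarrow> real multiset" where
  "spectrum_mset n E = proots (char_poly (adj_mat n E))"

text \<open>Only one copy of the largest eigenvalue is exempt from the bound.\<close>

definition ndl_graph :: "nat \<Rightarrow> nat \<Rightarrow> real \<Rightarrow> (nat \<times> nat) set \<Rightarrow> bool" where
  "ndl_graph n d lam E \<longleftrightarrow> regular_graph n E d \<and>
     (\<forall>e \<in># spectrum_mset n E - {#Max_mset (spectrum_mset n E)#}. \<bar>e\<bar> \<le> lam)"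

definition is_path :: "(nat \<times> nat) set \<Rightarrow> nat \<Rightarrow> nat list \<Rightarrow> nat \<Rightarrow> bool" where
  "is_path E a q b \<longleftrightarrow> q \<noteq> [] \<and> hd q = a \<and> last q = b \<and> distinct q \<and>
     successively (\<lambda>u v. (u, v) \<in> E) q"

definition path_length :: "nat list \<Rightarrow> nat" where
  "path_length q = length q - 1"

text \<open>All listed endpoints are distinct: each pair consists of two vertices, and different pairs
  are disjoint.\<close>

definition disjoint_pairs_in :: "nat set \<Rightarrow> (nat \<times> nat) list \<Rightarrow> bool" where
  "disjoint_pairs_in S ps \<longleftrightarrow>
     distinct (map fst ps @ map snd ps) \<and> set (map fst ps @ map snd ps) \<subseteq> S"


section \<open>Algorithms and running time\<close>

text \<open>
  The machine model is the one-variable WHILE language over binary trees (N. D. Jones,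
  Computability and Complexity from a Programming Perspective), with expressions and commands
  merged into one syntactic category of programs that transform the current value. Every
  construct costs one unit in addition to the cost of its subprograms.
  The unit cost is realistic: trees are represented by shared pointers, every primitive is a
  constant number of pointer operations, and a run of \<open>t\<close> steps allocates at most \<open>t\<close> cells.
  Polynomial time in this model is therefore polynomial time on Turing machines.
\<close>

datatype sexp = NIL | CONS sexp sexp

fun head :: "sexp \<Rightarrow> sexp" where
  "head NIL = NIL"
| "head (CONS u v) = u"

fun tail :: "sexp \<Rightarrow> sexp" where
  "tail NIL = NIL"
| "tail (CONS u v) = v"

datatype prog =
    Arg
  | Empty
  | Head
  | Tail
  | Fork prog prog
  | Seq prog prog
  | Cond prog prog prog
  | Loop prog prog

text \<open>\<open>runs p x t y\<close>: started on \<open>x\<close>, the program \<open>p\<close> halts after exactly \<open>t\<close> steps with result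
  \<open>y\<close>. \<open>NIL\<close> counts as false, every other value as true.\<close>

inductive runs :: "prog \<Rightarrow> sexp \<Rightarrow> nat \<Rightarrow> sexp \<Rightarrow> bool" where
  Arg: "runs Arg x 1 x"
| Empty: "runs Empty x 1 NIL"
| Head: "runs Head x 1 (head x)"
| Tail: "runs Tail x 1 (tail x)"
| Fork: "runs p x s u \<Longrightarrow> runs q x t v \<Longrightarrow> runs (Fork p q) x (s + t + 1) (CONS u v)"
| Seq: "runs p x s u \<Longrightarrow> runs q u t v \<Longrightarrow> runs (Seq p q) x (s + t + 1) v"
| Cond_true: "runs c x s b \<Longrightarrow> b \<noteq> NIL \<Longrightarrow> runs p x t y \<Longrightarrow> runs (Cond c p q) x (s + t + 1) y"
| Cond_false: "runs c x s NIL \<Longrightarrow> runs q x t y \<Longrightarrow> runs (Cond c p q) x (s + t + 1) y"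
| Loop_stop: "runs c x s NIL \<Longrightarrow> runs (Loop c p) x (s + 1) x"
| Loop_step: "runs c x s b \<Longrightarrow> b \<noteq> NIL \<Longrightarrow> runs p x t y \<Longrightarrow> runs (Loop c p) y r z \<Longrightarrow>
    runs (Loop c p) x (s + t + r + 1) z"

inductive_cases runs_ArgE: "runs Arg x t y"
inductive_cases runs_EmptyE: "runs Empty x t y"
inductive_cases runs_HeadE: "runs Head x t y"
inductive_cases runs_TailE: "runs Tail x t y"
inductive_cases runs_ForkE: "runs (Fork p q) x t y"
inductive_cases runs_SeqE: "runs (Seq p q) x t y"
inductive_cases runs_CondE: "runs (Cond c p q) x t y"
inductive_cases runs_LoopE: "runs (Loop c p) x t y"

lemma runs_deterministic:
  "runs p x t y \<Longrightarrow> runs p x t' y' \<Longrightarrow> t' = t \<and> y' = y"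
proof (induction arbitrary: t' y' rule: runs.induct)
  case (Arg x)
  then show ?case by (auto elim: runs_ArgE)
next
  case (Empty x)
  then show ?case by (auto elim: runs_EmptyE)
next
  case (Head x)
  then show ?case by (auto elim: runs_HeadE)
next
  case (Tail x)
  then show ?case by (auto elim: runs_TailE)
next
  case (Fork p x s u q t v)
  from Fork.prems show ?case
    by (rule runs_ForkE) (auto dest!: Fork.IH)
next
  case (Seq p x s u q t v)
  from Seq.prems show ?case
    by (rule runs_SeqE) (auto dest!: Seq.IH)
next
  case (Cond_true c x s b p t y q)
  from Cond_true.prems show ?case
    by (rule runs_CondE) (auto dest!: Cond_true.IH simp: Cond_true.hyps)
next
  case (Cond_false c x s q t y p)
  from Cond_false.prems show ?case
    by (rule runs_CondE) (auto dest!: Cond_false.IH)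
next
  case (Loop_stop c x s p)
  from Loop_stop.prems show ?case
    by (rule runs_LoopE) (auto dest!: Loop_stop.IH)
next
  case (Loop_step c x s b p t y r z)
  from Loop_step.prems show ?case
    by (rule runs_LoopE) (auto dest!: Loop_step.IH simp: Loop_step.hyps)
qed


subsection \<open>Encoding of inputs and outputs\<close>

text \<open>Numbers are encoded in unary; all numbers below are vertices, hence less than \<open>n\<close>, so
  encodings have size polynomial in \<open>n\<close>. Graphs are encoded by adjacency lists.\<close>

fun enc_list :: "('a \<Rightarrow> sexp) \<Rightarrow> 'a list \<Rightarrow> sexp" where
  "enc_list f [] = NIL"
| "enc_list f (x # xs) = CONS (f x) (enc_list f xs)"

definition enc_nat :: "nat \<Rightarrow> sexp" where
  "enc_nat k = enc_list (\<lambda>_. NIL) [0..<k]"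

definition enc_path :: "nat list \<Rightarrow> sexp" where
  "enc_path q = enc_list enc_nat q"

definition enc_vset :: "nat set \<Rightarrow> sexp" where
  "enc_vset A = enc_list enc_nat (sorted_list_of_set A)"

definition enc_graph :: "nat \<Rightarrow> (nat \<times> nat) set \<Rightarrow> sexp" where
  "enc_graph n E = enc_list (\<lambda>x. enc_vset (nbhd E x)) [0..<n]"

definition enc_pair :: "nat \<times> nat \<Rightarrow> sexp" where
  "enc_pair ab = CONS (enc_nat (fst ab)) (enc_nat (snd ab))"

text \<open>A request consists of the graph, the set \<open>S\<close>, the connections \<open>qs\<close> established so far and the
  newly revealed pair \<open>ab\<close>. The endpoints of the paths in \<open>qs\<close> are the earlier pairs.\<close>

definition enc_request ::
  "nat \<Rightarrow> (nat \<times> nat) set \<Rightarrow> nat set \<Rightarrow> nat list list \<Rightarrow> nat \<times> nat \<Rightarrow> sexp" where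
  "enc_request n E S qs ab =
     CONS (enc_graph n E) (CONS (enc_vset S) (CONS (enc_list enc_path qs) (enc_pair ab)))"

text \<open>\<open>serves_online A T n E S ps qs\<close>: when the pairs \<open>ps\<close> are revealed one after the other, the
  algorithm \<open>A\<close> answers with the connections \<open>qs\<close>, spending at most \<open>T\<close> steps on each of them.
  The answer to a pair depends only on what is known when the pair is revealed, and is never
  revised. By \<open>runs_deterministic\<close>, \<open>A\<close> and the pairs determine \<open>qs\<close>, so
  quantifying over all sequences \<open>ps\<close> also covers adversaries that choose the next pair depending
  on the connections made before.\<close>

definition serves_online ::
  "prog \<Rightarrow> nat \<Rightarrow> nat \<Rightarrow> (nat \<times> nat) set \<Rightarrow> nat set \<Rightarrow> (nat \<times> nat) list \<Rightarrow> nat list list \<Rightarrow> bool" where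
  "serves_online A T n E S ps qs \<longleftrightarrow> length qs = length ps \<and>
     (\<forall>i<length ps. \<exists>t\<le>T. runs A (enc_request n E S (take i qs) (ps ! i)) t (enc_path (qs ! i)))"

end

theory Submission
  imports Defs "Jordan_Normal_Form.Spectral_Radius" "HOL-Analysis.Convex"
begin

text \<open>
  Let \<open>m\<close> be the integer part of the \<open>\<lceil>1 / \<epsilon>\<rceil>\<close>-th root of \<open>d\<close>, so that \<open>320 m \<lambda> < d\<close>. To connect \<open>a\<close> with \<open>b\<close>,
  grow two disjoint \<open>m\<close>-ary trees of the same depth from \<open>a\<close> and \<open>b\<close> through free vertices, until
  each has more than \<open>n \<lambda> / d\<close> leaves; the mixing lemma then gives an edge between the two sets of leaves,
  hence a path. The depth depends only on \<open>n\<close> and \<open>m\<close>.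

  What has to be maintained, in the spirit of Friedman and Pippenger, is that the trees can always be
  grown. A set \<open>U\<close> of used vertices is good if there are disjoint stars with \<open>m\<close> free leaves such that
  every unused vertex that is not the centre of a star has more than half of its neighbours outside
  \<open>U\<close>, \<open>S\<close> and the stars. Vertices in trouble are few by the mixing lemma, and small sets of vertices
  with many free neighbours expand, so Hall's condition holds for the centres. The stars are computed
  by an auction: a centre that lacks leaves takes its cheapest neighbour, possibly from another centre,
  and the price of that neighbour goes up by one. Hall's condition keeps the prices below \<open>n\<close>,
  so the auction ends after at most \<open>n\<^sup>2\<close> bids. A new path uses up vertices of the stars only
  together with their centres, hence goodness is preserved. Since the auction recovers suitable stars
  from \<open>U\<close> alone, the algorithm needs no memory besides the established paths.
\<close>

section \<open>The expander mixing lemma\<close>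

text \<open>The program may depend on \<open>\<epsilon>\<close> but handles natural numbers only.
  With \<open>k = \<lceil>1 / \<epsilon>\<rceil>\<close> it can find the largest \<open>m\<close>
  with \<open>m ^ k \<le> d\<close> by comparing integers. Since
  \<open>1 / k \<le> \<epsilon>\<close>, also \<open>m \<le> d powr \<epsilon>\<close>, so
  \<open>320 * m * lam < d\<close>. Since \<open>\<epsilon> < 1 / 4\<close> and
  \<open>d powr \<epsilon> \<ge> 5\<close>, rounding costs at most a square:
  \<open>d powr \<epsilon> \<le> m\<^sup>2\<close>. With
  \<open>L = ln n / (\<epsilon> * ln d) > 4\<close> the depth is therefore at most
  \<open>2 * L\<close>, the path length \<open>2 * depth + 1\<close> is below \<open>5 * L\<close>,
  and at most \<open>n / (480 * L)\<close> paths cover at most \<open>n / 90\<close> vertices.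

  The obstacle is a cascade: a star given to a vertex in trouble occupies \<open>m\<close> more
  vertices, which may bring further vertices into trouble while the auction is still running. If
  \<open>z\<close> vertices are occupied, mixing leaves at most \<open>z / (32 * m)\<close> vertices
  in trouble; their stars account for at most \<open>z / 32\<close>, so the cascade dies out and
  \<open>z\<close> stays proportional to what the paths and the tree tips require.\<close>

lemma log_convex_ratio_le:
  fixes N :: "nat \<Rightarrow> real"
  assumes nonneg: "\<And>k. 0 \<le> N k"
    and convex: "\<And>k. (N (Suc k))\<^sup>2 \<le> N k * N (Suc (Suc k))"
    and bound: "\<And>k. N k \<le> C * r ^ k" and "0 < r"
  shows "N 1 \<le> r * N 0"
proof (rule ccontr)
  assume "\<not> N 1 \<le> r * N 0"
  hence gt: "r * N 0 < N 1" by simp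
  have "N 0 \<noteq> 0"
  proof
    assume "N 0 = 0"
    hence "(N 1)\<^sup>2 \<le> 0" using convex[of 0] by simp
    thus False using gt \<open>N 0 = 0\<close> by simp
  qed
  hence pos: "0 < N 0" using nonneg[of 0] by simp
  define s where "s = N 1 / N 0"
  have rs: "r < s" using gt pos by (simp add: s_def field_simps)
  hence spos: "0 < s" using \<open>0 < r\<close> by simp
  \<comment> \<open>By log-convexity the ratios of consecutive terms never decrease, so each is at
    least the first one, \<open>s\<close>. Then \<open>N\<close> grows at least like
    \<open>s ^ k\<close>, which outruns \<open>C * r ^ k\<close> when \<open>r < s\<close>.\<close>
  have step: "0 < N k \<and> s * N k \<le> N (Suc k)" for k
  proof (induction k)
    case 0
    then show ?case using pos by (simp add: s_def)
  next
    case (Suc k)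
    hence k: "0 < N k" and sk: "s * N k \<le> N (Suc k)" by auto
    have "0 < s * N k" using spos k by simp
    hence p: "0 < N (Suc k)" using sk by linarith
    have "s * N k * N (Suc k) \<le> N (Suc k) * N (Suc k)"
      using sk p by (intro mult_right_mono) auto
    also have "\<dots> \<le> N k * N (Suc (Suc k))" using convex[of k] by (simp add: power2_eq_square)
    finally have "N k * (s * N (Suc k)) \<le> N k * N (Suc (Suc k))" by (simp add: algebra_simps)
    hence "s * N (Suc k) \<le> N (Suc (Suc k))" using k by simp
    thus ?case using p by simp
  qed
  have lower: "s ^ k * N 0 \<le> N k" for k
  proof (induction k)
    case (Suc k)
    have "s ^ Suc k * N 0 = s * (s ^ k * N 0)" by simp
    also have "\<dots> \<le> s * N k" using Suc spos by (intro mult_left_mono) auto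
    also have "\<dots> \<le> N (Suc k)" using step by blast
    finally show ?case .
  qed simp
  have "1 < s / r" using rs \<open>0 < r\<close> by simp
  then obtain k where k: "C / N 0 < (s / r) ^ k" using real_arch_pow by blast
  have "s ^ k * N 0 \<le> C * r ^ k" using lower[of k] bound[of k] by linarith
  hence "(s / r) ^ k \<le> C / N 0"
    using pos \<open>0 < r\<close> by (simp add: power_divide field_simps)
  thus False using k by simp
qed

text \<open>The Hermitian form of a real symmetric matrix takes real values, and at an eigenvector
  it is \<open>e\<close> times a positive real. The spectral radius ranges over complex eigenvalues,
  while the gap is assumed for real roots only; this closes the difference.\<close>

lemma eigenvalue_symmetric_real:
  fixes B :: "real mat"
  assumes B: "B \<in> carrier_mat n n" and sym: "\<And>i j. i < n \<Longrightarrow> j < n \<Longrightarrow> B $$ (i, j) = B $$ (j, i)"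
    and ev: "eigenvalue (map_mat complex_of_real B) e"
  shows "Im e = 0"
proof -
  let ?B = "map_mat complex_of_real B"
  from ev obtain v where v: "v \<in> carrier_vec n" and v0: "v \<noteq> 0\<^sub>v n"
    and Bv: "?B *\<^sub>v v = e \<cdot>\<^sub>v v"
    using B unfolding eigenvalue_def eigenvector_def by auto
  define S where "S = (\<Sum>i<n. (cmod (v $ i))\<^sup>2)"
  define Q where "Q = (\<Sum>i<n. \<Sum>j<n. of_real (B $$ (i, j)) * v $ j * cnj (v $ i))"
  have row: "(\<Sum>j<n. of_real (B $$ (i, j)) * v $ j) = e * v $ i" if "i < n" for i
  proof -
    have "(?B *\<^sub>v v) $ i = (\<Sum>j<n. of_real (B $$ (i, j)) * v $ j)"
      using that B v by (simp add: scalar_prod_def lessThan_atLeast0)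
    thus ?thesis using Bv that v by simp
  qed
  have "Q = (\<Sum>i<n. e * v $ i * cnj (v $ i))"
    unfolding Q_def by (intro sum.cong refl) (simp flip: row sum_distrib_right)
  also have "\<dots> = e * of_real S"
    unfolding S_def of_real_sum complex_norm_square by (simp add: sum_distrib_left mult.assoc)
  finally have Q: "Q = e * of_real S" .
  have "cnj Q = (\<Sum>i<n. \<Sum>j<n. of_real (B $$ (i, j)) * cnj (v $ j) * v $ i)"
    by (simp add: Q_def)
  also have "\<dots> = (\<Sum>j<n. \<Sum>i<n. of_real (B $$ (i, j)) * cnj (v $ j) * v $ i)"
    by (rule sum.swap)
  also have "\<dots> = Q"
    unfolding Q_def by (intro sum.cong refl) (simp add: sym mult_ac)
  finally have "cnj Q = Q" .
  hence "Im Q = 0" by (simp add: complex_eq_iff)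
  hence "Im e * S = 0" using Q by simp
  moreover have "S \<noteq> 0"
  proof
    assume "S = 0"
    hence "\<forall>i<n. v $ i = 0" by (simp add: S_def sum_nonneg_eq_0_iff)
    hence "v = 0\<^sub>v n" using v by (intro eq_vecI) auto
    thus False using v0 by simp
  qed
  ultimately show ?thesis by simp
qed

text \<open>By self-adjointness the squared norms of \<open>B\<^sup>k f\<close> are log-convex in \<open>k\<close>, so the first ratio bounds
  their growth from below; the spectral radius bounds it from above.\<close>

lemma symmetric_mat_norm_le:
  fixes B :: "real mat"
  assumes B: "B \<in> carrier_mat n n" and sym: "\<And>i j. i < n \<Longrightarrow> j < n \<Longrightarrow> B $$ (i, j) = B $$ (j, i)"
    and ev: "\<And>x. poly (char_poly B) x = 0 \<Longrightarrow> \<bar>x\<bar> \<le> mu" and mu: "0 \<le> mu" and n: "0 < n"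
    and f: "f \<in> carrier_vec n"
  shows "(B *\<^sub>v f) \<bullet> (B *\<^sub>v f) \<le> mu\<^sup>2 * (f \<bullet> f)"
proof -
  define v where "v k = (B ^\<^sub>m k) *\<^sub>v f" for k
  have Bk: "B ^\<^sub>m k \<in> carrier_mat n n" for k using B by simp
  have vc: "v k \<in> carrier_vec n" for k unfolding v_def by (rule mult_mat_vec_carrier[OF Bk f])
  have comm: "B ^\<^sub>m k * B = B * B ^\<^sub>m k" for k
  proof (induction k)
    case (Suc k)
    have "B ^\<^sub>m Suc k * B = (B * B ^\<^sub>m k) * B" using Suc by simp
    also have "\<dots> = B * (B ^\<^sub>m k * B)" by (rule assoc_mult_mat[OF B Bk B])
    finally show ?case by simp
  qed (use B in simp)
  have vSuc: "v (Suc k) = B *\<^sub>v v k" for k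
    using assoc_mult_mat_vec[OF B Bk f] by (simp add: v_def comm)
  have selfadj: "(B *\<^sub>v x) \<bullet> y = x \<bullet> (B *\<^sub>v y)"
    if x: "x \<in> carrier_vec n" and y: "y \<in> carrier_vec n" for x y
  proof -
    have BT: "transpose_mat B = B" using B sym by (intro eq_matI) auto
    have "(B *\<^sub>v x) \<bullet> y = y \<bullet> (B *\<^sub>v x)"
      using B x y by (intro comm_scalar_prod) auto
    also have "\<dots> = x \<bullet> (B *\<^sub>v y)"
      using transpose_vec_mult_scalar[OF B x y] BT
        comm_scalar_prod[OF x mult_mat_vec_carrier[OF B y]] by simp
    finally show ?thesis .
  qed
  define N where "N k = v k \<bullet> v k" for k
  have sp_nonneg: "0 \<le> x \<bullet> x" for x :: "real vec"
    by (simp add: scalar_prod_def sum_nonneg)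
  have cs: "(x \<bullet> y)\<^sup>2 \<le> (x \<bullet> x) * (y \<bullet> y)"
    if "x \<in> carrier_vec n" "y \<in> carrier_vec n" for x y :: "real vec"
    using Cauchy_Schwarz_ineq_sum[of "\<lambda>i. x $ i" "\<lambda>i. y $ i" "{0..<n}"] that
    by (simp add: scalar_prod_def power2_eq_square)
  have convex: "(N (Suc k))\<^sup>2 \<le> N k * N (Suc (Suc k))" for k
  proof -
    have "N (Suc k) = v k \<bullet> v (Suc (Suc k))"
      unfolding N_def using selfadj[OF vc[of k] vc[of "Suc k"]] by (simp add: vSuc)
    thus ?thesis using cs[OF vc vc, of k "Suc (Suc k)"] by (simp add: N_def)
  qed
  \<comment> \<open>For \<open>r > mu\<close> the matrix \<open>B / r\<close> has spectral radius
    strictly below 1, so its powers have bounded entries. At \<open>mu\<close> itself this could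
    fail; the limit is taken at the end.\<close>
  have main: "N 1 \<le> r\<^sup>2 * N 0" if r: "mu < r" for r
  proof -
    have rpos: "0 < r" using r mu by simp
    define C where "C = map_mat complex_of_real B"
    define D where "D = (1 / complex_of_real r) \<cdot>\<^sub>m C"
    have C: "C \<in> carrier_mat n n" using B by (simp add: C_def)
    have D: "D \<in> carrier_mat n n" using C by (simp add: D_def)
    have evD: "cmod e < 1" if "eigenvalue D e" for e
    proof -
      from that obtain w where w: "w \<in> carrier_vec n" "w \<noteq> 0\<^sub>v n" "D *\<^sub>v w = e \<cdot>\<^sub>v w"
        using D unfolding eigenvalue_def eigenvector_def by auto
      have "C *\<^sub>v w = complex_of_real r \<cdot>\<^sub>v (D *\<^sub>v w)"
        using C w(1) rpos by (intro eq_vecI) (auto simp: D_def)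
      also have "\<dots> = (of_real r * e) \<cdot>\<^sub>v w" using w by (simp add: smult_smult_assoc)
      finally have evC: "eigenvalue C (of_real r * e)"
        using w C unfolding eigenvalue_def eigenvector_def by auto
      define x where "x = Re (of_real r * e)"
      have "Im (of_real r * e) = 0"
        using eigenvalue_symmetric_real[OF B sym, of "of_real r * e"] evC unfolding C_def by blast
      hence x: "of_real r * e = of_real x" by (simp add: x_def complex_eq_iff)
      have "poly (char_poly C) (of_real x) = 0"
        using evC x eigenvalue_root_char_poly[OF C] by simp
      hence "poly (char_poly B) x = 0"
        using of_real_hom.char_poly_hom[OF B, where 'a = complex] by (simp add: C_def)
      hence "\<bar>x\<bar> \<le> mu" by (rule ev)
      moreover have "r * cmod e = \<bar>x\<bar>" using arg_cong[OF x, of cmod] rpos by (simp add: norm_mult)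
      ultimately show ?thesis using r rpos
        by (smt (verit, best) mult_less_cancel_left_pos mult_cancel_left1 mult.commute)
    qed
    have "spectral_radius D \<in> cmod ` spectrum D" by (rule spectral_radius_mem_max(1)[OF D n])
    hence "spectral_radius D < 1" using evD by (auto simp: spectrum_def)
    then obtain c where c: "\<And>k. norm_bound (D ^\<^sub>m k) c"
      using spectral_radius_jnf_norm_bound_less_1[OF D] jordan_nf_exists[OF D] char_poly_factorized[OF D]
      by metis
    have Dk: "D ^\<^sub>m k = (1 / complex_of_real r) ^ k \<cdot>\<^sub>m map_mat complex_of_real (B ^\<^sub>m k)" for k
    proof (induction k)
      case 0
      then show ?case using B D by (intro eq_matI) auto
    next
      case (Suc k)
      have "D ^\<^sub>m Suc k = ((1 / complex_of_real r) ^ k \<cdot>\<^sub>m map_mat complex_of_real (B ^\<^sub>m k)) * D"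
        using Suc by simp
      also have "\<dots> = (1 / complex_of_real r) ^ Suc k \<cdot>\<^sub>m (map_mat complex_of_real (B ^\<^sub>m k) * C)"
        using C Bk[of k] by (intro eq_matI) (auto simp: D_def mult_ac)
      also have "map_mat complex_of_real (B ^\<^sub>m k) * C = map_mat complex_of_real (B ^\<^sub>m Suc k)"
        using of_real_hom.mat_hom_mult[OF Bk[of k] B, where 'a = complex] by (simp add: C_def)
      finally show ?case .
    qed
    have entry: "\<bar>(B ^\<^sub>m k) $$ (i, j)\<bar> \<le> c * r ^ k" if "i < n" "j < n" for i j k
    proof -
      have "norm ((D ^\<^sub>m k) $$ (i, j)) \<le> c"
        using c[of k] that D unfolding norm_bound_def by simp
      hence "\<bar>(B ^\<^sub>m k) $$ (i, j)\<bar> / r ^ k \<le> c"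
        using that Bk[of k] rpos B by (simp add: Dk norm_mult norm_divide norm_power power_one_over field_simps)
      thus ?thesis using rpos by (simp add: field_simps)
    qed
    define F where "F = (\<Sum>j<n. \<bar>f $ j\<bar>)"
    have comp: "\<bar>v k $ i\<bar> \<le> c * F * r ^ k" if "i < n" for i k
    proof -
      have "\<bar>v k $ i\<bar> = \<bar>\<Sum>j<n. (B ^\<^sub>m k) $$ (i, j) * f $ j\<bar>"
        using that Bk[of k] f B by (simp add: v_def scalar_prod_def lessThan_atLeast0)
      also have "\<dots> \<le> (\<Sum>j<n. \<bar>(B ^\<^sub>m k) $$ (i, j) * f $ j\<bar>)" by (rule sum_abs)
      also have "\<dots> \<le> (\<Sum>j<n. c * r ^ k * \<bar>f $ j\<bar>)"
        using that entry by (intro sum_mono) (auto simp: abs_mult intro!: mult_right_mono)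
      also have "\<dots> = c * F * r ^ k" by (simp add: F_def sum_distrib_left mult_ac)
      finally show ?thesis .
    qed
    have bnd: "N k \<le> (real n * (c * F)\<^sup>2) * (r\<^sup>2) ^ k" for k
    proof -
      have "N k = (\<Sum>i<n. (v k $ i)\<^sup>2)"
        using vc[of k] by (simp add: N_def scalar_prod_def power2_eq_square lessThan_atLeast0)
      also have "\<dots> \<le> (\<Sum>i<n. (c * F * r ^ k)\<^sup>2)"
      proof (rule sum_mono)
        fix i assume "i \<in> {..<n}"
        hence "\<bar>v k $ i\<bar> \<le> c * F * r ^ k" using comp by simp
        thus "(v k $ i)\<^sup>2 \<le> (c * F * r ^ k)\<^sup>2" by (metis abs_ge_zero power2_abs power_mono)
      qed
      also have "\<dots> = (real n * (c * F)\<^sup>2) * (r\<^sup>2) ^ k"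
        by (simp add: power_mult_distrib power_mult[symmetric] mult.commute)
      finally show ?thesis .
    qed
    have "0 \<le> N k" for k using sp_nonneg by (simp add: N_def)
    thus ?thesis using log_convex_ratio_le[OF _ convex bnd] rpos by simp
  qed
  have N0: "0 \<le> N 0" using sp_nonneg by (simp add: N_def)
  have N1: "0 \<le> N 1" using sp_nonneg by (simp add: N_def)
  have "N 1 \<le> mu\<^sup>2 * N 0"
  proof (cases "N 0 = 0")
    case True
    then show ?thesis using main[of "mu + 1"] by simp
  next
    case False
    hence pos: "0 < N 0" using N0 by simp
    have "sqrt (N 1 / N 0) \<le> r" if "mu < r" for r
    proof -
      have "N 1 / N 0 \<le> r\<^sup>2" using main[OF that] pos by (simp add: field_simps)
      thus ?thesis using that mu by (intro real_le_lsqrt) auto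
    qed
    hence "sqrt (N 1 / N 0) \<le> mu" by (rule dense_ge)
    hence "N 1 / N 0 \<le> mu\<^sup>2" by (rule sqrt_le_D)
    thus ?thesis using pos by (simp add: field_simps)
  qed
  moreover have "N 0 = f \<bullet> f" using f B by (simp add: N_def v_def)
  moreover have "N 1 = (B *\<^sub>v f) \<bullet> (B *\<^sub>v f)" using f B by (simp add: N_def v_def)
  ultimately show ?thesis by simp
qed

text \<open>Let \<open>M = x I - A\<close>. Adding all columns of \<open>M\<close> to the first one gives a multiple of the all-ones
  column, by \<open>x - r\<close>; for \<open>x I - A + (r / n) J\<close> the factor is \<open>x\<close>, and the remaining columns differ from
  those of \<open>M\<close> by a multiple of the all-ones column. Both determinants are thus multiples of the same \<open>D\<close>.\<close>

lemma char_poly_deflate: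
  fixes A :: "real mat"
  assumes A: "A \<in> carrier_mat n n" and n: "0 < n"
    and rows: "\<And>i. i < n \<Longrightarrow> (\<Sum>j<n. A $$ (i, j)) = r"
  obtains D where "char_poly A = [:- r, 1:] * D"
    and "char_poly (mat n n (\<lambda>ij. A $$ ij - r / n)) = [:0, 1:] * D"
proof
  define c where "c = r / real n"
  define A' where "A' = mat n n (\<lambda>ij. A $$ ij - c)"
  define M where "M = char_poly_matrix A"
  define M' where "M' = char_poly_matrix A'"
  \<comment> \<open>Multiplying by \<open>P\<close> on the right adds all columns to the first.
    \<open>D\<close> is \<open>M\<close> with a first column of ones; \<open>Q\<close> and
    \<open>Q'\<close> put the row sum back into that column, and \<open>Q'\<close> also adds the
    constant \<open>c\<close> to the other columns.\<close>
  define P :: "real poly mat" where "P = mat n n (\<lambda>(i, j). if i = j \<or> j = 0 then 1 else 0)"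
  define D where "D = mat n n (\<lambda>(i, j). if j = 0 then 1 else M $$ (i, j))"
  define Q where "Q = mat n n (\<lambda>(i, j). if i = j then if i = 0 then [:- r, 1:] else 1 else 0)"
  define Q' where "Q' = mat n n (\<lambda>(i, j). if i = j then if i = 0 then [:0, 1:] else 1
    else if i = 0 then [:c:] else 0)"
  have A': "A' \<in> carrier_mat n n" by (simp add: A'_def)
  have M: "M \<in> carrier_mat n n" and M': "M' \<in> carrier_mat n n"
    using A A' by (simp_all add: M_def M'_def)
  have P: "P \<in> carrier_mat n n" and D: "D \<in> carrier_mat n n" and Q: "Q \<in> carrier_mat n n"
    and Q': "Q' \<in> carrier_mat n n"
    by (simp_all add: P_def D_def Q_def Q'_def)
  have M_idx: "M $$ (i, j) = (if i = j then [:- A $$ (i, j), 1:] else [:- A $$ (i, j):])"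
    if "i < n" "j < n" for i j
    using that A by (simp add: M_def char_poly_matrix_def)
  have M'_idx: "M' $$ (i, j) = M $$ (i, j) + [:c:]" if "i < n" "j < n" for i j
    using that A' by (simp add: M'_def char_poly_matrix_def M_idx A'_def)
  have row: "(\<Sum>k<n. M $$ (i, k)) = [:- r, 1:]" if i: "i < n" for i
  proof -
    have "(\<Sum>k<n. M $$ (i, k)) = (\<Sum>k<n. [:- A $$ (i, k):] + (if k = i then [:0, 1:] else 0))"
      using i by (intro sum.cong) (auto simp: M_idx)
    also have "\<dots> = [:\<Sum>k<n. - A $$ (i, k):] + [:0, 1:]"
      using i by (simp add: sum.distrib sum_to_poly)
    also have "\<dots> = [:- r, 1:]" using rows[OF i] by (simp add: sum_negf)
    finally show ?thesis .
  qed
  have row': "(\<Sum>k<n. M' $$ (i, k)) = [:0, 1:]" if i: "i < n" for i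
  proof -
    have "(\<Sum>k<n. M' $$ (i, k)) = (\<Sum>k<n. M $$ (i, k)) + of_nat n * [:c:]"
      using i by (simp add: M'_idx sum.distrib)
    thus ?thesis using row[OF i] n by (simp add: of_nat_poly c_def)
  qed
  have MP: "M * P = D * Q"
  proof (rule eq_matI)
    fix i j assume "i < dim_row (D * Q)" "j < dim_col (D * Q)"
    hence i: "i < n" and j: "j < n" using D Q by auto
    have "(M * P) $$ (i, j) = (\<Sum>k<n. M $$ (i, k) * (if k = j \<or> j = 0 then 1 else 0))"
      using i j M P by (simp add: scalar_prod_def lessThan_atLeast0 P_def)
    also have "\<dots> = (if j = 0 then [:- r, 1:] else M $$ (i, j))"
      using i j row by (auto simp: if_distrib cong: if_cong)
    also have "\<dots> = (\<Sum>k<n. (if k = j then D $$ (i, k) * (if j = 0 then [:- r, 1:] else 1) else 0))"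
      using i j by (simp add: D_def)
    also have "\<dots> = (\<Sum>k<n. D $$ (i, k) * Q $$ (k, j))"
      using j by (intro sum.cong) (auto simp: Q_def)
    also have "\<dots> = (D * Q) $$ (i, j)"
      using i j D Q by (simp add: scalar_prod_def lessThan_atLeast0)
    finally show "(M * P) $$ (i, j) = (D * Q) $$ (i, j)" .
  qed (use M P D Q in auto)
  have MP': "M' * P = D * Q'"
  proof (rule eq_matI)
    fix i j assume "i < dim_row (D * Q')" "j < dim_col (D * Q')"
    hence i: "i < n" and j: "j < n" using D Q' by auto
    have "(M' * P) $$ (i, j) = (\<Sum>k<n. M' $$ (i, k) * (if k = j \<or> j = 0 then 1 else 0))"
      using i j M' P by (simp add: scalar_prod_def lessThan_atLeast0 P_def)
    also have "\<dots> = (if j = 0 then [:0, 1:] else M $$ (i, j) + [:c:])"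
      using i j row' by (auto simp: if_distrib M'_idx cong: if_cong)
    also have "\<dots> = (\<Sum>k<n. (if k = j then D $$ (i, k) * (if j = 0 then [:0, 1:] else 1) else 0)
        + (if k = 0 then (if j = 0 then 0 else [:c:]) else 0))"
      using i j n by (simp add: D_def sum.distrib)
    also have "\<dots> = (\<Sum>k<n. D $$ (i, k) * Q' $$ (k, j))"
      using i j by (intro sum.cong) (auto simp: Q'_def D_def)
    also have "\<dots> = (D * Q') $$ (i, j)"
      using i j D Q' by (simp add: scalar_prod_def lessThan_atLeast0)
    finally show "(M' * P) $$ (i, j) = (D * Q') $$ (i, j)" .
  qed (use M' P D Q' in auto)
  have detP: "det P = 1"
    using P by (subst det_lower_triangular[of n]) (auto simp: P_def prod_list_diag_prod)
  have detQ: "det Q = [:- r, 1:]"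
  proof -
    have "det Q = (\<Prod>i=0..<n. if i = 0 then [:- r, 1:] else 1)"
      using Q by (subst det_lower_triangular[of n]) (auto simp: Q_def prod_list_diag_prod intro!: prod.cong)
    thus ?thesis using n by simp
  qed
  have detQ': "det Q' = [:0, 1:]"
  proof -
    have "det Q' = (\<Prod>i=0..<n. if i = 0 then [:0, 1:] else 1)"
      using Q' by (subst det_upper_triangular[of _ n])
        (auto simp: Q'_def prod_list_diag_prod upper_triangular_def intro!: prod.cong)
    thus ?thesis using n by simp
  qed
  have "det M * det P = det D * det Q" using det_mult[OF M P] det_mult[OF D Q] MP by simp
  thus "char_poly A = [:- r, 1:] * det D"
    by (simp only: detP detQ char_poly_def M_def mult_1_right mult.commute)
  have "det M' * det P = det D * det Q'" using det_mult[OF M' P] det_mult[OF D Q'] MP' by simp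
  hence "char_poly A' = [:0, 1:] * det D"
    by (simp only: detP detQ' char_poly_def M'_def mult_1_right mult.commute)
  thus "char_poly (mat n n (\<lambda>ij. A $$ ij - r / n)) = [:0, 1:] * det D"
    by (simp add: A'_def c_def)
qed

text \<open>Compare both sides of the eigenvalue equation in a coordinate where the eigenvector is
  largest in absolute value. It serves to identify \<open>d\<close> as the largest
  eigenvalue.\<close>

lemma eigenvalue_le_row_sum:
  fixes A :: "real mat"
  assumes A: "A \<in> carrier_mat n n" and ev: "eigenvalue A e"
    and rows: "\<And>i. i < n \<Longrightarrow> (\<Sum>j<n. \<bar>A $$ (i, j)\<bar>) \<le> r"
  shows "\<bar>e\<bar> \<le> r"
proof -
  from ev obtain v where v: "v \<in> carrier_vec n" and v0: "v \<noteq> 0\<^sub>v n"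
    and Av: "A *\<^sub>v v = e \<cdot>\<^sub>v v"
    using A unfolding eigenvalue_def eigenvector_def by auto
  from v v0 obtain l where l: "l < n" "v $ l \<noteq> 0" by (metis carrier_vecD eq_vecI index_zero_vec)
  obtain i where i: "i < n" and imax: "\<And>j. j < n \<Longrightarrow> \<bar>v $ j\<bar> \<le> \<bar>v $ i\<bar>"
  proof -
    have "Max ((\<lambda>j. \<bar>v $ j\<bar>) ` {..<n}) \<in> (\<lambda>j. \<bar>v $ j\<bar>) ` {..<n}"
      using l(1) by (intro Max_in) auto
    then obtain i where i: "i < n" "Max ((\<lambda>j. \<bar>v $ j\<bar>) ` {..<n}) = \<bar>v $ i\<bar>" by auto
    moreover have "\<bar>v $ j\<bar> \<le> \<bar>v $ i\<bar>" if "j < n" for j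
      unfolding i(2)[symmetric] using that by (intro Max_ge) auto
    ultimately show ?thesis using that by blast
  qed
  have pos: "0 < \<bar>v $ i\<bar>" using imax[OF l(1)] l(2) by simp
  have "(\<Sum>j<n. A $$ (i, j) * v $ j) = e * v $ i"
  proof -
    have "(A *\<^sub>v v) $ i = (\<Sum>j<n. A $$ (i, j) * v $ j)"
      using i A v by (simp add: scalar_prod_def lessThan_atLeast0)
    thus ?thesis using Av i v by simp
  qed
  hence "\<bar>e\<bar> * \<bar>v $ i\<bar> = \<bar>\<Sum>j<n. A $$ (i, j) * v $ j\<bar>" by (simp add: abs_mult)
  also have "\<dots> \<le> (\<Sum>j<n. \<bar>A $$ (i, j)\<bar> * \<bar>v $ i\<bar>)"
    by (rule order_trans[OF sum_abs]) (auto simp: abs_mult intro!: sum_mono mult_left_mono imax)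
  also have "\<dots> = (\<Sum>j<n. \<bar>A $$ (i, j)\<bar>) * \<bar>v $ i\<bar>" by (simp add: sum_distrib_right)
  also have "\<dots> \<le> r * \<bar>v $ i\<bar>" using rows[OF i] by (simp add: mult_right_mono)
  finally show ?thesis using pos by simp
qed

lemma card_edges_between:
  assumes "finite X" "finite Y"
  shows "card (E \<inter> X \<times> Y) = (\<Sum>x\<in>X. card (nbhd E x \<inter> Y))"
proof -
  have "E \<inter> X \<times> Y = Sigma X (\<lambda>x. nbhd E x \<inter> Y)" by (auto simp: nbhd_def)
  thus ?thesis using assms by simp
qed

text \<open>Subtracting \<open>d / n\<close> from all entries of the adjacency matrix turns one
  eigenvalue \<open>d\<close> into 0 and keeps the rest. The result has norm at most
  \<open>max lam 0\<close>, where the 0 pays for the new eigenvalue. Apply it to the indicator of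
  \<open>Y\<close> and pair with the indicator of \<open>X\<close> by Cauchy-Schwarz.\<close>

theorem expander_mixing:
  assumes G: "ndl_graph n d lam E" and X: "X \<subseteq> {..<n}" and Y: "Y \<subseteq> {..<n}"
  shows "\<bar>real (card (E \<inter> X \<times> Y)) - d * card X * card Y / n\<bar>
    \<le> max lam 0 * sqrt (card X * card Y)"
proof -
  from G have n: "0 < n" and E: "E \<subseteq> {..<n} \<times> {..<n}" and "sym E"
    and deg: "\<And>x. x < n \<Longrightarrow> card (nbhd E x) = d"
    and gap: "\<And>e. e \<in># spectrum_mset n E - {#Max_mset (spectrum_mset n E)#} \<Longrightarrow> \<bar>e\<bar> \<le> lam"
    by (auto simp: ndl_graph_def regular_graph_def simple_graph_def)
  define A where "A = adj_mat n E"
  have A: "A \<in> carrier_mat n n" by (simp add: A_def adj_mat_def)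
  have A_idx: "A $$ (i, j) = (if (i, j) \<in> E then 1 else 0)" if "i < n" "j < n" for i j
    using that by (simp add: A_def adj_mat_def)
  have rows: "(\<Sum>j<n. A $$ (i, j)) = d" if i: "i < n" for i
  proof -
    have "(\<Sum>j<n. A $$ (i, j)) = (\<Sum>j\<in>{..<n}. if j \<in> nbhd E i then 1 else 0)"
      using i by (intro sum.cong) (auto simp: A_idx nbhd_def)
    also have "\<dots> = card ({..<n} \<inter> nbhd E i)" by (simp add: sum.If_cases Int_def)
    also have "{..<n} \<inter> nbhd E i = nbhd E i" using E by (auto simp: nbhd_def)
    finally show ?thesis using deg[OF i] by simp
  qed
  define B where "B = mat n n (\<lambda>ij. A $$ ij - d / n)"
  have B: "B \<in> carrier_mat n n" by (simp add: B_def)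
  obtain D where cA: "char_poly A = [:- real d, 1:] * D" and cB: "char_poly B = [:0, 1:] * D"
    using char_poly_deflate[OF A n rows] unfolding B_def by blast
  have "char_poly A \<noteq> 0" using degree_monic_char_poly[OF A] by auto
  hence D0: "D \<noteq> 0" using cA by auto
  have spec: "spectrum_mset n E = {#real d#} + proots D"
    unfolding spectrum_mset_def A_def[symmetric] cA using D0
    by (subst proots_mult) (auto simp: proots_linear_factor)
  have "\<bar>e\<bar> \<le> d" if "e \<in># spectrum_mset n E" for e
  proof -
    have "poly (char_poly A) e = 0"
      using that \<open>char_poly A \<noteq> 0\<close> by (simp add: spectrum_mset_def A_def)
    hence "eigenvalue A e" using eigenvalue_root_char_poly[OF A] by simp
    thus ?thesis
    proof (rule eigenvalue_le_row_sum[OF A])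
      fix i assume "i < n"
      thus "(\<Sum>j<n. \<bar>A $$ (i, j)\<bar>) \<le> d" using rows[of i] by (simp add: A_idx if_distrib cong: if_cong)
    qed
  qed
  \<comment> \<open>Removing one copy of the maximum from the spectrum therefore leaves exactly
    \<open>proots D\<close>, so the gap hypothesis covers every root of \<open>D\<close>, a further
    root \<open>d\<close> included.\<close>
  hence "Max_mset (spectrum_mset n E) = d" using spec by (intro Max_eqI) force+
  hence gapD: "\<bar>e\<bar> \<le> lam" if "poly D e = 0" for e
    using gap[of e] that spec D0 by simp
  have evB: "\<bar>x\<bar> \<le> max lam 0" if "poly (char_poly B) x = 0" for x
    using that gapD[of x] cB by auto
  have symB: "B $$ (i, j) = B $$ (j, i)" if "i < n" "j < n" for i j
    using that \<open>sym E\<close> by (auto simp: B_def A_idx sym_def)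
  define f where "f = vec n (\<lambda>j. if j \<in> Y then 1 else (0::real))"
  have f: "f \<in> carrier_vec n" by (simp add: f_def)
  have ff: "f \<bullet> f = card Y"
  proof -
    have "f \<bullet> f = (\<Sum>j<n. if j \<in> Y then 1 else 0)"
      by (auto simp: f_def scalar_prod_def lessThan_atLeast0 intro!: sum.cong)
    also have "\<dots> = card ({..<n} \<inter> Y)" by (simp add: sum.If_cases Int_def)
    also have "{..<n} \<inter> Y = Y" using Y by auto
    finally show ?thesis .
  qed
  define g where "g = B *\<^sub>v f"
  have g_idx: "g $ i = card (nbhd E i \<inter> Y) - d * card Y / n" if i: "i < n" for i
  proof -
    have "g $ i = (\<Sum>j<n. B $$ (i, j) * f $ j)"
      using i B f by (simp add: g_def scalar_prod_def lessThan_atLeast0)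
    also have "\<dots> = (\<Sum>j<n. (if j \<in> nbhd E i \<inter> Y then 1 else 0) - (if j \<in> Y then d / n else 0))"
      using i by (intro sum.cong) (auto simp: B_def A_idx f_def nbhd_def)
    also have "\<dots> = card ({..<n} \<inter> (nbhd E i \<inter> Y)) - card ({..<n} \<inter> Y) * (d / n)"
      by (simp add: sum_subtractf sum.If_cases Int_def)
    also have "{..<n} \<inter> (nbhd E i \<inter> Y) = nbhd E i \<inter> Y" using Y by auto
    also have "{..<n} \<inter> Y = Y" using Y by auto
    finally show ?thesis by (simp add: mult.commute)
  qed
  have finX: "finite X" using X finite_subset by blast
  have edges: "card (E \<inter> X \<times> Y) = (\<Sum>i\<in>X. card (nbhd E i \<inter> Y))"
    using finX Y by (intro card_edges_between) (auto intro: finite_subset)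
  have "real (card (E \<inter> X \<times> Y)) - d * card X * card Y / n = (\<Sum>i\<in>X. g $ i)"
  proof -
    have "(\<Sum>i\<in>X. g $ i) = (\<Sum>i\<in>X. card (nbhd E i \<inter> Y) - d * card Y / n)"
      using X by (intro sum.cong refl g_idx) auto
    also have "\<dots> = real (card (E \<inter> X \<times> Y)) - d * card X * card Y / n"
      by (simp add: sum_subtractf edges mult_ac)
    finally show ?thesis by simp
  qed
  moreover have "\<bar>\<Sum>i\<in>X. g $ i\<bar> \<le> max lam 0 * sqrt (card X * card Y)"
  proof -
    have "(\<Sum>i\<in>X. g $ i)\<^sup>2 \<le> card X * (\<Sum>i\<in>X. (g $ i)\<^sup>2)"
      using Cauchy_Schwarz_ineq_sum[of "\<lambda>_. 1" "\<lambda>i. g $ i" X] by simp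
    also have "(\<Sum>i\<in>X. (g $ i)\<^sup>2) \<le> (\<Sum>i<n. (g $ i)\<^sup>2)" using X by (intro sum_mono2) auto
    also have "(\<Sum>i<n. (g $ i)\<^sup>2) = g \<bullet> g"
      using B by (simp add: g_def scalar_prod_def power2_eq_square lessThan_atLeast0)
    also have "\<dots> \<le> (max lam 0)\<^sup>2 * card Y"
      using symmetric_mat_norm_le[OF B symB evB _ n f] ff by (simp add: g_def)
    finally have "(\<Sum>i\<in>X. g $ i)\<^sup>2 \<le> card X * ((max lam 0)\<^sup>2 * card Y)"
      by (simp add: mult_left_mono)
    hence "(\<Sum>i\<in>X. g $ i)\<^sup>2 \<le> (max lam 0)\<^sup>2 * (card X * card Y)"
      by (simp only: of_nat_mult mult_ac)
    hence "sqrt ((\<Sum>i\<in>X. g $ i)\<^sup>2) \<le> sqrt ((max lam 0)\<^sup>2 * (card X * card Y))"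
      by (rule real_sqrt_le_mono)
    thus ?thesis by (simp add: real_sqrt_mult)
  qed
  ultimately show ?thesis by simp
qed


section \<open>Star systems and the auction\<close>

definition kidset :: "(nat \<rightharpoonup> nat) \<Rightarrow> nat \<Rightarrow> nat set" where
  "kidset par v = {u. par u = Some v}"

lemma dom_eq_UN_kidset: "dom par = (\<Union>v\<in>ran par. kidset par v)"
  by (auto simp: kidset_def ran_def)

definition price :: "(nat \<times> nat) list \<Rightarrow> nat \<Rightarrow> nat" where
  "price H u = length (filter (\<lambda>e. fst e = u) H)"

lemma price_simps [simp]:
  "price [] u = 0" "price (e # H) u = (if fst e = u then Suc (price H u) else price H u)"
  by (simp_all add: price_def)

lemma price_pos_iff: "0 < price H u \<longleftrightarrow> (\<exists>v. map_of H u = Some v)"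
  by (induction H) auto

lemma sum_price: "fst ` set H \<subseteq> {..<n} \<Longrightarrow> (\<Sum>u<n. price H u) = length H"
proof (induction H)
  case (Cons e H)
  have "(\<Sum>u<n. price (e # H) u) = (\<Sum>u<n. price H u + (if u = fst e then 1 else 0))"
    by (intro sum.cong) auto
  also have "\<dots> = Suc (length H)" using Cons by (simp add: sum.distrib)
  finally show ?case by simp
qed simp

section \<open>Expansion, star systems and good sets of occupied vertices\<close>

locale expander =
  fixes n d m :: nat and E :: "(nat \<times> nat) set" and mu :: real and S :: "nat set"
  assumes E: "E \<subseteq> {..<n} \<times> {..<n}" and symE: "sym E"
    and deg: "x < n \<Longrightarrow> card (nbhd E x) = d"
    and mixing: "X \<subseteq> {..<n} \<Longrightarrow> Y \<subseteq> {..<n} \<Longrightarrow>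
      \<bar>real (card (E \<inter> X \<times> Y)) - d * card X * card Y / n\<bar> \<le> mu * sqrt (card X * card Y)"
    and mu: "0 \<le> mu" "320 * m * mu < d" and m: "3 \<le> m" and n: "28 \<le> n"
    and S: "S \<subseteq> {..<n}" and degS: "x < n \<Longrightarrow> 4 * card (nbhd E x \<inter> S) \<le> d"
begin

lemma nbhd_subset: "nbhd E x \<subseteq> {..<n}"
  using E by (auto simp: nbhd_def)

lemma finite_nbhd [simp]: "finite (nbhd E x)"
  using nbhd_subset finite_subset by blast

lemma d_pos: "0 < d"
proof -
  have "0 \<le> 320 * m * mu" using mu(1) by simp
  hence "0 < real d" using mu(2) by linarith
  thus ?thesis by simp
qed

lemma mu_m_le: "mu * m \<le> d / 320"
  using mu(2) by (simp add: field_simps)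

text \<open>Otherwise \<open>4 * card Y \<le> n\<close>, and mixing allows at most
  \<open>1 / 4 + 1 / 320\<close> of \<open>d * card X\<close> edges between \<open>X\<close> and
  \<open>Y\<close>, while \<open>dense\<close> demands half of it. This is the part of Hall's
  condition for vertices that have no star yet.\<close>

lemma low_expansion:
  assumes X: "X \<subseteq> {..<n}" and Y: "Y \<subseteq> {..<n}" and small: "4 * m * card X \<le> n"
    and dense: "\<And>x. x \<in> X \<Longrightarrow> d \<le> 2 * card (nbhd E x \<inter> Y)"
  shows "m * card X \<le> card Y"
proof (rule ccontr)
  assume "\<not> m * card X \<le> card Y"
  hence lt: "card Y < m * card X" by simp
  hence Xpos: "0 < card X" by (cases "card X") auto
  have fin: "finite X" "finite Y" using X Y finite_subset by blast+
  let ?x = "real (card X)" and ?y = "real (card Y)"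
  have y: "?y \<le> m * ?x" using lt by (metis less_imp_le of_nat_le_iff of_nat_mult)
  have "card X * d \<le> (\<Sum>x\<in>X. 2 * card (nbhd E x \<inter> Y))"
    using sum_bounded_below[of X d "\<lambda>x. 2 * card (nbhd E x \<inter> Y)"] dense by simp
  also have "\<dots> = 2 * card (E \<inter> X \<times> Y)"
    using card_edges_between[OF fin] by (simp add: sum_distrib_left)
  finally have "?x * d \<le> 2 * real (card (E \<inter> X \<times> Y))"
    by (metis of_nat_le_iff of_nat_mult of_nat_numeral)
  also have "\<dots> \<le> 2 * (d * ?x * ?y / n + mu * sqrt (?x * ?y))"
    using mixing[OF X Y] by (simp add: abs_le_iff)
  finally have main: "?x * d \<le> 2 * (d * ?x * ?y / n + mu * sqrt (?x * ?y))" .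
  have "4 * card Y \<le> n" using lt small by (simp add: mult.assoc)
  hence "4 * ?y \<le> n" by (metis of_nat_le_iff of_nat_mult of_nat_numeral)
  hence "d * ?x * (4 * ?y) \<le> d * ?x * n" by (intro mult_left_mono) auto
  hence 1: "d * ?x * ?y / n \<le> ?x * d / 4" using n by (simp add: field_simps)
  have "?x * ?y \<le> ?x * (m * ?x)" using y by (intro mult_left_mono) auto
  also have "\<dots> \<le> (m * ?x)\<^sup>2"
  proof -
    have "1 * ?x \<le> m * ?x" using m by (intro mult_right_mono) auto
    thus ?thesis unfolding power2_eq_square by (intro mult_right_mono) auto
  qed
  finally have "sqrt (?x * ?y) \<le> m * ?x" by (intro real_le_lsqrt) auto
  hence "mu * sqrt (?x * ?y) \<le> mu * (m * ?x)" using mu by (intro mult_left_mono) auto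
  also have "\<dots> = (mu * m) * ?x" by simp
  also have "\<dots> \<le> (d / 320) * ?x" using mu_m_le by (intro mult_right_mono) auto
  finally have 2: "mu * sqrt (?x * ?y) \<le> ?x * d / 320" by (simp add: mult.commute)
  have "\<not> 0 < b" if "b \<le> 2 * (t + s)" "t \<le> b / 4" "s \<le> b / 320" for b s t :: real
    using that by argo
  from this[OF main 1 2] have "\<not> 0 < ?x * d" .
  moreover have "0 < ?x * d" using Xpos d_pos by simp
  ultimately show False by blast
qed

text \<open>As \<open>16 * card Z \<le> n\<close>, the main term of mixing explains only a quarter
  of the required edges, and the error term must supply the rest. Squaring gives even
  \<open>3600 * m\<^sup>2 * card X \<le> card Z\<close>; the weaker factor \<open>32 * m\<close> is
  what later limits the stars of crowded vertices to a 32nd of the occupied vertices.\<close>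

lemma few_dense:
  assumes X: "X \<subseteq> {..<n}" and Z: "Z \<subseteq> {..<n}" and small: "16 * card Z \<le> n"
    and dense: "\<And>x. x \<in> X \<Longrightarrow> d \<le> 4 * card (nbhd E x \<inter> Z)"
  shows "32 * m * card X \<le> card Z"
proof (cases "card X = 0")
  case False
  have fin: "finite X" "finite Z" using X Z finite_subset by blast+
  let ?x = "real (card X)" and ?z = "real (card Z)"
  have xpos: "0 < ?x" using False by simp
  have "card X * d \<le> (\<Sum>x\<in>X. 4 * card (nbhd E x \<inter> Z))"
    using sum_bounded_below[of X d "\<lambda>x. 4 * card (nbhd E x \<inter> Z)"] dense by simp
  also have "\<dots> = 4 * card (E \<inter> X \<times> Z)"
    using card_edges_between[OF fin] by (simp add: sum_distrib_left)
  finally have "?x * d \<le> 4 * real (card (E \<inter> X \<times> Z))"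
    by (metis of_nat_le_iff of_nat_mult of_nat_numeral)
  also have "\<dots> \<le> 4 * (d * ?x * ?z / n + mu * sqrt (?x * ?z))"
    using mixing[OF X Z] by (simp add: abs_le_iff)
  finally have main: "?x * d \<le> 4 * (d * ?x * ?z / n + mu * sqrt (?x * ?z))" .
  have "16 * ?z \<le> n" using small by (metis of_nat_le_iff of_nat_mult of_nat_numeral)
  hence "d * ?x * (16 * ?z) \<le> d * ?x * n" by (intro mult_left_mono) auto
  hence t: "d * ?x * ?z / n \<le> (?x * d) / 16" using n by (simp add: field_simps)
  have "3 * b \<le> 16 * c" if "b \<le> 4 * (a + c)" "a \<le> b / 16" for a b c :: real
    using that by argo
  from this[OF main t] have "3 * (?x * d) \<le> 16 * (mu * sqrt (?x * ?z))" .
  hence "(3 * (?x * d)) * m \<le> 16 * (mu * sqrt (?x * ?z)) * m" by (intro mult_right_mono) auto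
  also have "\<dots> = (mu * m) * (16 * sqrt (?x * ?z))" by simp
  also have "\<dots> \<le> (d / 320) * (16 * sqrt (?x * ?z))" using mu_m_le by (intro mult_right_mono) auto
  finally have "d * (60 * ?x * m) \<le> d * sqrt (?x * ?z)" by (simp add: field_simps)
  hence "60 * ?x * m \<le> sqrt (?x * ?z)" using d_pos by simp
  hence "(60 * ?x * m)\<^sup>2 \<le> ?x * ?z"
    using power_mono[of "60 * ?x * m" "sqrt (?x * ?z)" 2] by simp
  hence "?x * (3600 * ?x * m * m) \<le> ?x * ?z" by (simp add: power2_eq_square algebra_simps)
  hence "3600 * ?x * m * m \<le> ?z" using xpos by simp
  moreover have low: "32 * m * ?x \<le> (3600 * ?x * m) * m"
  proof -
    have "32 * m * ?x \<le> 3600 * ?x * m" by (simp add: mult_left_mono)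
    also have "\<dots> = 3600 * ?x * m * 1" by simp
    also have "\<dots> \<le> 3600 * ?x * m * m" using m by (intro mult_left_mono) auto
    finally show ?thesis .
  qed
  ultimately have "32 * m * ?x \<le> ?z" by (rule_tac order_trans)
  hence "real (32 * m * card X) \<le> real (card Z)" by simp
  thus ?thesis by (simp only: of_nat_le_iff)
qed simp

text \<open>Without an edge the error term would have to cancel the whole main term, that is
  \<open>d * k \<le> mu * n \<le> 320 * m * mu * k\<close>, against \<open>320 * m * mu < d\<close>.
  This fixes the size at which the trees stop growing.\<close>

lemma large_sets_adjacent:
  assumes A: "A \<subseteq> {..<n}" and B: "B \<subseteq> {..<n}" and cards: "card A = k" "card B = k"
    and large: "0 < k" "n \<le> 320 * m * k"
  shows "\<exists>x\<in>A. \<exists>y\<in>B. (x, y) \<in> E"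
proof (rule ccontr)
  assume "\<not> ?thesis"
  hence "E \<inter> A \<times> B = {}" by auto
  hence "d * k * k / n \<le> mu * sqrt (real k * real k)" using mixing[OF A B] cards by simp
  hence "d * k * k / n \<le> mu * k" by simp
  hence "d * k * k \<le> mu * k * n" using n by (simp add: field_simps)
  also have "\<dots> \<le> mu * k * (320 * m * k)"
  proof (rule mult_left_mono)
    show "real n \<le> 320 * m * k" using large(2) by (metis of_nat_le_iff of_nat_mult of_nat_numeral)
  qed (use mu in simp)
  finally have "d * (real k * k) \<le> (320 * m * mu) * (real k * k)" by (simp add: algebra_simps)
  moreover have "0 < real k * k" using large by simp
  ultimately have "real d \<le> 320 * m * mu" by (rule_tac mult_right_le_imp_le)
  thus False using mu by simp
qed

text \<open>The map sends leaves to centres, so the leaf sets are disjoint by construction. A centre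
  may lie in \<open>S\<close> or be a leaf of another star: that is how the stars form trees rooted
  at the endpoints.\<close>

definition star_system :: "nat set \<Rightarrow> (nat \<rightharpoonup> nat) \<Rightarrow> bool" where
  "star_system U par \<longleftrightarrow> (\<forall>u v. par u = Some v \<longrightarrow> v < n \<and> v \<notin> U \<and> (v, u) \<in> E \<and> u \<notin> U \<union> S) \<and>
     (\<forall>v\<in>ran par. card (kidset par v) = m)"

definition crowded :: "nat set \<Rightarrow> (nat \<rightharpoonup> nat) \<Rightarrow> nat \<Rightarrow> bool" where
  "crowded U par v \<longleftrightarrow> d \<le> 2 * card (nbhd E v \<inter> (U \<union> S \<union> dom par))"

definition closed_for :: "nat set \<Rightarrow> (nat \<rightharpoonup> nat) \<Rightarrow> bool" where
  "closed_for U par \<longleftrightarrow> (\<forall>v<n. v \<notin> U \<longrightarrow> v \<notin> ran par \<longrightarrow> \<not> crowded U par v)"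

definition good :: "nat set \<Rightarrow> bool" where
  "good U \<longleftrightarrow> (\<exists>par. star_system U par \<and> closed_for U par)"

lemma crowded_mono: "crowded U par v \<Longrightarrow> U \<union> S \<union> dom par \<subseteq> U' \<union> S \<union> dom par' \<Longrightarrow> crowded U' par' v"
  unfolding crowded_def
  by (erule order_trans) (intro mult_le_mono2 card_mono; auto)

lemma good_empty: "good {}"
  unfolding good_def
proof (intro exI conjI)
  show "star_system {} Map.empty" by (simp add: star_system_def)
  have "\<not> d \<le> 2 * card (nbhd E v \<inter> S)" if "v < n" for v
    using degS[OF that] d_pos by linarith
  thus "closed_for {} Map.empty" by (simp add: closed_for_def crowded_def)
qed

text \<open>Drop the stars centred in \<open>P\<close>. By \<open>up\<close> the surviving stars
  have no leaf in \<open>P\<close>, so they stay complete. Since \<open>P\<close> was already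
  counted as occupied within \<open>dom W\<close> or \<open>S\<close>, no vertex becomes crowded,
  and the centres that lose their stars are now in the used set.\<close>

lemma good_extend:
  assumes W: "star_system U W" "closed_for U W" and P: "P \<subseteq> dom W \<union> S"
    and up: "\<And>u v. u \<in> P \<Longrightarrow> W u = Some v \<Longrightarrow> v \<in> P"
  shows "good (U \<union> P)"
  unfolding good_def
proof (intro exI conjI)
  define W' where "W' u = (case W u of None \<Rightarrow> None | Some v \<Rightarrow> if v \<in> P then None else Some v)" for u
  have W'_iff: "W' u = Some v \<longleftrightarrow> W u = Some v \<and> v \<notin> P" for u v
    by (auto simp: W'_def split: option.splits)
  have kids: "kidset W' v = kidset W v" if "v \<notin> P" for v using that by (auto simp: kidset_def W'_iff)
  have ran: "ran W' = ran W - P" by (auto simp: ran_def W'_iff)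
  show "star_system (U \<union> P) W'"
    using W(1) up unfolding star_system_def ran by (auto simp: W'_iff kids)
  show "closed_for (U \<union> P) W'"
    unfolding closed_for_def
  proof (intro allI impI notI)
    fix v assume v: "v < n" "v \<notin> U \<union> P" "v \<notin> ran W'" and c: "crowded (U \<union> P) W' v"
    have "dom W' \<subseteq> dom W" by (auto simp: W'_iff)
    hence "crowded U W v" using P by (intro crowded_mono[OF c]) auto
    thus False using v W(2) by (auto simp: closed_for_def ran)
  qed
qed

end

text \<open>One round of the growth of the two trees: the frozen stars \<open>par0\<close> are to be enlarged by a star
  for every vertex of \<open>Phi\<close>, the current leaves. Stars that are already known to exist (\<open>W\<close>) guarantee
  that the auction succeeds, but their leaves may be redistributed.\<close>

locale batch = expander +
  fixes U :: "nat set" and par0 W :: "nat \<rightharpoonup> nat" and F Phi :: "nat set"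
  assumes U: "U \<subseteq> {..<n}" and par0: "star_system U par0"
    and W: "star_system U W" "closed_for U W" and par0_W: "par0 \<subseteq>\<^sub>m W"
    and Phi: "Phi \<subseteq> {..<n} - U" and finF: "finite F"
    and forced: "\<And>v. v \<in> ran par0 \<Longrightarrow> v \<in> F \<or> crowded U par0 v"
    and room: "16 * card (U \<union> dom par0) \<le> n"
    and budget: "40 * (card U + m * (card F + card Phi)) \<le> n"
begin

definition cur :: "(nat \<times> nat) list \<Rightarrow> (nat \<rightharpoonup> nat)" where
  "cur H = par0 ++ map_of H"

definition needy :: "(nat \<times> nat) list \<Rightarrow> nat \<Rightarrow> bool" where
  "needy H v \<longleftrightarrow> v < n \<and> v \<notin> U \<and> (v \<in> Phi \<or> crowded U (cur H) v) \<and> card (kidset (cur H) v) < m"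

text \<open>Vertices sold earlier in the same auction remain candidates for other bidders; only
  frozen leaves are out of reach.\<close>

definition cand :: "nat \<Rightarrow> nat set" where
  "cand v = nbhd E v - (U \<union> S \<union> dom par0)"

definition valid_move :: "(nat \<times> nat) list \<Rightarrow> nat \<times> nat \<Rightarrow> bool" where
  "valid_move H e \<longleftrightarrow> needy H (snd e) \<and> fst e \<in> cand (snd e) \<and>
     (\<forall>u\<in>cand (snd e). price H (fst e) \<le> price H u)"

text \<open>The auction: a move \<open>(u, v)\<close> gives \<open>u\<close> to \<open>v\<close>, possibly taking it from a previous owner,
  and raises the price of \<open>u\<close> by one. The log \<open>H\<close> starts with the latest move, so \<open>map_of H\<close> is the
  current ownership.\<close>

inductive reachable :: "(nat \<times> nat) list \<Rightarrow> bool" where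
  start: "reachable []"
| move: "reachable H \<Longrightarrow> valid_move H e \<Longrightarrow> reachable (e # H)"

definition bidders :: "(nat \<times> nat) list \<Rightarrow> nat set" where
  "bidders H = {w. w < n \<and> w \<notin> U \<and> w \<notin> ran par0 \<and> (w \<in> Phi \<or> crowded U (cur H) w)}"

text \<open>The third clause is an approximate equilibrium: when sold, \<open>u\<close> was the
  cheapest candidate of its owner and then rose by one, and no price ever falls. The factor 16 in
  the fourth clause is the one required by \<open>few_dense\<close>.\<close>

definition invar :: "(nat \<times> nat) list \<Rightarrow> bool" where
  "invar H \<longleftrightarrow> (\<forall>(u, v)\<in>set H. v \<in> bidders H \<and> u \<in> cand v) \<and>
     (\<forall>v. card (kidset (cur H) v) \<le> m) \<and>
     (\<forall>u v. map_of H u = Some v \<longrightarrow> (\<forall>u'\<in>cand v. price H u \<le> Suc (price H u'))) \<and>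
     16 * card (U \<union> dom (cur H)) \<le> n \<and> (\<forall>u. price H u \<le> n)"

lemma finite_cand [simp]: "finite (cand v)"
  by (simp add: cand_def)

lemma star_system_child_less: "star_system U par \<Longrightarrow> par u = Some v \<Longrightarrow> u < n \<and> v < n"
  using E unfolding star_system_def by blast

lemma finite_kidset_star: "star_system U par \<Longrightarrow> finite (kidset par v)"
  by (rule finite_subset[of _ "{..<n}"]) (auto simp: kidset_def dest: star_system_child_less)

lemma dom_cur: "dom (cur H) = dom par0 \<union> fst ` set H"
  by (auto simp: cur_def dom_map_of_conv_image_fst)

lemma cur_Cons: "cur ((u, v) # H) = (cur H)(u \<mapsto> v)"
  by (simp add: cur_def)

lemma invar_map_of:
  assumes "invar H" "map_of H u = Some v" shows "v \<in> bidders H" "u \<in> cand v"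
  using assms map_of_SomeD[of H u v] unfolding invar_def by blast+

text \<open>Candidates avoid \<open>dom par0\<close>, so in \<open>cur\<close> the auction never
  overrides a frozen leaf.\<close>

lemma cur_eq: 
  assumes "invar H"
  shows "cur H u = Some v \<longleftrightarrow> par0 u = Some v \<or> map_of H u = Some v"
proof -
  have "par0 u = None" if "map_of H u = Some w" for w
    using invar_map_of(2)[OF assms that] by (auto simp: cand_def)
  thus ?thesis by (cases "map_of H u") (auto simp: cur_def map_add_def)
qed

lemma invar_par0_le: "invar H \<Longrightarrow> par0 \<subseteq>\<^sub>m cur H"
  unfolding map_le_def using cur_eq by (metis domD)

lemma invar_child_less: "invar H \<Longrightarrow> cur H u = Some v \<Longrightarrow> u < n \<and> v < n"
  using star_system_child_less[OF par0] invar_map_of[of H u v] nbhd_subset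
  by (fastforce simp: cur_eq bidders_def cand_def)

lemma finite_kidset: "invar H \<Longrightarrow> finite (kidset (cur H) v)"
  by (rule finite_subset[of _ "{..<n}"]) (auto simp: kidset_def dest: invar_child_less)

lemma crowded_cur_mono: "crowded U (cur H) v \<Longrightarrow> crowded U (cur (e # H)) v"
  by (erule crowded_mono) (auto simp: dom_cur)

lemma bidders_mono: "bidders H \<subseteq> bidders (e # H)"
  using crowded_cur_mono[of H _ e] unfolding bidders_def by blast

lemma finite_bidders [simp]: "finite (bidders H)"
  by (rule finite_subset[of _ "{..<n}"]) (auto simp: bidders_def)

text \<open>Half of the neighbourhood of a crowded vertex is occupied, and \<open>S\<close> accounts
  for at most a quarter of it. A quarter remains in \<open>U \<union> dom (cur H)\<close>, so
  \<open>few_dense\<close> applies.\<close>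

lemma card_crowded:
  assumes "invar H"
  shows "32 * m * card {w. w < n \<and> crowded U (cur H) w} \<le> card (U \<union> dom (cur H))"
proof (rule few_dense)
  show "U \<union> dom (cur H) \<subseteq> {..<n}" using U invar_child_less[OF assms] by auto
  show "16 * card (U \<union> dom (cur H)) \<le> n" using assms by (simp add: invar_def)
  fix w assume w: "w \<in> {w. w < n \<and> crowded U (cur H) w}"
  let ?Z = "U \<union> dom (cur H)"
  have "nbhd E w \<inter> (U \<union> S \<union> dom (cur H)) = (nbhd E w \<inter> ?Z) \<union> (nbhd E w \<inter> S)" by auto
  hence "card (nbhd E w \<inter> (U \<union> S \<union> dom (cur H))) \<le> card (nbhd E w \<inter> ?Z) + card (nbhd E w \<inter> S)"
    using card_Un_le by metis
  moreover have "4 * card (nbhd E w \<inter> S) \<le> d" using w degS by simp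
  moreover have "d \<le> 2 * card (nbhd E w \<inter> (U \<union> S \<union> dom (cur H)))" using w by (simp add: crowded_def)
  ultimately show "d \<le> 4 * card (nbhd E w \<inter> ?Z)" by linarith
qed auto

text \<open>\<open>F\<close> stands for the tips of earlier rounds. A centre that was crowded when
  its star was made is still crowded, because no occupied vertex is released during the
  auction.\<close>

lemma ran_cur_subset:
  assumes "invar H"
  shows "ran (cur H) \<subseteq> F \<union> Phi \<union> {w. w < n \<and> crowded U (cur H) w}"
proof
  fix v assume "v \<in> ran (cur H)"
  then obtain u where u: "cur H u = Some v" by (auto simp: ran_def)
  have "v < n" using invar_child_less[OF assms u] by simp
  show "v \<in> F \<union> Phi \<union> {w. w < n \<and> crowded U (cur H) w}"
  proof (cases "par0 u = Some v")
    case True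
    hence "v \<in> ran par0" by (auto simp: ran_def)
    moreover have "crowded U par0 v \<Longrightarrow> crowded U (cur H) v"
      by (erule crowded_mono) (auto simp: dom_cur)
    ultimately have "v \<in> F \<or> crowded U (cur H) v" using forced[of v] by blast
    thus ?thesis using \<open>v < n\<close> by auto
  next
    case False
    hence "v \<in> bidders H" using u invar_map_of[OF assms] cur_eq[OF assms] by blast
    thus ?thesis by (auto simp: bidders_def)
  qed
qed

text \<open>Let \<open>z\<close> be the number of occupied vertices. Stars of crowded centres take
  at most \<open>z / 32\<close>, so \<open>31 * z / 32 \<le> card U + m * (card F + card Phi) \<le>
  n / 40\<close>, hence \<open>38 * z \<le> n\<close>. The weak bound with 16 in
  \<open>invar\<close> thus improves itself, which leaves room for one more move.\<close>

lemma card_used_le: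
  assumes "invar H" shows "38 * card (U \<union> dom (cur H)) \<le> n"
proof -
  let ?Z = "U \<union> dom (cur H)" and ?Q = "{w. w < n \<and> crowded U (cur H) w}"
  have finPhi: "finite Phi" using Phi finite_subset by blast
  have fin: "finite (F \<union> Phi \<union> ?Q)" using finF finPhi by auto
  hence finran: "finite (ran (cur H))" using ran_cur_subset[OF assms] finite_subset by blast
  have "card (dom (cur H)) \<le> (\<Sum>v\<in>ran (cur H). card (kidset (cur H) v))"
    unfolding dom_eq_UN_kidset by (rule card_UN_le[OF finran])
  also have "\<dots> \<le> (\<Sum>v\<in>ran (cur H). m)"
    using assms by (intro sum_mono) (auto simp: invar_def)
  also have "\<dots> \<le> m * card (F \<union> Phi \<union> ?Q)"
    using card_mono[OF fin ran_cur_subset[OF assms]] by simp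
  also have "\<dots> \<le> m * (card F + card Phi + card ?Q)"
    by (intro mult_le_mono2) (meson add_le_mono1 card_Un_le order_trans)
  finally have "card ?Z \<le> card U + m * (card F + card Phi + card ?Q)"
    using card_Un_le[of U "dom (cur H)"] by linarith
  moreover have "32 * (m * card ?Q) \<le> card ?Z" using card_crowded[OF assms] by simp
  ultimately show ?thesis using budget by (simp add: algebra_simps)
qed

text \<open>Bidders with a star in \<open>W\<close> can count on its \<open>m\<close> leaves. Any
  other bidder is not crowded with respect to \<open>W\<close>, so at least half of its neighbours
  avoid \<open>U\<close>, \<open>S\<close> and \<open>dom W\<close>, and
  \<open>low_expansion\<close> applies; its size condition holds because crowded vertices are few.
  The two kinds of candidates are disjoint. \<open>W\<close> is only a witness here, unknown to the
  algorithm.\<close>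

lemma hall:
  assumes "invar H" and X: "X \<subseteq> bidders H"
  shows "m * card X \<le> card (\<Union>x\<in>X. cand x)"
proof -
  have finX: "finite X" using X finite_subset finite_bidders by blast
  define X1 X2 where "X1 = X \<inter> ran W" and "X2 = X - ran W"
  define Y1 where "Y1 = (\<Union>x\<in>X1. kidset W x)"
  define Y2 where "Y2 = (\<Union>x\<in>X2. nbhd E x) - (U \<union> S \<union> dom W)"
  have dom0: "dom par0 \<subseteq> dom W" using par0_W by (rule map_le_implies_dom_le)
  have "card Y1 = (\<Sum>x\<in>X1. card (kidset W x))"
    unfolding Y1_def using finX finite_kidset_star[OF W(1)]
    by (intro card_UN_disjoint) (auto simp: X1_def kidset_def)
  also have "\<dots> = m * card X1" using W(1) by (simp add: X1_def star_system_def)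
  finally have Y1: "card Y1 = m * card X1" .
  have "m * card X2 \<le> card Y2"
  proof (rule low_expansion)
    show "X2 \<subseteq> {..<n}" using X by (auto simp: X2_def bidders_def)
    show "Y2 \<subseteq> {..<n}" using nbhd_subset by (auto simp: Y2_def)
    have finPhi: "finite Phi" using Phi finite_subset by blast
    have "card X2 \<le> card (Phi \<union> {w. w < n \<and> crowded U (cur H) w})"
      using X finPhi by (intro card_mono) (auto simp: X2_def bidders_def)
    also have "\<dots> \<le> card Phi + card {w. w < n \<and> crowded U (cur H) w}" by (rule card_Un_le)
    finally have "4 * m * card X2 \<le> 4 * m * (card Phi + card {w. w < n \<and> crowded U (cur H) w})"
      by (rule mult_le_mono2)
    thus "4 * m * card X2 \<le> n"
      using card_crowded[OF assms(1)] card_used_le[OF assms(1)] budget by (simp add: algebra_simps)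
    fix x assume x: "x \<in> X2"
    hence xn: "x < n" and "x \<notin> U" "x \<notin> ran W" using X by (auto simp: X2_def bidders_def)
    hence "\<not> crowded U W x" using W(2) by (simp add: closed_for_def)
    moreover have "card (nbhd E x) = card (nbhd E x \<inter> (U \<union> S \<union> dom W)) + card (nbhd E x - (U \<union> S \<union> dom W))"
      by (metis card_Int_Diff finite_nbhd)
    moreover have "nbhd E x - (U \<union> S \<union> dom W) = nbhd E x \<inter> Y2" using x by (auto simp: Y2_def)
    ultimately show "d \<le> 2 * card (nbhd E x \<inter> Y2)" using deg[OF xn] by (simp add: crowded_def)
  qed
  moreover have "card X = card X1 + card X2"
    using finX by (simp add: X1_def X2_def card_Int_Diff)
  moreover have "Y1 \<inter> Y2 = {}" by (auto simp: Y1_def Y2_def kidset_def)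
  moreover have sub: "Y1 \<union> Y2 \<subseteq> (\<Union>x\<in>X. cand x)"
  proof -
    have "u \<in> cand x" if x: "x \<in> X1" and u: "W u = Some x" for u x
    proof -
      have "par0 u \<noteq> Some w" for w
      proof
        assume w: "par0 u = Some w"
        hence "W u = Some w" using par0_W by (metis domI map_le_def)
        hence "x \<in> ran par0" using u w by (auto simp: ran_def)
        thus False using x X by (auto simp: X1_def bidders_def)
      qed
      hence "u \<notin> dom par0" by (auto simp: dom_def)
      thus ?thesis using W(1) u by (auto simp: star_system_def cand_def nbhd_def)
    qed
    thus ?thesis using dom0 by (auto simp: Y1_def Y2_def X1_def X2_def kidset_def cand_def)
  qed
  moreover have "card (Y1 \<union> Y2) \<le> card (\<Union>x\<in>X. cand x)"
    using sub finX by (intro card_mono) auto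
  moreover have "finite Y1" "finite Y2"
    using sub finX by (auto intro: finite_subset[OF _ finite_UN_I[OF finX finite_cand]])
  ultimately show ?thesis using Y1 by (simp add: card_Un_disjoint algebra_simps)
qed

lemma needy_bidder:
  assumes "invar H" "needy H v" shows "v \<in> bidders H"
proof -
  have "v \<notin> ran par0"
  proof
    assume "v \<in> ran par0"
    hence "m = card (kidset par0 v)" using par0 by (simp add: star_system_def)
    also have "\<dots> \<le> card (kidset (cur H) v)"
      using cur_eq[OF assms(1)] by (intro card_mono finite_kidset assms(1)) (auto simp: kidset_def)
    finally show False using assms(2) by (simp add: needy_def)
  qed
  thus ?thesis using assms(2) by (auto simp: needy_def bidders_def)
qed

text \<open>If \<open>p\<close> were large, the sets \<open>X j\<close> of bidders all of whose candidates cost at least \<open>j\<close>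
  would form a strictly decreasing chain of length \<open>p\<close>: candidates of \<open>X (j + 1)\<close> are all owned,
  by members of \<open>X j\<close>, one of which, \<open>v\<close>, still owns fewer than \<open>m\<close> of them.\<close>

lemma price_bound:
  assumes inv: "invar H" and v: "needy H v" and p: "\<And>u. u \<in> cand v \<Longrightarrow> p \<le> price H u"
  shows "p < n"
proof -
  define X where "X j = {w \<in> bidders H. \<forall>u\<in>cand w. j \<le> price H u}" for j
  have vX: "v \<in> X j" if "j \<le> p" for j
    using needy_bidder[OF inv v] p that by (force simp: X_def)
  have finX: "finite (X j)" for j by (simp add: X_def)
  have dec: "card (X (Suc j)) < card (X j)" if "Suc j \<le> p" for j
  proof -
    have sub: "(\<Union>w\<in>X (Suc j). cand w) \<subseteq> (\<Union>w\<in>X j. kidset (cur H) w)"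
    proof
      fix u assume "u \<in> (\<Union>w\<in>X (Suc j). cand w)"
      hence pr: "Suc j \<le> price H u" by (auto simp: X_def)
      hence "0 < price H u" by linarith
      then obtain w where w: "map_of H u = Some w" by (auto simp: price_pos_iff)
      have "\<forall>u'\<in>cand w. price H u \<le> Suc (price H u')" using inv w by (simp add: invar_def)
      hence "\<forall>u'\<in>cand w. j \<le> price H u'" using pr by fastforce
      hence "w \<in> X j" using invar_map_of(1)[OF inv w] by (simp add: X_def)
      moreover have "u \<in> kidset (cur H) w" using w cur_eq[OF inv] by (simp add: kidset_def)
      ultimately show "u \<in> (\<Union>w\<in>X j. kidset (cur H) w)" by blast
    qed
    have "m * card (X (Suc j)) \<le> card (\<Union>w\<in>X (Suc j). cand w)"
      by (rule hall[OF inv]) (auto simp: X_def)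
    also have "\<dots> \<le> card (\<Union>w\<in>X j. kidset (cur H) w)"
      using finX finite_kidset[OF inv] by (intro card_mono[OF _ sub]) auto
    also have "\<dots> \<le> (\<Sum>w\<in>X j. card (kidset (cur H) w))" by (rule card_UN_le[OF finX])
    also have "\<dots> < (\<Sum>w\<in>X j. m)"
      using inv v vX[of j] that finX
      by (intro sum_strict_mono_ex1) (auto simp: invar_def needy_def)
    finally show ?thesis by simp
  qed
  have "j \<le> p \<Longrightarrow> card (X j) + j \<le> card (X 0)" for j
  proof (induction j)
    case (Suc j)
    thus ?case using dec[of j] by simp
  qed simp
  from this[of p] have "card (X p) + p \<le> card (X 0)" by simp
  moreover have "0 < card (X p)" using vX[of p] finX[of p] by (auto simp: card_gt_0_iff)
  moreover have "card (X 0) \<le> card {..<n}"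
    by (intro card_mono) (auto simp: X_def bidders_def)
  ultimately show ?thesis by simp
qed

lemma invar_reachable: "reachable H \<Longrightarrow> invar H"
proof (induction rule: reachable.induct)
  case start
  have "card (kidset par0 v) \<le> m" for v
    using par0 by (cases "v \<in> ran par0") (auto simp: star_system_def kidset_def ran_def)
  thus ?case using room by (simp add: invar_def cur_def)
next
  case (move H e)
  obtain u v where e: "e = (u, v)" by force
  note inv = \<open>invar H\<close>
  have needy: "needy H v" and u: "u \<in> cand v" and least: "\<forall>u'\<in>cand v. price H u \<le> price H u'"
    using move.hyps e by (auto simp: valid_move_def)
  have 1: "\<forall>(u', v')\<in>set (e # H). v' \<in> bidders (e # H) \<and> u' \<in> cand v'"
    using inv needy_bidder[OF inv needy] u bidders_mono[of H e] by (auto simp: invar_def e)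
  have 2: "card (kidset (cur (e # H)) w) \<le> m" for w
  proof (cases "w = v")
    case True
    have "kidset (cur (e # H)) v \<subseteq> insert u (kidset (cur H) v)"
      by (auto simp: e cur_Cons kidset_def)
    hence "card (kidset (cur (e # H)) v) \<le> card (insert u (kidset (cur H) v))"
      by (intro card_mono) (simp_all add: finite_kidset[OF inv])
    also have "\<dots> \<le> Suc (card (kidset (cur H) v))"
      by (simp add: card_insert_if finite_kidset[OF inv])
    finally have "card (kidset (cur (e # H)) v) \<le> Suc (card (kidset (cur H) v))" .
    thus ?thesis using needy True by (simp add: needy_def)
  next
    case False
    have "kidset (cur (e # H)) w \<subseteq> kidset (cur H) w" using False by (auto simp: e cur_Cons kidset_def)
    hence "card (kidset (cur (e # H)) w) \<le> card (kidset (cur H) w)"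
      by (intro card_mono finite_kidset inv)
    also have "\<dots> \<le> m" using inv by (simp add: invar_def)
    finally show ?thesis .
  qed
  have 3: "price (e # H) u1 \<le> Suc (price (e # H) u2)"
    if "map_of (e # H) u1 = Some w" "u2 \<in> cand w" for u1 u2 w
  proof (cases "u1 = u")
    case True
    hence "w = v" using that e by simp
    thus ?thesis using True that least e by auto
  next
    case False
    hence "price H u1 \<le> Suc (price H u2)" using that inv e by (auto simp: invar_def)
    thus ?thesis using False e by simp
  qed
  have "U \<union> dom (cur (e # H)) = insert u (U \<union> dom (cur H))" by (auto simp: dom_cur e)
  hence "card (U \<union> dom (cur (e # H))) \<le> Suc (card (U \<union> dom (cur H)))"
    by (cases "finite (U \<union> dom (cur H))") (simp_all add: card_insert_if del: finite_Un)
  \<comment> \<open>The move adds one vertex, and \<open>16 * (n / 38 + 1) \<le> n\<close> holds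
    from 28 on: the origin of the assumption \<open>28 \<le> n\<close>.\<close>
  hence 4: "16 * card (U \<union> dom (cur (e # H))) \<le> n" using card_used_le[OF inv] n by simp
  \<comment> \<open>The strict bound before the move becomes the bound \<open>n\<close> after the
    price has risen by one.\<close>
  have "price H u < n" using price_bound[OF inv needy] least by blast
  moreover have "price H u' \<le> n" for u' using inv by (simp add: invar_def)
  ultimately have 5: "price (e # H) u' \<le> n" for u' using e by (cases "u' = u") auto
  show ?case unfolding invar_def using 1 2 3 4 5 by blast
qed

text \<open>Every move raises exactly one price by one, so the number of moves is the sum of the
  \<open>n\<close> prices.\<close>

lemma length_reachable_le: "reachable H \<Longrightarrow> length H \<le> n * n"
proof -
  assume "reachable H"
  hence inv: "invar H" by (rule invar_reachable)
  have "fst ` set H \<subseteq> {..<n}" using inv nbhd_subset by (fastforce simp: invar_def cand_def)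
  hence "length H = (\<Sum>u<n. price H u)" by (simp add: sum_price)
  also have "\<dots> \<le> (\<Sum>u<n. n)" using inv by (intro sum_mono) (simp add: invar_def)
  finally show ?thesis by simp
qed

text \<open>Hall's condition for the single bidder \<open>v\<close> yields at least
  \<open>m > 0\<close> candidates, hence a cheapest one.\<close>

lemma valid_move_exists:
  assumes inv: "invar H" and v: "needy H v" shows "\<exists>u. valid_move H (u, v)"
proof -
  have "m * card {v} \<le> card (\<Union>x\<in>{v}. cand x)"
    using needy_bidder[OF inv v] by (intro hall[OF inv]) auto
  hence "cand v \<noteq> {}" using m by auto
  hence "Min (price H ` cand v) \<in> price H ` cand v" by (intro Min_in) auto
  then obtain u where u: "u \<in> cand v" "Min (price H ` cand v) = price H u" by auto
  have "price H u \<le> price H u'" if "u' \<in> cand v" for u'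
    unfolding u(2)[symmetric] using that by (intro Min_le) auto
  thus ?thesis using u v by (auto simp: valid_move_def)
qed

text \<open>\<open>xs\<close> is only a clock. Were there a move at every tick, the log would be
  longer than \<open>n * n\<close>. So some tick finds no valid move; the state then stays the same,
  and by \<open>valid_move_exists\<close> no vertex is needy.\<close>

lemma run_auction:
  assumes step: "\<And>H. reachable H \<Longrightarrow>
      (\<exists>e. valid_move H e \<and> f H = e # H) \<or> (\<nexists>e. valid_move H e) \<and> f H = H"
    and len: "n * n < length xs"
  shows "reachable (foldl (\<lambda>H _. f H) [] xs) \<and> (\<forall>v. \<not> needy (foldl (\<lambda>H _. f H) [] xs) v)"
proof -
  define H where "H = foldl (\<lambda>H _. f H) [] xs"
  have "reachable H \<and> (length H = length xs \<or> (\<nexists>e. valid_move H e))"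
    unfolding H_def
  proof (induction xs rule: rev_induct)
    case (snoc x xs)
    thus ?case using step[of "foldl (\<lambda>H _. f H) [] xs"] by (auto intro: reachable.move)
  qed (simp add: reachable.start)
  moreover from this have "length H \<noteq> length xs"
    using len length_reachable_le[of H] by linarith
  ultimately show ?thesis
    using valid_move_exists[OF invar_reachable] unfolding H_def by blast
qed

text \<open>When no vertex is needy, every bidder has all its \<open>m\<close> leaves. A crowded
  vertex or a vertex of \<open>Phi\<close> that is no centre would own \<open>0 < m\<close> leaves
  and be needy; this gives both closedness and \<open>Phi \<subseteq> ran (cur H)\<close>.\<close>

lemma auction_result:
  assumes "reachable H" and idle: "\<And>v. \<not> needy H v"
  shows "star_system U (cur H)" "closed_for U (cur H)" "par0 \<subseteq>\<^sub>m cur H" "Phi \<subseteq> ran (cur H)"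
    "38 * card (U \<union> dom (cur H)) \<le> n"
    "\<And>v. v \<in> ran (cur H) \<Longrightarrow> v \<in> F \<union> Phi \<or> crowded U (cur H) v"
proof -
  have inv: "invar H" using assms(1) by (rule invar_reachable)
  show "par0 \<subseteq>\<^sub>m cur H" by (rule invar_par0_le[OF inv])
  show "38 * card (U \<union> dom (cur H)) \<le> n" by (rule card_used_le[OF inv])
  show "v \<in> F \<union> Phi \<or> crowded U (cur H) v" if "v \<in> ran (cur H)" for v
    using ran_cur_subset[OF inv] that by blast
  have le_m: "card (kidset (cur H) v) \<le> m" for v using inv by (simp add: invar_def)
  have bid: "card (kidset (cur H) v) = m" if "v \<in> bidders H" for v
    using idle[of v] that le_m[of v] by (auto simp: needy_def bidders_def)
  have old: "card (kidset (cur H) v) = m" if "v \<in> ran par0" for v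
  proof -
    have "m = card (kidset par0 v)" using par0 that by (simp add: star_system_def)
    also have "\<dots> \<le> card (kidset (cur H) v)"
      using cur_eq[OF inv] by (intro card_mono finite_kidset inv) (auto simp: kidset_def)
    finally show ?thesis using le_m[of v] by simp
  qed
  show "star_system U (cur H)"
    unfolding star_system_def
  proof (intro conjI allI impI ballI)
    fix u v assume "cur H u = Some v"
    hence "par0 u = Some v \<or> map_of H u = Some v" by (simp add: cur_eq[OF inv])
    thus "v < n" "v \<notin> U" "(v, u) \<in> E" "u \<notin> U \<union> S"
      using par0 invar_map_of[OF inv, of u v]
      by (auto simp: star_system_def bidders_def cand_def nbhd_def)
  next
    fix v assume "v \<in> ran (cur H)"
    then obtain u where "par0 u = Some v \<or> map_of H u = Some v"
      by (auto simp: ran_def cur_eq[OF inv])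
    thus "card (kidset (cur H) v) = m" using old bid invar_map_of(1)[OF inv] by (auto simp: ran_def)
  qed
  have empty: "card (kidset (cur H) v) = 0" if "v \<notin> ran (cur H)" for v
    using that by (auto simp: kidset_def ran_def)
  show "closed_for U (cur H)"
    using idle empty m by (force simp: closed_for_def needy_def)
  show "Phi \<subseteq> ran (cur H)"
    using idle empty m Phi by (force simp: needy_def)
qed

end


section \<open>Polynomial time\<close>

text \<open>A single exponent stands for a polynomial. The summand 2 keeps the base at least 2, so
  that constants and sums are absorbed by a larger exponent even for the smallest inputs.\<close>

definition poly_bounded :: "('a \<Rightarrow> sexp) \<Rightarrow> ('a \<Rightarrow> nat) \<Rightarrow> bool" where
  "poly_bounded ea g \<longleftrightarrow> (\<exists>c. \<forall>x. g x \<le> (size (ea x) + 2) ^ c)"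

lemma poly_boundedI: "(\<And>x. g x \<le> (size (ea x) + 2) ^ c) \<Longrightarrow> poly_bounded ea g"
  unfolding poly_bounded_def by blast

lemma poly_bounded_mono: "poly_bounded ea h \<Longrightarrow> (\<And>x. g x \<le> h x) \<Longrightarrow> poly_bounded ea g"
  unfolding poly_bounded_def by (meson order_trans)

lemma poly_bounded_size [simp]: "poly_bounded ea (\<lambda>x. size (ea x))"
  by (rule poly_boundedI[where c = 1]) simp

lemma poly_bounded_const [simp]: "poly_bounded ea (\<lambda>_. k)"
proof (rule poly_boundedI[where c = k])
  fix x
  have "k \<le> 2 ^ k" by (simp add: less_imp_le)
  also have "\<dots> \<le> (size (ea x) + 2) ^ k" by (intro power_mono) auto
  finally show "k \<le> (size (ea x) + 2) ^ k" .
qed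

lemma poly_bounded_mult:
  assumes "poly_bounded ea g" "poly_bounded ea h"
  shows "poly_bounded ea (\<lambda>x. g x * h x)"
proof -
  from assms obtain c d where "\<And>x. g x \<le> (size (ea x) + 2) ^ c" "\<And>x. h x \<le> (size (ea x) + 2) ^ d"
    unfolding poly_bounded_def by blast
  hence "g x * h x \<le> (size (ea x) + 2) ^ (c + d)" for x by (simp only: power_add mult_le_mono)
  thus ?thesis by (rule poly_boundedI)
qed

lemma poly_bounded_add:
  assumes "poly_bounded ea g" "poly_bounded ea h"
  shows "poly_bounded ea (\<lambda>x. g x + h x)"
proof (rule poly_bounded_mono)
  \<comment> \<open>This product dominates \<open>g x + h x\<close> and reduces addition to
    multiplication.\<close>
  show "poly_bounded ea (\<lambda>x. 2 * ((g x + 1) * (h x + 1)))"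
  proof -
    have suc: "poly_bounded ea (\<lambda>x. f x + 1)" if f: "poly_bounded ea f" for f
    proof -
      from f obtain c where c: "\<And>x. f x \<le> (size (ea x) + 2) ^ c"
        unfolding poly_bounded_def by blast
      have "f x + 1 \<le> (size (ea x) + 2) ^ (c + 1)" for x
      proof -
        have "1 \<le> (size (ea x) + 2) ^ c" by simp
        hence "f x + 1 \<le> 2 * (size (ea x) + 2) ^ c" using c[of x] by linarith
        also have "\<dots> \<le> (size (ea x) + 2) * (size (ea x) + 2) ^ c" by (intro mult_right_mono) auto
        finally show ?thesis by simp
      qed
      thus ?thesis by (rule poly_boundedI)
    qed
    show ?thesis by (intro poly_bounded_mult poly_bounded_const suc assms)
  qed
qed (simp add: algebra_simps)

lemma poly_bounded_power:
  assumes "poly_bounded ea g" shows "poly_bounded ea (\<lambda>x. g x ^ k)"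
proof -
  from assms obtain c where "\<And>x. g x \<le> (size (ea x) + 2) ^ c"
    unfolding poly_bounded_def by blast
  hence "g x ^ k \<le> (size (ea x) + 2) ^ (c * k)" for x by (simp add: power_mult power_mono)
  thus ?thesis by (rule poly_boundedI)
qed

lemma poly_bounded_comp:
  assumes g: "poly_bounded eb g" and f: "poly_bounded ea (\<lambda>x. size (eb (f x)))"
  shows "poly_bounded ea (\<lambda>x. g (f x))"
proof -
  from g obtain c where "\<And>y. g y \<le> (size (eb y) + 2) ^ c" unfolding poly_bounded_def by blast
  moreover have "poly_bounded ea (\<lambda>x. (size (eb (f x)) + 2) ^ c)"
    by (intro poly_bounded_power poly_bounded_add f poly_bounded_const)
  ultimately show ?thesis by (rule_tac poly_bounded_mono) auto
qed

lemmas poly_bounded_intros =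
  poly_bounded_size poly_bounded_const poly_bounded_add poly_bounded_mult poly_bounded_power

text \<open>The bound on the size of the output is not implied by the bound on the time, because the
  machine shares subtrees.\<close>

definition poly_time :: "('a \<Rightarrow> sexp) \<Rightarrow> ('b \<Rightarrow> sexp) \<Rightarrow> ('a \<Rightarrow> 'b) \<Rightarrow> bool" where
  "poly_time ea eb f \<longleftrightarrow> poly_bounded ea (\<lambda>x. size (eb (f x))) \<and>
     (\<exists>p g. poly_bounded ea g \<and> (\<forall>x. \<exists>t\<le>g x. runs p (ea x) t (eb (f x))))"

lemma poly_timeI:
  assumes "poly_bounded ea (\<lambda>x. size (eb (f x)))" "poly_bounded ea g"
    and "\<And>x. \<exists>t\<le>g x. runs p (ea x) t (eb (f x))"
  shows "poly_time ea eb f"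
  using assms unfolding poly_time_def by blast

lemma poly_time_size: "poly_time ea eb f \<Longrightarrow> poly_bounded ea (\<lambda>x. size (eb (f x)))"
  by (simp add: poly_time_def)

lemma poly_time_recode:
  assumes "poly_time ea eb f" "\<And>x. eb' (f' x) = eb (f x)"
  shows "poly_time ea eb' f'"
  using assms by (simp add: poly_time_def)

lemma pt_id: "poly_time e e (\<lambda>x. x)"
  by (rule poly_timeI[where g = "\<lambda>_. 1" and p = Arg]) (auto intro!: exI[of _ 1] runs.Arg simp del: One_nat_def)

lemma pt_comp:
  assumes g: "poly_time eb ec g" and f: "poly_time ea eb f"
  shows "poly_time ea ec (\<lambda>x. g (f x))"
proof -
  from f obtain p s where s: "poly_bounded ea s" "\<And>x. \<exists>t\<le>s x. runs p (ea x) t (eb (f x))"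
    unfolding poly_time_def by blast
  from g obtain q r where r: "poly_bounded eb r" "\<And>x. \<exists>t\<le>r x. runs q (eb x) t (ec (g x))"
    unfolding poly_time_def by blast
  show ?thesis
  proof (rule poly_timeI[where p = "Seq p q"])
    show "poly_bounded ea (\<lambda>x. size (ec (g (f x))))"
      using poly_bounded_comp[OF poly_time_size[OF g] poly_time_size[OF f]] .
    show "poly_bounded ea (\<lambda>x. s x + r (f x) + 1)"
      by (intro poly_bounded_intros s(1) poly_bounded_comp[OF r(1)] poly_time_size[OF f])
    fix x
    from s(2)[of x] obtain t where t: "t \<le> s x" "runs p (ea x) t (eb (f x))" by blast
    from r(2)[of "f x"] obtain t' where t': "t' \<le> r (f x)" "runs q (eb (f x)) t' (ec (g (f x)))" by blast
    show "\<exists>t\<le>s x + r (f x) + 1. runs (Seq p q) (ea x) t (ec (g (f x)))"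
      using runs.Seq[OF t(2) t'(2)] t(1) t'(1) by (intro exI[of _ "t + t' + 1"]) auto
  qed
qed

lemma pt_const: "poly_time ea eb (\<lambda>_. c)"
proof -
  have "\<exists>p t. \<forall>x. runs p x t s" for s
  proof (induction s)
    case NIL
    show ?case using runs.Empty by blast
  next
    case (CONS u v)
    then obtain p t q r where "\<And>x. runs p x t u" "\<And>x. runs q x r v" by blast
    hence "runs (Fork p q) x (t + r + 1) (CONS u v)" for x by (intro runs.Fork) auto
    thus ?case by blast
  qed
  then obtain p t where "\<And>x. runs p x t (eb c)" by blast
  thus ?thesis by (intro poly_timeI[where g = "\<lambda>_. t" and p = p]) auto
qed

lemma pt_fork:
  assumes f: "poly_time ea eb f" and g: "poly_time ea ec g"
    and h: "\<And>x. ed (h x) = CONS (eb (f x)) (ec (g x))"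
  shows "poly_time ea ed h"
proof -
  from f obtain p s where s: "poly_bounded ea s" "\<And>x. \<exists>t\<le>s x. runs p (ea x) t (eb (f x))"
    unfolding poly_time_def by blast
  from g obtain q r where r: "poly_bounded ea r" "\<And>x. \<exists>t\<le>r x. runs q (ea x) t (ec (g x))"
    unfolding poly_time_def by blast
  show ?thesis
  proof (rule poly_timeI[where p = "Fork p q"])
    show "poly_bounded ea (\<lambda>x. size (ed (h x)))"
      unfolding h sexp.size using poly_time_size[OF f] poly_time_size[OF g]
      by (auto intro!: poly_bounded_intros simp flip: One_nat_def)
    show "poly_bounded ea (\<lambda>x. s x + r x + 1)"
      by (intro poly_bounded_intros s(1) r(1))
    fix x
    from s(2)[of x] obtain t where t: "t \<le> s x" "runs p (ea x) t (eb (f x))" by blast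
    from r(2)[of x] obtain t' where t': "t' \<le> r x" "runs q (ea x) t' (ec (g x))" by blast
    show "\<exists>t\<le>s x + r x + 1. runs (Fork p q) (ea x) t (ed (h x))"
      using runs.Fork[OF t(2) t'(2)] t(1) t'(1) by (intro exI[of _ "t + t' + 1"]) (auto simp: h)
  qed
qed

lemma size_tail_le: "size (tail s) \<le> size s" and size_head_le: "size (head s) \<le> size s"
  by (cases s; simp)+

lemma pt_tail:
  assumes f: "poly_time ea eb f" and h: "\<And>x. ec (h x) = tail (eb (f x))"
  shows "poly_time ea ec h"
proof -
  have "poly_time (\<lambda>s. s) (\<lambda>s. s) tail"
    by (rule poly_timeI[where g = "\<lambda>_. 1" and p = Tail])
      (auto intro!: exI[of _ 1] runs.Tail simp del: One_nat_def intro: poly_bounded_mono[OF poly_bounded_size] size_tail_le)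
  moreover have "poly_time ea (\<lambda>s. s) (\<lambda>x. eb (f x))" using f by (rule poly_time_recode) simp
  ultimately have "poly_time ea (\<lambda>s. s) (\<lambda>x. tail (eb (f x)))" by (rule pt_comp)
  thus ?thesis by (rule poly_time_recode) (simp add: h)
qed

lemma pt_head:
  assumes f: "poly_time ea eb f" and h: "\<And>x. ec (h x) = head (eb (f x))"
  shows "poly_time ea ec h"
proof -
  have "poly_time (\<lambda>s. s) (\<lambda>s. s) head"
    by (rule poly_timeI[where g = "\<lambda>_. 1" and p = Head])
      (auto intro!: exI[of _ 1] runs.Head simp del: One_nat_def intro: poly_bounded_mono[OF poly_bounded_size] size_head_le)
  moreover have "poly_time ea (\<lambda>s. s) (\<lambda>x. eb (f x))" using f by (rule poly_time_recode) simp
  ultimately have "poly_time ea (\<lambda>s. s) (\<lambda>x. head (eb (f x)))" by (rule pt_comp)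
  thus ?thesis by (rule poly_time_recode) (simp add: h)
qed

definition enc_prod :: "('a \<Rightarrow> sexp) \<Rightarrow> ('b \<Rightarrow> sexp) \<Rightarrow> 'a \<times> 'b \<Rightarrow> sexp" where
  "enc_prod ea eb z = CONS (ea (fst z)) (eb (snd z))"

lemma pt_pair: "poly_time ea eb f \<Longrightarrow> poly_time ea ec g \<Longrightarrow> poly_time ea (enc_prod eb ec) (\<lambda>x. (f x, g x))"
  by (erule (1) pt_fork) (simp add: enc_prod_def)

lemma pt_fst: "poly_time ea (enc_prod eb ec) f \<Longrightarrow> poly_time ea eb (\<lambda>x. fst (f x))"
  by (erule pt_head) (simp add: enc_prod_def)

lemma pt_snd: "poly_time ea (enc_prod eb ec) f \<Longrightarrow> poly_time ea ec (\<lambda>x. snd (f x))"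
  by (erule pt_tail) (simp add: enc_prod_def)

lemma pt_let:
  assumes f: "poly_time ea eb f" and h: "poly_time (enc_prod ea eb) ec (\<lambda>z. h (fst z) (snd z))"
  shows "poly_time ea ec (\<lambda>x. let y = f x in h x y)"
  using pt_comp[OF h pt_pair[OF pt_id f]] by (simp add: Let_def)

definition enc_bool :: "bool \<Rightarrow> sexp" where
  "enc_bool b = (if b then CONS NIL NIL else NIL)"

lemma pt_if:
  assumes c: "poly_time ea enc_bool c" and f: "poly_time ea eb f" and g: "poly_time ea eb g"
  shows "poly_time ea eb (\<lambda>x. if c x then f x else g x)"
proof -
  from c obtain o' u where u: "poly_bounded ea u" "\<And>x. \<exists>t\<le>u x. runs o' (ea x) t (enc_bool (c x))"
    unfolding poly_time_def by blast
  from f obtain p s where s: "poly_bounded ea s" "\<And>x. \<exists>t\<le>s x. runs p (ea x) t (eb (f x))"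
    unfolding poly_time_def by blast
  from g obtain q r where r: "poly_bounded ea r" "\<And>x. \<exists>t\<le>r x. runs q (ea x) t (eb (g x))"
    unfolding poly_time_def by blast
  show ?thesis
  proof (rule poly_timeI[where p = "Cond o' p q"])
    show "poly_bounded ea (\<lambda>x. size (eb (if c x then f x else g x)))"
      by (rule poly_bounded_mono[OF poly_bounded_add[OF poly_time_size[OF f] poly_time_size[OF g]]]) auto
    show "poly_bounded ea (\<lambda>x. u x + (s x + r x) + 1)"
      by (intro poly_bounded_intros s(1) r(1) u(1))
    fix x
    from u(2)[of x] obtain v where v: "v \<le> u x" "runs o' (ea x) v (enc_bool (c x))" by blast
    from s(2)[of x] obtain t where t: "t \<le> s x" "runs p (ea x) t (eb (f x))" by blast
    from r(2)[of x] obtain t' where t': "t' \<le> r x" "runs q (ea x) t' (eb (g x))" by blast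
    show "\<exists>t\<le>u x + (s x + r x) + 1. runs (Cond o' p q) (ea x) t (eb (if c x then f x else g x))"
    proof (cases "c x")
      case True
      hence "runs (Cond o' p q) (ea x) (v + t + 1) (eb (f x))"
        using v t by (intro runs.Cond_true[of _ _ _ "enc_bool True"]) (auto simp: enc_bool_def)
      thus ?thesis using True v(1) t(1) by (intro exI[of _ "v + t + 1"]) auto
    next
      case False
      hence "runs (Cond o' p q) (ea x) (v + t' + 1) (eb (g x))"
        using v t' by (intro runs.Cond_false) (auto simp: enc_bool_def)
      thus ?thesis using False v(1) t'(1) by (intro exI[of _ "v + t' + 1"]) auto
    qed
  qed
qed

lemma pt_conj:
  assumes "poly_time ea enc_bool c" "poly_time ea enc_bool d"
  shows "poly_time ea enc_bool (\<lambda>x. c x \<and> d x)"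
  by (rule poly_time_recode[OF pt_if[OF assms pt_const[where eb = enc_bool and c = False]]]) auto

lemma pt_disj:
  assumes "poly_time ea enc_bool c" "poly_time ea enc_bool d"
  shows "poly_time ea enc_bool (\<lambda>x. c x \<or> d x)"
  by (rule poly_time_recode[OF pt_if[OF assms(1) pt_const[where eb = enc_bool and c = True] assms(2)]]) auto

lemma pt_not:
  assumes "poly_time ea enc_bool c" shows "poly_time ea enc_bool (\<lambda>x. \<not> c x)"
  by (rule poly_time_recode[OF pt_if[OF assms pt_const[where eb = enc_bool and c = False] pt_const[where eb = enc_bool and c = True]]]) auto

lemma pt_Cons:
  "poly_time ea eb f \<Longrightarrow> poly_time ea (enc_list eb) l \<Longrightarrow> poly_time ea (enc_list eb) (\<lambda>x. f x # l x)"
  by (erule (1) pt_fork) simp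

lemma pt_tl:
  assumes "poly_time ea (enc_list eb) l" shows "poly_time ea (enc_list eb) (\<lambda>x. tl (l x))"
proof (rule pt_tail[OF assms])
  show "enc_list eb (tl (l x)) = tail (enc_list eb (l x))" for x by (cases "l x") auto
qed

lemma size_enc_list_append:
  "size (enc_list e (xs @ ys)) = size (enc_list e xs) + size (enc_list e ys)"
  by (induction xs) auto

lemma size_enc_elem: "x \<in> set xs \<Longrightarrow> size (e x) < size (enc_list e xs)"
  by (induction xs) auto

lemma length_le_size_enc: "length xs \<le> size (enc_list e xs)"
  by (induction xs) auto

lemma size_enc_filter: "size (enc_list e (filter P xs)) \<le> size (enc_list e xs)"
  by (induction xs) auto

lemma size_enc_take: "size (enc_list e (take k xs)) \<le> size (enc_list e xs)"
  by (metis append_take_drop_id le_add1 size_enc_list_append)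

lemma size_enc_list_le:
  "(\<And>x. x \<in> set xs \<Longrightarrow> size (e x) \<le> b) \<Longrightarrow> size (enc_list e xs) \<le> length xs * (b + 1)"
  by (induction xs) (force simp: algebra_simps)+

text \<open>The loop works on states \<open>(env, (remaining list, accumulator))\<close>.\<close>

definition fold_guard :: prog where
  "fold_guard = Seq Tail Head"

text \<open>One iteration: \<open>p\<close> receives the environment, the accumulator and the head
  of the list; the environment is kept and the list loses its head.\<close>

definition fold_body :: "prog \<Rightarrow> prog" where
  "fold_body p = Fork Head (Fork (Seq fold_guard Tail)
     (Seq (Fork Head (Fork (Seq Tail Tail) (Seq fold_guard Head))) p))"

lemma runs_fold_guard: "runs fold_guard (CONS u (CONS v w)) 3 v"
  using runs.Seq[OF runs.Tail runs.Head, of "CONS u (CONS v w)"]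
  by (simp add: fold_guard_def numeral_eq_Suc)

lemma runs_fold_body:
  assumes "runs p (CONS u (CONS w v)) t w'"
  shows "runs (fold_body p) (CONS u (CONS (CONS v vs) w)) (t + 20) (CONS u (CONS vs w'))"
proof -
  let ?z = "CONS u (CONS (CONS v vs) w)"
  have 1: "runs Head ?z 1 u" using runs.Head[of ?z] by simp
  have 2: "runs (Seq fold_guard Tail) ?z 5 vs"
    using runs.Seq[OF runs_fold_guard runs.Tail, of u "CONS v vs" w] by (simp add: numeral_eq_Suc)
  have 3: "runs (Seq fold_guard Head) ?z 5 v"
    using runs.Seq[OF runs_fold_guard runs.Head, of u "CONS v vs" w] by (simp add: numeral_eq_Suc)
  have 4: "runs (Seq Tail Tail) ?z 3 w"
    using runs.Seq[OF runs.Tail runs.Tail, of ?z] by (simp add: numeral_eq_Suc)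
  have 5: "runs (Fork Head (Fork (Seq Tail Tail) (Seq fold_guard Head))) ?z 11 (CONS u (CONS w v))"
    using runs.Fork[OF 1 runs.Fork[OF 4 3]] by (simp add: numeral_eq_Suc)
  show ?thesis
    using runs.Fork[OF 1 runs.Fork[OF 2 runs.Seq[OF 5 assms]]] by (simp add: fold_body_def numeral_eq_Suc)
qed

lemma runs_fold_loop:
  assumes "\<And>ys y zs. xs = ys @ y # zs \<Longrightarrow>
    \<exists>t\<le>M. runs p (CONS u (CONS (eb (foldl f a ys)) (ec y))) t (eb (f (foldl f a ys) y))"
  shows "\<exists>t\<le>length xs * (M + 24) + 4. runs (Loop fold_guard (fold_body p))
    (CONS u (CONS (enc_list ec xs) (eb a))) t (CONS u (CONS NIL (eb (foldl f a xs))))"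
  using assms
proof (induction xs arbitrary: a)
  case Nil
  have "runs (Loop fold_guard (fold_body p)) (CONS u (CONS NIL (eb a))) (3 + 1) (CONS u (CONS NIL (eb a)))"
    by (rule runs.Loop_stop[OF runs_fold_guard])
  thus ?case by (intro exI[of _ 4]) auto
next
  case (Cons x xs)
  from Cons.prems[of "[]" x xs] obtain s where s: "s \<le> M"
    and ps: "runs p (CONS u (CONS (eb a) (ec x))) s (eb (f a x))" by auto
  have "\<exists>t\<le>length xs * (M + 24) + 4. runs (Loop fold_guard (fold_body p))
    (CONS u (CONS (enc_list ec xs) (eb (f a x)))) t (CONS u (CONS NIL (eb (foldl f (f a x) xs))))"
  proof (rule Cons.IH)
    fix ys y zs assume "xs = ys @ y # zs"
    thus "\<exists>t\<le>M. runs p (CONS u (CONS (eb (foldl f (f a x) ys)) (ec y))) t (eb (f (foldl f (f a x) ys) y))"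
      using Cons.prems[of "x # ys" y zs] by simp
  qed
  then obtain r where r: "r \<le> length xs * (M + 24) + 4" and loop: "runs (Loop fold_guard (fold_body p))
    (CONS u (CONS (enc_list ec xs) (eb (f a x)))) r (CONS u (CONS NIL (eb (foldl f (f a x) xs))))" by blast
  have "runs (Loop fold_guard (fold_body p)) (CONS u (CONS (enc_list ec (x # xs)) (eb a)))
     (3 + (s + 20) + r + 1) (CONS u (CONS NIL (eb (foldl f a (x # xs)))))"
    using runs.Loop_step[OF runs_fold_guard _ runs_fold_body[OF ps] loop] by simp
  thus ?case using s r by (intro exI[of _ "3 + (s + 20) + r + 1"]) auto
qed

text \<open>Iterating a polynomial-time step may take exponential time when the accumulator grows
  geometrically. Hence the bound \<open>B\<close> on all intermediate accumulators; with it one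
  polynomial \<open>M\<close> limits the time of every step.\<close>

lemma pt_foldl:
  assumes step: "poly_time (enc_prod ea (enc_prod eb ec)) eb (\<lambda>z. g (fst z) (fst (snd z)) (snd (snd z)))"
    and l: "poly_time ea (enc_list ec) l" and i: "poly_time ea eb i"
    and B: "poly_bounded ea B"
    and bound: "\<And>x ys zs. l x = ys @ zs \<Longrightarrow> size (eb (foldl (g x) (i x) ys)) \<le> B x"
  shows "poly_time ea eb (\<lambda>x. foldl (g x) (i x) (l x))"
proof -
  from step obtain p s where s: "poly_bounded (enc_prod ea (enc_prod eb ec)) s"
    and p: "\<And>z. \<exists>t\<le>s z. runs p (enc_prod ea (enc_prod eb ec) z) t (eb (g (fst z) (fst (snd z)) (snd (snd z))))"
    unfolding poly_time_def by blast
  from s obtain c where c: "\<And>z. s z \<le> (size (enc_prod ea (enc_prod eb ec) z) + 2) ^ c"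
    unfolding poly_bounded_def by blast
  define M where "M x = (size (ea x) + B x + size (enc_list ec (l x)) + 4) ^ c" for x
  have M: "poly_bounded ea M"
    unfolding M_def by (intro poly_bounded_intros B poly_time_size[OF l])
  have "poly_time ea (enc_prod ea (enc_prod (enc_list ec) eb)) (\<lambda>x. (x, (l x, i x)))"
    by (rule pt_pair pt_id l i)+
  then obtain q r where r: "poly_bounded ea r"
    and q: "\<And>x. \<exists>t\<le>r x. runs q (ea x) t (CONS (ea x) (CONS (enc_list ec (l x)) (eb (i x))))"
    unfolding enc_prod_def fst_conv snd_conv poly_time_def by blast
  show ?thesis
  proof (rule poly_timeI[where p = "Seq q (Seq (Loop fold_guard (fold_body p)) (Seq Tail Tail))"])
    show "poly_bounded ea (\<lambda>x. size (eb (foldl (g x) (i x) (l x))))"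
      using bound by (rule_tac poly_bounded_mono[OF B]) (metis append_Nil2)
    show "poly_bounded ea (\<lambda>x. r x + (size (enc_list ec (l x)) * (M x + 24) + 4) + 5)"
      by (intro poly_bounded_intros r M poly_time_size[OF l])
    fix x
    let ?y = "foldl (g x) (i x) (l x)"
    have "\<exists>t\<le>length (l x) * (M x + 24) + 4. runs (Loop fold_guard (fold_body p))
      (CONS (ea x) (CONS (enc_list ec (l x)) (eb (i x)))) t (CONS (ea x) (CONS NIL (eb ?y)))"
    proof (rule runs_fold_loop)
      fix ys y zs assume l_eq: "l x = ys @ y # zs"
      let ?a = "foldl (g x) (i x) ys"
      have "s (x, (?a, y)) \<le> (size (ea x) + (size (eb ?a) + size (ec y)) + 4) ^ c"
        using c[of "(x, (?a, y))"] by (simp add: enc_prod_def numeral_eq_Suc)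
      also have "\<dots> \<le> M x"
        unfolding M_def using bound[OF l_eq] size_enc_elem[of y "l x" ec] l_eq
        by (intro power_mono) auto
      finally have "s (x, (?a, y)) \<le> M x" .
      moreover from p[of "(x, (?a, y))"] obtain t where "t \<le> s (x, (?a, y))"
        "runs p (CONS (ea x) (CONS (eb ?a) (ec y))) t (eb (g x ?a y))"
        by (auto simp: enc_prod_def)
      ultimately show "\<exists>t\<le>M x. runs p (CONS (ea x) (CONS (eb ?a) (ec y))) t (eb (g x ?a y))"
        using order_trans by blast
    qed
    then obtain t where t: "t \<le> length (l x) * (M x + 24) + 4" and loop: "runs (Loop fold_guard (fold_body p))
      (CONS (ea x) (CONS (enc_list ec (l x)) (eb (i x)))) t (CONS (ea x) (CONS NIL (eb ?y)))" by blast
    have t2: "t \<le> size (enc_list ec (l x)) * (M x + 24) + 4"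
      using t mult_le_mono1[OF length_le_size_enc] by (meson add_le_mono1 order_trans)
    from q[of x] obtain t' where t': "t' \<le> r x"
      "runs q (ea x) t' (CONS (ea x) (CONS (enc_list ec (l x)) (eb (i x))))" by blast
    have "runs (Seq Tail Tail) (CONS (ea x) (CONS NIL (eb ?y))) 3 (eb ?y)"
      using runs.Seq[OF runs.Tail runs.Tail, of "CONS (ea x) (CONS NIL (eb ?y))"]
      by (simp add: numeral_eq_Suc)
    from runs.Seq[OF t'(2) runs.Seq[OF loop this]]
    have "runs (Seq q (Seq (Loop fold_guard (fold_body p)) (Seq Tail Tail))) (ea x) (t' + (t + 3 + 1) + 1) (eb ?y)" .
    thus "\<exists>t\<le>r x + (size (enc_list ec (l x)) * (M x + 24) + 4) + 5.
        runs (Seq q (Seq (Loop fold_guard (fold_body p)) (Seq Tail Tail))) (ea x) t (eb ?y)"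
      using t2 t'(1) by (intro exI[of _ "t' + (t + 3 + 1) + 1"]) auto
  qed
qed

lemma foldl_size_additive:
  assumes "\<And>acc e. e \<in> set xs \<Longrightarrow> size (eb (f acc e)) \<le> size (eb acc) + b"
  shows "size (eb (foldl f i xs)) \<le> size (eb i) + length xs * b"
  using assms
proof (induction xs rule: rev_induct)
  case (snoc x xs)
  hence "size (eb (foldl f i xs)) \<le> size (eb i) + length xs * b" by simp
  moreover have "size (eb (f (foldl f i xs) x)) \<le> size (eb (foldl f i xs)) + b" using snoc by simp
  ultimately show ?case by simp
qed simp

text \<open>If each step adds at most \<open>b x\<close>, the accumulator grows only linearly in the
  length of the list.\<close>

lemma pt_foldl_additive:
  assumes step: "poly_time (enc_prod ea (enc_prod eb ec)) eb (\<lambda>z. g (fst z) (fst (snd z)) (snd (snd z)))"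
    and l: "poly_time ea (enc_list ec) l" and i: "poly_time ea eb i"
    and b: "poly_bounded ea b"
    and bound: "\<And>x acc e. e \<in> set (l x) \<Longrightarrow> size (eb (g x acc e)) \<le> size (eb acc) + b x"
  shows "poly_time ea eb (\<lambda>x. foldl (g x) (i x) (l x))"
proof (rule pt_foldl[OF step l i])
  show "poly_bounded ea (\<lambda>x. size (eb (i x)) + size (enc_list ec (l x)) * b x)"
    by (intro poly_bounded_intros poly_time_size[OF i] poly_time_size[OF l] b)
  fix x ys zs assume eq: "l x = ys @ zs"
  hence "size (eb (foldl (g x) (i x) ys)) \<le> size (eb (i x)) + length ys * b x"
    by (intro foldl_size_additive bound) auto
  also have "length ys \<le> size (enc_list ec (l x))"
    using length_le_size_enc[of ys ec] eq by (simp add: size_enc_list_append)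
  finally show "size (eb (foldl (g x) (i x) ys)) \<le> size (eb (i x)) + size (enc_list ec (l x)) * b x"
    by (simp add: mult_right_mono)
qed

lemma foldl_Cons_filter: "foldl (\<lambda>acc e. if P e then e # acc else acc) ys xs = rev (filter P xs) @ ys"
  by (induction xs arbitrary: ys) auto

lemma foldl_Cons_map: "foldl (\<lambda>acc e. f e # acc) ys xs = rev (map f xs) @ ys"
  by (induction xs arbitrary: ys) auto

lemma foldl_append_concat: "foldl (\<lambda>acc e. f e @ acc) ys xs = concat (map f (rev xs)) @ ys"
  by (induction xs arbitrary: ys) auto

lemma pt_rev:
  assumes l: "poly_time ea (enc_list eb) l"
  shows "poly_time ea (enc_list eb) (\<lambda>x. rev (l x))"
proof -
  have "poly_time ea (enc_list eb) (\<lambda>x. foldl (\<lambda>acc e. e # acc) [] (l x))"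
    by (rule pt_foldl_additive[where b = "\<lambda>x. size (enc_list eb (l x)) + 1"])
      (auto intro!: l pt_const pt_Cons pt_fst pt_snd pt_id poly_bounded_add poly_time_size[OF l]
        less_imp_le size_enc_elem simp flip: One_nat_def simp: less_imp_le[OF size_enc_elem])
  thus ?thesis by (simp add: foldl_Cons_map[of "\<lambda>x. x"])
qed

lemma pt_append:
  assumes k: "poly_time ea (enc_list eb) k" and l: "poly_time ea (enc_list eb) l"
  shows "poly_time ea (enc_list eb) (\<lambda>x. k x @ l x)"
proof -
  have "poly_time ea (enc_list eb) (\<lambda>x. foldl (\<lambda>acc e. e # acc) (l x) (rev (k x)))"
    by (rule pt_foldl_additive[where b = "\<lambda>x. size (enc_list eb (k x)) + 1"])
      (auto intro!: l k pt_rev pt_Cons pt_fst pt_snd pt_id poly_bounded_add poly_time_size[OF k]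
        simp flip: One_nat_def simp: less_imp_le[OF size_enc_elem])
  thus ?thesis by (simp add: foldl_Cons_map[of "\<lambda>x. x"] rev_map)
qed

lemma pt_filter:
  assumes P: "poly_time (enc_prod ea eb) enc_bool (\<lambda>z. P (fst z) (snd z))"
    and l: "poly_time ea (enc_list eb) l"
  shows "poly_time ea (enc_list eb) (\<lambda>x. filter (P x) (l x))"
proof -
  have P': "poly_time (enc_prod ea (enc_prod ec eb)) enc_bool (\<lambda>z. P (fst z) (snd (snd z)))" for ec :: "'c \<Rightarrow> _"
    using pt_comp[OF P pt_pair[OF pt_fst[OF pt_id] pt_snd[OF pt_snd[OF pt_id]]]] by simp
  have "poly_time ea (enc_list eb) (\<lambda>x. foldl (\<lambda>acc e. if P x e then e # acc else acc) [] (rev (l x)))"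
    by (rule pt_foldl_additive[where b = "\<lambda>x. size (enc_list eb (l x)) + 1"])
      (auto intro!: l pt_rev pt_const pt_if P' pt_Cons pt_fst pt_snd pt_id poly_bounded_add poly_time_size[OF l]
        simp flip: One_nat_def simp: less_imp_le[OF size_enc_elem])
  thus ?thesis by (simp add: foldl_Cons_filter rev_filter)
qed

lemma pt_size_elem:
  assumes f: "poly_time (enc_prod ea eb) ec (\<lambda>z. f (fst z) (snd z))"
    and l: "poly_time ea (enc_list eb) l"
  obtains b where "poly_bounded ea b" "\<And>x e. e \<in> set (l x) \<Longrightarrow> size (ec (f x e)) \<le> b x"
proof -
  from poly_time_size[OF f] obtain c
    where c: "\<And>z. size (ec (f (fst z) (snd z))) \<le> (size (enc_prod ea eb z) + 2) ^ c"
    unfolding poly_bounded_def by blast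
  show ?thesis
  proof (rule that)
    show "poly_bounded ea (\<lambda>x. (size (ea x) + size (enc_list eb (l x)) + 3) ^ c)"
      by (intro poly_bounded_intros poly_time_size[OF l])
    fix x e assume e: "e \<in> set (l x)"
    have "size (ec (f x e)) \<le> (size (ea x) + size (eb e) + 3) ^ c"
      using c[of "(x, e)"] by (simp add: enc_prod_def numeral_eq_Suc)
    also have "\<dots> \<le> (size (ea x) + size (enc_list eb (l x)) + 3) ^ c"
      using size_enc_elem[OF e, of eb] by (intro power_mono) auto
    finally show "size (ec (f x e)) \<le> (size (ea x) + size (enc_list eb (l x)) + 3) ^ c" .
  qed
qed

lemma pt_map:
  assumes f: "poly_time (enc_prod ea eb) ec (\<lambda>z. f (fst z) (snd z))"
    and l: "poly_time ea (enc_list eb) l"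
  shows "poly_time ea (enc_list ec) (\<lambda>x. map (f x) (l x))"
proof -
  obtain b where b: "poly_bounded ea b" "\<And>x e. e \<in> set (l x) \<Longrightarrow> size (ec (f x e)) \<le> b x"
    using pt_size_elem[OF f l] by blast
  have f': "poly_time (enc_prod ea (enc_prod ed eb)) ec (\<lambda>z. f (fst z) (snd (snd z)))" for ed :: "'d \<Rightarrow> _"
    using pt_comp[OF f pt_pair[OF pt_fst[OF pt_id] pt_snd[OF pt_snd[OF pt_id]]]] by simp
  have "poly_time ea (enc_list ec) (\<lambda>x. foldl (\<lambda>acc e. f x e # acc) [] (rev (l x)))"
    by (rule pt_foldl_additive[where b = "\<lambda>x. b x + 1"])
      (auto intro!: l pt_rev pt_const f' pt_Cons pt_fst pt_snd pt_id poly_bounded_add b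
        simp flip: One_nat_def)
  thus ?thesis by (simp add: foldl_Cons_map rev_map)
qed

lemma pt_concat:
  assumes l: "poly_time ea (enc_list (enc_list eb)) l"
  shows "poly_time ea (enc_list eb) (\<lambda>x. concat (l x))"
proof -
  have "poly_time ea (enc_list eb) (\<lambda>x. foldl (\<lambda>acc e. e @ acc) [] (rev (l x)))"
    by (rule pt_foldl_additive[where b = "\<lambda>x. size (enc_list (enc_list eb) (l x))"])
      (auto intro!: l pt_rev pt_const pt_append pt_fst pt_snd pt_id poly_time_size[OF l]
        simp: size_enc_list_append less_imp_le[OF size_enc_elem])
  thus ?thesis by (simp add: foldl_append_concat[of "\<lambda>x. x"])
qed

lemma pt_Bex:
  assumes P: "poly_time (enc_prod ea eb) enc_bool (\<lambda>z. P (fst z) (snd z))"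
    and l: "poly_time ea (enc_list eb) l"
  shows "poly_time ea enc_bool (\<lambda>x. \<exists>e\<in>set (l x). P x e)"
proof -
  have P': "poly_time (enc_prod ea (enc_prod ec eb)) enc_bool (\<lambda>z. P (fst z) (snd (snd z)))" for ec :: "'c \<Rightarrow> _"
    using pt_comp[OF P pt_pair[OF pt_fst[OF pt_id] pt_snd[OF pt_snd[OF pt_id]]]] by simp
  have "poly_time ea enc_bool (\<lambda>x. foldl (\<lambda>acc e. acc \<or> P x e) False (l x))"
    by (rule pt_foldl_additive[where b = "\<lambda>x. 1"])
      (auto intro!: l pt_const pt_disj P' pt_fst pt_snd pt_id simp: enc_bool_def)
  moreover have "foldl (\<lambda>acc e. acc \<or> Q e) b xs \<longleftrightarrow> b \<or> (\<exists>e\<in>set xs. Q e)" for Q b and xs :: "'b list"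
    by (induction xs arbitrary: b) auto
  ultimately show ?thesis by simp
qed

lemma pt_Ball:
  assumes P: "poly_time (enc_prod ea eb) enc_bool (\<lambda>z. P (fst z) (snd z))"
    and l: "poly_time ea (enc_list eb) l"
  shows "poly_time ea enc_bool (\<lambda>x. \<forall>e\<in>set (l x). P x e)"
  using pt_not[OF pt_Bex[OF pt_not[OF P] l]] by simp

lemma pt_take1: 
  assumes l: "poly_time ea (enc_list eb) l" 
  shows "poly_time ea (enc_list eb) (\<lambda>x. take 1 (l x))"
proof -
  have "poly_time (enc_list eb) (enc_list eb) (take 1)"
  proof (rule poly_timeI[where p = "Cond Arg (Fork Head Empty) Empty" and g = "\<lambda>_. 5"])
    show "poly_bounded (enc_list eb) (\<lambda>x. size (enc_list eb (take 1 x)))"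
      by (rule poly_bounded_mono[OF poly_bounded_size size_enc_take])
    fix xs
    show "\<exists>t\<le>5. runs (Cond Arg (Fork Head Empty) Empty) (enc_list eb xs) t (enc_list eb (take 1 xs))"
    proof (cases xs)
      case Nil
      thus ?thesis using runs.Cond_false[OF runs.Arg runs.Empty, of "Fork Head Empty"]
        by (auto intro!: exI[of _ "1 + 1 + 1"])
    next
      case (Cons y ys)
      thus ?thesis
        using runs.Cond_true[OF runs.Arg _ runs.Fork[OF runs.Head runs.Empty, of "enc_list eb xs"], of Empty]
        by (auto intro!: exI[of _ "1 + (1 + 1 + 1) + 1"])
    qed
  qed simp
  from pt_comp[OF this l] show ?thesis .
qed

lemma enc_nat_0 [simp]: "enc_nat 0 = NIL"
  by (simp add: enc_nat_def)

lemma enc_list_const: "enc_list (\<lambda>_. NIL) xs = enc_nat (length xs)"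
proof -
  have "length xs = length ys \<Longrightarrow> enc_list (\<lambda>_. NIL) xs = enc_list (\<lambda>_. NIL) ys" for ys :: "nat list"
    by (induction xs ys rule: list_induct2) auto
  thus ?thesis unfolding enc_nat_def by simp
qed

lemma enc_nat_Suc [simp]: "enc_nat (Suc k) = CONS NIL (enc_nat k)"
  using enc_list_const[of "0 # [0..<k]"] enc_list_const[of "[0..<k]"] by simp

lemma size_enc_nat [simp]: "size (enc_nat k) = k"
  by (induction k) auto

definition enc_unit :: "unit \<Rightarrow> sexp" where
  "enc_unit = (\<lambda>_. NIL)"

text \<open>A unary number already is the code of a list of units, so it can serve as a loop counter
  without conversion.\<close>

lemma pt_replicate:
  assumes f: "poly_time ea enc_nat f"
  shows "poly_time ea (enc_list enc_unit) (\<lambda>x. replicate (f x) ())"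
  by (rule poly_time_recode[OF f]) (simp add: enc_unit_def enc_list_const)

lemma pt_Suc:
  assumes f: "poly_time ea enc_nat f" shows "poly_time ea enc_nat (\<lambda>x. Suc (f x))"
  by (rule pt_fork[OF pt_const[where eb = enc_unit and c = "()"] f]) (simp add: enc_unit_def)

lemma pt_length: 
  assumes l: "poly_time ea (enc_list eb) l"
  shows "poly_time ea enc_nat (\<lambda>x. length (l x))"
proof -
  have "poly_time ea enc_nat (\<lambda>x. foldl (\<lambda>acc e. Suc acc) 0 (l x))"
    by (rule pt_foldl_additive[where b = "\<lambda>_. 1"]) (auto intro!: l pt_const pt_Suc pt_fst pt_snd pt_id)
  moreover have "foldl (\<lambda>acc e. Suc acc) k xs = length xs + k" for xs :: "'b list" and k
    by (induction xs arbitrary: k) auto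
  ultimately show ?thesis by simp
qed

lemma pt_add:
  assumes f: "poly_time ea enc_nat f" and g: "poly_time ea enc_nat g"
  shows "poly_time ea enc_nat (\<lambda>x. f x + g x)"
proof -
  have "poly_time ea enc_nat (\<lambda>x. length (replicate (f x) () @ replicate (g x) ()))"
    by (rule pt_length pt_append pt_replicate f g)+
  thus ?thesis by simp
qed

lemma pt_mult:
  assumes f: "poly_time ea enc_nat f" and g: "poly_time ea enc_nat g"
  shows "poly_time ea enc_nat (\<lambda>x. f x * g x)"
proof -
  have f': "poly_time (enc_prod ea eb) enc_nat (\<lambda>z. f (fst z))" for eb :: "'b \<Rightarrow> _"
    by (rule pt_comp[OF f pt_fst[OF pt_id]])
  have "poly_time ea enc_nat
    (\<lambda>x. length (concat (map (\<lambda>_. replicate (f x) ()) (replicate (g x) ()))))"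
    by (rule pt_length pt_concat pt_map pt_replicate f' g)+
  moreover have "length (concat (map (\<lambda>_. replicate a ()) (replicate b ()))) = a * b" for a b
    by (induction b) auto
  ultimately show ?thesis by simp
qed

lemma pt_power:
  assumes f: "poly_time ea enc_nat f" shows "poly_time ea enc_nat (\<lambda>x. f x ^ k)"
proof (induction k)
  case 0
  show ?case using pt_const[of ea enc_nat 1] by simp
next
  case (Suc k)
  show ?case using pt_mult[OF f Suc] by simp
qed

lemma pt_drop:
  assumes l: "poly_time ea (enc_list eb) l" and f: "poly_time ea enc_nat f"
  shows "poly_time ea (enc_list eb) (\<lambda>x. drop (f x) (l x))"
proof -
  have "poly_time ea (enc_list eb) (\<lambda>x. foldl (\<lambda>acc _. tl acc) (l x) (replicate (f x) ()))"
  proof (rule pt_foldl_additive[where b = "\<lambda>_. 0"])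
    show "size (enc_list eb (tl acc)) \<le> size (enc_list eb acc) + 0" for acc by (cases acc) auto
  qed (auto intro!: l pt_replicate f pt_tl pt_fst pt_snd pt_id)
  moreover have "foldl (\<lambda>acc _. tl acc) xs (replicate k ()) = drop k xs" for xs :: "'b list" and k
    by (induction k arbitrary: xs) (auto simp: drop_Suc)
  ultimately show ?thesis by simp
qed

lemma pt_is_Nil:
  assumes l: "poly_time ea (enc_list eb) l" shows "poly_time ea enc_bool (\<lambda>x. l x = [])"
  using pt_Ball[OF pt_const l, of False] by (rule poly_time_recode) (simp add: ex_in_conv)

lemma pt_le:
  assumes f: "poly_time ea enc_nat f" and g: "poly_time ea enc_nat g"
  shows "poly_time ea enc_bool (\<lambda>x. f x \<le> g x)"
proof -
  have "poly_time ea enc_bool (\<lambda>x. drop (g x) (replicate (f x) ()) = [])"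
    by (rule pt_is_Nil pt_drop pt_replicate f g)+
  thus ?thesis by simp
qed

lemma pt_less:
  "poly_time ea enc_nat f \<Longrightarrow> poly_time ea enc_nat g \<Longrightarrow> poly_time ea enc_bool (\<lambda>x. f x < g x)"
  using pt_not[OF pt_le[of ea g f]] by (simp add: not_le)

lemma pt_eq:
  "poly_time ea enc_nat f \<Longrightarrow> poly_time ea enc_nat g \<Longrightarrow> poly_time ea enc_bool (\<lambda>x. f x = g x)"
  using pt_conj[OF pt_le[of ea f g] pt_le[of ea g f]] by (simp add: eq_iff)

lemma pt_mem:
  assumes f: "poly_time ea enc_nat f" and l: "poly_time ea (enc_list enc_nat) l"
  shows "poly_time ea enc_bool (\<lambda>x. f x \<in> set (l x))"
proof -
  have "poly_time ea enc_bool (\<lambda>x. \<exists>e\<in>set (l x). f x = e)"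
    by (rule pt_Bex pt_eq pt_comp[OF f] pt_fst pt_snd pt_id l)+
  thus ?thesis by simp
qed

text \<open>Descending, because a fold that puts the current length in front of the accumulator
  produces the list in this order.\<close>

definition down_list :: "nat \<Rightarrow> nat list" where
  "down_list k = rev [0..<k]"

lemma pt_down_list:
  assumes f: "poly_time ea enc_nat f" shows "poly_time ea (enc_list enc_nat) (\<lambda>x. down_list (f x))"
proof -
  have eq: "foldl (\<lambda>acc _. length acc # acc) [] (replicate k ()) = down_list k" for k
  proof (induction k)
    case (Suc k)
    have "replicate (Suc k) () = replicate k () @ [()]" by (simp add: replicate_append_same)
    thus ?case using Suc by (simp add: down_list_def)
  qed (simp add: down_list_def)
  have "poly_time ea (enc_list enc_nat) (\<lambda>x. foldl (\<lambda>acc _. length acc # acc) [] (replicate (f x) ()))"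
  proof (rule pt_foldl[where B = "\<lambda>x. f x * (f x + 1)"])
    show "poly_bounded ea (\<lambda>x. f x * (f x + 1))"
      using poly_time_size[OF f] by (auto intro!: poly_bounded_intros)
    fix x ys zs assume "replicate (f x) () = ys @ zs"
    hence ys: "ys = replicate (length ys) ()" "length ys \<le> f x"
      by (simp_all add: replicate_length_same) (metis length_append length_replicate le_add1)
    have "size (enc_list enc_nat (down_list (length ys))) \<le> length ys * (length ys + 1)"
      using size_enc_list_le[of "down_list (length ys)" enc_nat "length ys"] by (simp add: down_list_def)
    also have "\<dots> \<le> f x * (f x + 1)" using ys(2) by (intro mult_le_mono) auto
    finally show "size (enc_list enc_nat (foldl (\<lambda>acc _. length acc # acc) [] ys)) \<le> f x * (f x + 1)"
      using ys(1) eq by metis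
  qed (auto intro!: f pt_replicate pt_const pt_Cons pt_length pt_fst pt_snd pt_id)
  thus ?thesis by (simp add: eq)
qed

text \<open>These rules follow the syntax of a function. Under a binder the enclosing variables sit
  in the first component of the environment, so facts about parameters are lifted by
  \<open>pt_comp\<close>.\<close>

lemmas pt_intros = pt_pair pt_fst pt_snd pt_id pt_const pt_let pt_if pt_conj pt_disj pt_not pt_Cons
  pt_append pt_rev pt_filter pt_map pt_concat pt_Bex pt_Ball pt_take1 pt_length pt_add pt_mult
  pt_power pt_drop pt_le pt_less pt_eq pt_mem pt_down_list


section \<open>The routing algorithm\<close>

text \<open>A total table lookup that returns \<open>[]\<close> out of range. Like the other
  functions of this section it uses only operations covered by \<open>pt_intros\<close>.\<close>

definition neighbours :: "nat list list \<Rightarrow> nat \<Rightarrow> nat list" where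
  "neighbours g v = concat (take 1 (drop v g))"

definition arcs :: "nat list list \<Rightarrow> (nat \<times> nat) list" where
  "arcs g = concat (map (\<lambda>v. map (\<lambda>u. (u, v)) (neighbours g v)) (down_list (length g)))"

definition owned_by :: "(nat \<times> nat) list \<Rightarrow> nat \<Rightarrow> nat \<Rightarrow> bool" where
  "owned_by par u v \<longleftrightarrow> (\<exists>e\<in>set (take 1 (filter (\<lambda>e. fst e = u) par)). snd e = v)"

definition kids :: "nat list list \<Rightarrow> (nat \<times> nat) list \<Rightarrow> nat \<Rightarrow> nat list" where
  "kids g par v = filter (\<lambda>u. owned_by par u v) (neighbours g v)"

definition blocked :: "nat list \<Rightarrow> (nat \<times> nat) list \<Rightarrow> nat \<Rightarrow> bool" where
  "blocked us par u \<longleftrightarrow> u \<in> set us \<or> (\<exists>e\<in>set par. fst e = u)"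

definition in_need :: "nat list list \<Rightarrow> nat \<Rightarrow> nat list \<Rightarrow> nat list \<Rightarrow> nat list \<Rightarrow> (nat \<times> nat) list \<Rightarrow> nat \<Rightarrow> bool" where
  "in_need g m ul sl phi par v \<longleftrightarrow> v \<notin> set ul \<and>
     (v \<in> set phi \<or> length (neighbours g v) \<le> 2 * length (filter (blocked (ul @ sl) par) (neighbours g v))) \<and>
     length (kids g par v) < m"

definition moves :: "nat list list \<Rightarrow> nat \<Rightarrow> nat list \<Rightarrow> nat list \<Rightarrow> nat list \<Rightarrow> (nat \<times> nat) list \<Rightarrow>
    (nat \<times> nat) list \<Rightarrow> (nat \<times> nat) list" where
  "moves g m ul sl phi par0 H = filter (\<lambda>e. in_need g m ul sl phi (H @ par0) (snd e) \<and>
     \<not> blocked (ul @ sl) par0 (fst e) \<and>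
     (\<forall>u\<in>set (neighbours g (snd e)). blocked (ul @ sl) par0 u \<or> price H (fst e) \<le> price H u)) (arcs g)"

text \<open>Only the length \<open>(n + 1) * n\<close> counts: more ticks than an auction can have
  moves.\<close>

definition clock :: "nat list list \<Rightarrow> nat list" where
  "clock g = concat (map (\<lambda>_. 0 # down_list (length g)) (down_list (length g)))"

definition auction :: "nat list list \<Rightarrow> nat \<Rightarrow> nat list \<Rightarrow> nat list \<Rightarrow> nat list \<Rightarrow> (nat \<times> nat) list \<Rightarrow>
    (nat \<times> nat) list" where
  "auction g m ul sl phi par0 =
     foldl (\<lambda>H _. take 1 (moves g m ul sl phi par0 H) @ H) [] (clock g) @ par0"

definition tips :: "nat list list \<Rightarrow> nat list" where
  "tips L = concat (map (take 1) L)"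

definition extend :: "nat list list \<Rightarrow> (nat \<times> nat) list \<Rightarrow> nat list list \<Rightarrow> nat list list" where
  "extend g par L = concat (map (\<lambda>p. map (\<lambda>u. u # p) (concat (map (kids g par) (take 1 p)))) L)"

text \<open>Paths are stored leaf first. Growth stops as soon as each of the two trees has at least
  \<open>n / (320 m)\<close> leaves. The test \<open>0 < m\<close> bounds the running time on inputs that do not encode graphs.\<close>

definition grow :: "nat list list \<Rightarrow> nat \<Rightarrow> nat list \<Rightarrow> nat list \<Rightarrow>
    nat list list \<times> (nat \<times> nat) list \<Rightarrow> nat list list \<times> (nat \<times> nat) list" where
  "grow g m ul sl st = (if 0 < m \<and> 160 * m * length (fst st) < length g
     then let par = auction g m ul sl (tips (fst st)) (snd st) in (extend g par (fst st), par)
     else st)"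

definition forest :: "nat list list \<Rightarrow> nat \<Rightarrow> nat list \<Rightarrow> nat list \<Rightarrow> nat \<Rightarrow> nat \<Rightarrow>
    nat list list \<times> (nat \<times> nat) list" where
  "forest g m ul sl a b =
     foldl (\<lambda>st _. grow g m ul sl st) ([[a], [b]], []) (down_list (length g))"

text \<open>Both trees share one list of branches. Membership of \<open>a\<close> and
  \<open>b\<close> tells the trees apart, because a branch meets \<open>S\<close> in its root
  only.\<close>

definition linked :: "nat list list \<Rightarrow> nat \<Rightarrow> nat \<Rightarrow> nat list \<Rightarrow> nat list \<Rightarrow> bool" where
  "linked g a b p q \<longleftrightarrow> a \<in> set p \<and> b \<in> set q \<and>
     (\<exists>x\<in>set (take 1 p). \<exists>y\<in>set (take 1 q). y \<in> set (neighbours g x))"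

definition join :: "nat list list \<Rightarrow> nat \<Rightarrow> nat \<Rightarrow> nat list list \<Rightarrow> nat list" where
  "join g a b L =
     concat (take 1 (concat (map (\<lambda>p. map (\<lambda>q. rev p @ q) (filter (linked g a b p) L)) L)))"

lemma owned_by_iff: "owned_by par u v \<longleftrightarrow> map_of par u = Some v"
  unfolding owned_by_def by (induction par) auto

lemma blocked_iff: "blocked us par u \<longleftrightarrow> u \<in> set us \<union> dom (map_of par)"
  by (auto simp: blocked_def dom_map_of_conv_image_fst)

definition adj_list :: "nat \<Rightarrow> (nat \<times> nat) set \<Rightarrow> nat list list" where
  "adj_list n E = map (\<lambda>x. sorted_list_of_set (nbhd E x)) [0..<n]"

lemma take_1_hd: "p \<noteq> [] \<Longrightarrow> take (Suc 0) p = [hd p]"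
  by (cases p) auto

lemma length_adj_list [simp]: "length (adj_list n E) = n"
  by (simp add: adj_list_def)

lemma neighbours_adj_list: "neighbours (adj_list n E) v = (if v < n then sorted_list_of_set (nbhd E v) else [])"
  by (auto simp: neighbours_def adj_list_def take_1_hd hd_drop_conv_nth)

lemma set_down_list [simp]: "set (down_list k) = {..<k}"
  by (auto simp: down_list_def)

lemma length_down_list [simp]: "length (down_list k) = k"
  by (simp add: down_list_def)

lemma length_concat_const: "(\<And>x. x \<in> set xs \<Longrightarrow> length (f x) = k) \<Longrightarrow> length (concat (map f xs)) = k * length xs"
  by (induction xs) auto

lemma length_clock: "length (clock g) = Suc (length g) * length g"
  unfolding clock_def by (subst length_concat_const[where k = "Suc (length g)"]) simp_all

context expander
begin

abbreviation G :: "nat list list" where "G \<equiv> adj_list n E"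

lemma set_neighbours: "v < n \<Longrightarrow> set (neighbours G v) = nbhd E v"
  by (simp add: neighbours_adj_list)

lemma distinct_neighbours: "distinct (neighbours G v)"
  by (simp add: neighbours_adj_list)

lemma length_neighbours: "v < n \<Longrightarrow> length (neighbours G v) = d"
  by (simp add: neighbours_adj_list deg)

lemma set_arcs: "set (arcs G) = {(u, v). v < n \<and> u \<in> nbhd E v}"
  by (auto simp: arcs_def set_neighbours)

lemma kids_eq:
  assumes "\<And>u v. map_of par u = Some v \<Longrightarrow> v < n \<and> u \<in> nbhd E v"
  shows "distinct (kids G par v)" "v < n \<Longrightarrow> set (kids G par v) = kidset (map_of par) v"
    "v < n \<Longrightarrow> length (kids G par v) = card (kidset (map_of par) v)"
proof -
  show 1: "distinct (kids G par v)" by (simp add: kids_def distinct_neighbours)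
  show 2: "set (kids G par v) = kidset (map_of par) v" if "v < n"
    using assms that by (auto simp: kids_def kidset_def owned_by_iff set_neighbours)
  show "length (kids G par v) = card (kidset (map_of par) v)" if "v < n"
    using distinct_card[OF 1] 2[OF that] by simp
qed

end

context batch
begin

lemma moves_iff:
  assumes inv: "invar H" and ul: "set ul = U" and sl: "set sl = S" and phi: "set phi = Phi"
    and p0: "map_of p0 = par0"
  shows "e \<in> set (moves G m ul sl phi p0 H) \<longleftrightarrow> valid_move H e"
proof -
  obtain u v where e: "e = (u, v)" by force
  have cur: "map_of (H @ p0) = cur H" by (simp add: cur_def p0)
  have edge: "v < n \<and> u \<in> nbhd E v" if "map_of (H @ p0) u = Some v" for u v
  proof -
    have "par0 u = Some v \<or> map_of H u = Some v" using that cur cur_eq[OF inv] by simp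
    thus ?thesis using par0 invar_map_of[OF inv, of u v]
      by (auto simp: star_system_def nbhd_def bidders_def cand_def)
  qed
  have need: "in_need G m ul sl phi (H @ p0) v \<longleftrightarrow> needy H v" if v: "v < n"
  proof -
    have "length (filter (blocked (ul @ sl) (H @ p0)) (neighbours G v)) =
        card (nbhd E v \<inter> (U \<union> S \<union> dom (cur H)))"
    proof -
      have "blocked (ul @ sl) (H @ p0) = (\<lambda>x. x \<in> U \<union> S \<union> dom (cur H))"
        unfolding blocked_iff cur by (auto simp: ul sl)
      thus ?thesis
        by (simp only: distinct_length_filter[OF distinct_neighbours] Collect_mem_eq set_neighbours[OF v] Int_commute)
    qed
    moreover have "length (kids G (H @ p0) v) = card (kidset (cur H) v)"
      unfolding cur[symmetric] by (rule kids_eq(3)[OF _ v]) (rule edge)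
    ultimately show ?thesis
      using v by (simp add: in_need_def needy_def length_neighbours ul phi crowded_def)
  qed
  show ?thesis
    by (auto simp: moves_def e set_arcs need valid_move_def cand_def blocked_iff ul sl p0 set_neighbours
        needy_def)
qed

lemma auction_run:
  assumes ul: "set ul = U" and sl: "set sl = S" and phi: "set phi = Phi"
    and p0: "map_of p0 = par0"
  shows "\<exists>H. reachable H \<and> (\<forall>v. \<not> needy H v) \<and> map_of (auction G m ul sl phi p0) = cur H"
proof -
  define H where "H = foldl (\<lambda>H _. take 1 (moves G m ul sl phi p0 H) @ H) [] (clock G)"
  have "reachable H \<and> (\<forall>v. \<not> needy H v)"
    unfolding H_def
  proof (rule run_auction)
    show "n * n < length (clock G)" using n by (simp add: length_clock)
    fix H assume "reachable H"
    hence iff: "e \<in> set (moves G m ul sl phi p0 H) \<longleftrightarrow> valid_move H e" for e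
      using moves_iff[OF invar_reachable ul sl phi p0] by blast
    show "(\<exists>e. valid_move H e \<and> take 1 (moves G m ul sl phi p0 H) @ H = e # H) \<or>
      (\<nexists>e. valid_move H e) \<and> take 1 (moves G m ul sl phi p0 H) @ H = H"
      using iff by (cases "moves G m ul sl phi p0 H") auto
  qed
  moreover have "map_of (auction G m ul sl phi p0) = cur H"
    by (simp add: auction_def H_def cur_def p0)
  ultimately show ?thesis by blast
qed

end

section \<open>Branches and the growth of the two trees in stages\<close>

lemma distinct_concat_map:
  "distinct vs \<Longrightarrow> (\<And>v. v \<in> set vs \<Longrightarrow> distinct (f v)) \<Longrightarrow>
   (\<And>v w. v \<noteq> w \<Longrightarrow> set (f v) \<inter> set (f w) = {}) \<Longrightarrow> distinct (concat (map f vs))"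
  by (induction vs) fastforce+

text \<open>For \<open>x = m * (card F + card Phi)\<close> and \<open>y = m ^ Suc j\<close>:
  \<open>40 / 90 + 3 * 40 / 320 < 1\<close>. The products are replaced by variables so that the
  arithmetic is linear.\<close>

lemma budget_arith:
  fixes u x y k :: nat
  assumes "2 * x \<le> 6 * y" "320 * y < k" "90 * u \<le> k"
  shows "40 * (u + x) \<le> k"
  using assms by simp

abbreviation chain :: "(nat \<rightharpoonup> nat) \<Rightarrow> nat list \<Rightarrow> bool" where
  "chain par \<equiv> successively (\<lambda>u v. par u = Some v)"

lemma chain_mono: "chain par p \<Longrightarrow> par \<subseteq>\<^sub>m par' \<Longrightarrow> chain par' p"
  by (erule successively_mono) (metis domI map_le_def)

lemma chain_subset: "chain par p \<Longrightarrow> p \<noteq> [] \<Longrightarrow> set p \<subseteq> insert (last p) (dom par)"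
  by (induction p rule: induct_list012) auto

lemma chain_up: "chain par p \<Longrightarrow> u \<in> set p \<Longrightarrow> par u = Some v \<Longrightarrow> last p \<notin> dom par \<Longrightarrow> v \<in> set p"
  by (induction p rule: induct_list012) (auto split: if_splits)

text \<open>From a common first vertex both lists follow the same partial function until it is
  undefined.\<close>

lemma chain_unique:
  "chain par p \<Longrightarrow> chain par q \<Longrightarrow> p \<noteq> [] \<Longrightarrow> q \<noteq> [] \<Longrightarrow> hd p = hd q \<Longrightarrow>
   last p \<notin> dom par \<Longrightarrow> last q \<notin> dom par \<Longrightarrow> p = q"
proof (induction p arbitrary: q)
  case (Cons x p)
  then obtain q' where q: "q = x # q'" by (cases q) auto
  show ?case
  proof (cases "p = []")
    case True
    hence "par x = None" using Cons.prems by auto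
    thus ?thesis using True q Cons.prems by (cases q') auto
  next
    case False
    hence x: "par x = Some (hd p)" using Cons.prems by (cases p) auto
    hence "q' \<noteq> []" using Cons.prems q by auto
    hence "par x = Some (hd q')" using Cons.prems q by (cases q') auto
    hence "p = q'"
      using x Cons.prems q False \<open>q' \<noteq> []\<close> by (intro Cons.IH) (auto simp: successively_Cons)
    thus ?thesis using q by simp
  qed
qed simp

lemma chain_suffix: "chain par (xs @ ys) \<Longrightarrow> chain par ys"
  by (simp add: successively_append_iff)

text \<open>From a common vertex \<open>z\<close> on, the two chains agree. Branches with different
  roots are thus disjoint.\<close>

lemma chain_meet:
  assumes "chain par p" "chain par q" "z \<in> set p" "z \<in> set q" "last p \<notin> dom par" "last q \<notin> dom par"
  shows "last p = last q"
proof -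
  from assms(3,4) obtain p1 p2 q1 q2 where eq: "p = p1 @ z # p2" "q = q1 @ z # q2"
    by (meson split_list)
  have "z # p2 = z # q2"
    using assms eq by (intro chain_unique[of par]) (auto dest: chain_suffix simp del: successively.simps)
  thus ?thesis using eq by simp
qed

text \<open>A repeated vertex would start two chains of different lengths, against
  \<open>chain_unique\<close>.\<close>

lemma chain_distinct: "chain par p \<Longrightarrow> last p \<notin> dom par \<Longrightarrow> distinct p"
proof (induction p)
  case (Cons x p)
  show ?case
  proof (cases "p = []")
    case False
    have "x \<notin> set p"
    proof
      assume "x \<in> set p"
      then obtain p1 p2 where p: "p = p1 @ x # p2" by (meson split_list)
      have "chain par (x # p2)" using Cons.prems(1) p chain_suffix[of par "x # p1" "x # p2"] by simp
      hence "x # p2 = x # p" using Cons.prems p by (intro chain_unique[of par]) auto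
      thus False using p by simp
    qed
    thus ?thesis using Cons False by (auto simp: successively_Cons)
  qed simp
qed simp

context expander
begin

definition chains :: "(nat \<rightharpoonup> nat) \<Rightarrow> nat \<Rightarrow> nat \<Rightarrow> nat list list \<Rightarrow> bool" where
  "chains par r j X \<longleftrightarrow> length X = m ^ j \<and> distinct (map hd X) \<and>
     (\<forall>p\<in>set X. length p = Suc j \<and> last p = r \<and> chain par p)"

text \<open>The closed star system \<open>W\<close> extends the partial one computed so far. It is kept separately
  because at stage 0 nothing has been computed; from stage 1 on the auction returns a closed one.\<close>

definition stage :: "nat set \<Rightarrow> nat \<Rightarrow> nat \<Rightarrow> nat \<Rightarrow> nat list list \<times> (nat \<times> nat) list \<Rightarrow> bool" where
  "stage U a b j st \<longleftrightarrow> (\<exists>La Lb W F. fst st = La @ Lb \<and>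
     chains (map_of (snd st)) a j La \<and> chains (map_of (snd st)) b j Lb \<and>
     star_system U (map_of (snd st)) \<and> star_system U W \<and> closed_for U W \<and> map_of (snd st) \<subseteq>\<^sub>m W \<and>
     finite F \<and> card F * (m - 1) + 2 \<le> 2 * m ^ j \<and>
     (\<forall>v\<in>ran (map_of (snd st)). v \<in> F \<or> crowded U (map_of (snd st)) v) \<and>
     16 * card (U \<union> dom (map_of (snd st))) \<le> n)"

lemma stage_0:
  assumes "good U" "90 * card U \<le> n" shows "stage U a b 0 ([[a], [b]], [])"
proof -
  from assms(1) obtain W where "star_system U W" "closed_for U W" unfolding good_def by blast
  thus ?thesis
    using assms(2) unfolding stage_def
    by (intro exI[of _ "[[a]]"] exI[of _ "[[b]]"] exI[of _ W] exI[of _ "{}"])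
      (auto simp: chains_def star_system_def)
qed

lemma tips_eq: "[] \<notin> set L \<Longrightarrow> tips L = map hd L"
  unfolding tips_def by (induction L) (auto simp: take_1_hd)

lemma extend_eq:
  "[] \<notin> set L \<Longrightarrow> extend g par L = concat (map (\<lambda>p. map (\<lambda>u. u # p) (kids g par (hd p))) L)"
  unfolding extend_def by (induction L) (auto simp: take_1_hd)

lemma chains_nonempty: "chains par r j X \<Longrightarrow> [] \<notin> set X"
  by (auto simp: chains_def)

lemma chains_tips:
  assumes X: "chains par r j X" and par: "star_system U par" and r: "r \<in> S - U"
  shows "hd ` set X \<subseteq> {..<n} - U"
proof
  fix x assume "x \<in> hd ` set X"
  then obtain p where p: "p \<in> set X" "x = hd p" by auto
  hence c: "chain par p" "last p = r" "p \<noteq> []" using X by (auto simp: chains_def)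
  show "x \<in> {..<n} - U"
  proof (cases "tl p = []")
    case True
    hence "x = r" using c p by (cases p) auto
    thus ?thesis using r S by auto
  next
    case False
    then obtain y where "par x = Some y" using c p by (cases p; cases "tl p") auto
    hence "x \<notin> U" "(y, x) \<in> E" using par by (auto simp: star_system_def)
    thus ?thesis using E by auto
  qed
qed

lemma chains_extend:
  assumes X: "chains par r j X" and le: "par \<subseteq>\<^sub>m map_of q" and q: "star_system U (map_of q)"
    and tips: "hd ` set X \<subseteq> ran (map_of q)"
  shows "chains (map_of q) r (Suc j) (extend G q X)"
proof -
  have edge: "v < n \<and> u \<in> nbhd E v" if "map_of q u = Some v" for u v
    using q that by (auto simp: star_system_def nbhd_def)
  have lt: "v < n" if "v \<in> hd ` set X" for v
    using tips that edge by (force simp: ran_def)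
  note eq = extend_eq[OF chains_nonempty[OF X], of G q]
  have len: "length (kids G q (hd p)) = m" if "p \<in> set X" for p
    using kids_eq(3)[OF edge lt] that tips q by (auto simp: star_system_def)
  have "length (extend G q X) = m * length X"
    unfolding eq by (rule length_concat_const) (simp add: len)
  hence 1: "length (extend G q X) = m ^ Suc j" using X by (simp add: chains_def)
  have "map hd (extend G q X) = concat (map (kids G q) (map hd X))"
    unfolding eq by (simp add: map_concat comp_def)
  moreover have "distinct (concat (map (kids G q) (map hd X)))"
  proof (rule distinct_concat_map)
    show "distinct (map hd X)" using X by (simp add: chains_def)
    show "distinct (kids G q v)" for v using kids_eq(1)[OF edge] .
    show "set (kids G q v) \<inter> set (kids G q w) = {}" if "v \<noteq> w" for v w
      using that by (auto simp: kids_def owned_by_iff)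
  qed
  ultimately have 2: "distinct (map hd (extend G q X))" by simp
  have 3: "length p' = Suc (Suc j) \<and> last p' = r \<and> chain (map_of q) p'" if "p' \<in> set (extend G q X)" for p'
  proof -
    from that obtain p u where p: "p \<in> set X" "u \<in> set (kids G q (hd p))" "p' = u # p"
      unfolding eq by auto
    have c: "length p = Suc j" "last p = r" "chain par p" using X p(1) by (auto simp: chains_def)
    have "map_of q u = Some (hd p)" using p(2) by (simp add: kids_def owned_by_iff)
    thus ?thesis using c chain_mono[OF c(3) le] p(3) by (cases p) auto
  qed
  show ?thesis unfolding chains_def by (rule conjI[OF 1 conjI[OF 2 ballI[OF 3]]])
qed

lemma stage_Suc:
  assumes st: "stage U a b j st" and U: "U \<subseteq> {..<n}" "90 * card U \<le> n"
    and ab: "a \<in> S - U" "b \<in> S - U"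
    and ul: "set ul = U" and sl: "set sl = S" and small: "320 * m ^ Suc j < n"
  shows "stage U a b (Suc j) (grow G m ul sl st)"
proof -
  let ?p = "map_of (snd st)"
  from st obtain La Lb W F where L: "fst st = La @ Lb" and La: "chains ?p a j La" and Lb: "chains ?p b j Lb"
    and p: "star_system U ?p" and W: "star_system U W" "closed_for U W" "?p \<subseteq>\<^sub>m W" and finF: "finite F"
    and cardF: "card F * (m - 1) + 2 \<le> 2 * m ^ j"
    and forced: "\<forall>v\<in>ran ?p. v \<in> F \<or> crowded U ?p v" and room: "16 * card (U \<union> dom ?p) \<le> n"
    unfolding stage_def by blast
  define Phi where "Phi = set (tips (fst st))"
  have Phi_eq: "Phi = hd ` set La \<union> hd ` set Lb"
    using L chains_nonempty[OF La] chains_nonempty[OF Lb] by (auto simp: Phi_def tips_eq)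
  have "card Phi \<le> card (hd ` set La) + card (hd ` set Lb)" unfolding Phi_eq by (rule card_Un_le)
  also have "\<dots> \<le> length La + length Lb"
    by (intro add_mono) (meson card_image_le card_length finite_set order_trans)+
  finally have cardPhi: "card Phi \<le> 2 * m ^ j" using La Lb by (simp add: chains_def)
  have finPhi: "finite Phi" by (simp add: Phi_def)
  \<comment> \<open>\<open>F\<close> collects the tips of all earlier rounds, at most
    \<open>2 * (1 + m + ... + m ^ (j - 1))\<close> of them; the invariant is this geometric sum with
    the denominator \<open>m - 1\<close> cleared.\<close>
  have cardFPhi: "(card F + card Phi) * (m - 1) + 2 \<le> 2 * m ^ Suc j"
  proof -
    have "card Phi * (m - 1) \<le> 2 * m ^ j * (m - 1)" using cardPhi by (rule mult_le_mono1)
    hence "(card F + card Phi) * (m - 1) + 2 \<le> 2 * m ^ j + 2 * m ^ j * (m - 1)"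
      using cardF add_mult_distrib[of "card F" "card Phi" "m - 1"] by linarith
    also have "\<dots> = 2 * m ^ j * (1 + (m - 1))" by (simp only: distrib_left mult_1_right)
    also have "1 + (m - 1) = m" using m by simp
    finally show ?thesis by (simp only: power_Suc2 mult.assoc)
  qed
  have "40 * (card U + m * (card F + card Phi)) \<le> n"
  proof -
    \<comment> \<open>From \<open>3 \<le> m\<close>. Hence all tips so far need at most
      \<open>3 * m ^ Suc j\<close> leaves, which is below \<open>3 * n / 320\<close>.\<close>
    have "2 * m \<le> 3 * (m - 1)" using m by simp
    hence "2 * m * (card F + card Phi) \<le> 3 * (m - 1) * (card F + card Phi)" by (rule mult_le_mono1)
    also have "\<dots> = 3 * ((card F + card Phi) * (m - 1))" by simp
    finally have budget: "2 * (m * (card F + card Phi)) \<le> 6 * m ^ Suc j"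
      using cardFPhi mult.assoc[of 2 m "card F + card Phi"] by linarith
    from budget_arith[OF budget small U(2)] show ?thesis .
  qed
  then interpret batch n d m E mu S U ?p W F Phi
    using U(1) p W finF forced room chains_tips[OF La p ab(1)] chains_tips[OF Lb p ab(2)]
    by unfold_locales (auto simp: Phi_eq)
  define q where "q = auction G m ul sl (tips (fst st)) (snd st)"
  obtain H where H: "reachable H" "\<And>v. \<not> needy H v" and q: "map_of q = cur H"
    using auction_run[OF ul sl Phi_def[symmetric] refl] unfolding q_def by blast
  note res = auction_result[OF H, folded q]
  have "length (fst st) = 2 * m ^ j" using L La Lb by (simp add: chains_def)
  hence grow: "grow G m ul sl st = (extend G q (fst st), q)"
    using small m by (simp add: grow_def q_def Let_def)
  show ?thesis
    unfolding stage_def grow fst_conv snd_conv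
  proof (intro exI conjI)
    show "extend G q (fst st) = extend G q La @ extend G q Lb" by (simp add: L extend_def)
    show "chains (map_of q) a (Suc j) (extend G q La)"
      by (rule chains_extend[OF La res(3,1)]) (use res(4) Phi_eq in auto)
    show "chains (map_of q) b (Suc j) (extend G q Lb)"
      by (rule chains_extend[OF Lb res(3,1)]) (use res(4) Phi_eq in auto)
    show "map_of q \<subseteq>\<^sub>m map_of q" by simp
    show "finite (F \<union> Phi)" using finF finPhi by simp
    have "card (F \<union> Phi) * (m - 1) \<le> (card F + card Phi) * (m - 1)"
      by (intro mult_le_mono1 card_Un_le)
    thus "card (F \<union> Phi) * (m - 1) + 2 \<le> 2 * m ^ Suc j" using cardFPhi by linarith
    show "\<forall>v\<in>ran (map_of q). v \<in> F \<union> Phi \<or> crowded U (map_of q) v" using res(6) by blast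
    show "16 * card (U \<union> dom (map_of q)) \<le> n" using res(5) by simp
  qed (use res in auto)
qed

text \<open>The stopping test of \<open>grow\<close> for \<open>2 * m ^ j\<close> branches, solved
  for \<open>j\<close>. It involves neither the used vertices nor the pair, so all paths get the
  same length.\<close>

definition depth :: nat where
  "depth = (LEAST j. n \<le> 320 * m ^ Suc j)"

lemma n_le_depth: "n \<le> 320 * m ^ Suc depth"
  unfolding depth_def
proof (rule LeastI)
  have "n < 2 ^ n" by simp
  also have "\<dots> \<le> m ^ n" using m by (intro power_mono) auto
  also have "\<dots> \<le> 320 * m ^ Suc n" using m by simp
  finally show "n \<le> 320 * m ^ Suc n" by simp
qed

lemma less_depth_iff: "320 * m ^ Suc j < n \<longleftrightarrow> j < depth"
proof
  assume "320 * m ^ Suc j < n"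
  show "j < depth"
  proof (rule ccontr)
    assume "\<not> j < depth"
    hence "m ^ Suc depth \<le> m ^ Suc j" using m by (intro power_increasing) auto
    thus False using n_le_depth \<open>320 * m ^ Suc j < n\<close> by linarith
  qed
next
  assume "j < depth"
  thus "320 * m ^ Suc j < n" unfolding depth_def by (metis not_less_Least not_le)
qed

lemma depth_le: "depth \<le> n"
proof -
  have "n < 2 ^ n" by simp
  also have "\<dots> \<le> m ^ n" using m by (intro power_mono) auto
  also have "\<dots> \<le> 320 * m ^ Suc n" using m by simp
  finally have "\<not> 320 * m ^ Suc n < n" by simp
  thus ?thesis using less_depth_iff[of n] by simp
qed

text \<open>After \<open>depth\<close> rounds \<open>grow\<close> leaves the state unchanged, so
  running \<open>n \<ge> depth\<close> rounds does no harm.\<close>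

lemma stage_forest:
  assumes good: "good U" and U: "U \<subseteq> {..<n}" "90 * card U \<le> n"
    and ab: "a \<in> S - U" "b \<in> S - U" and ul: "set ul = U" and sl: "set sl = S"
  shows "stage U a b depth (forest G m ul sl a b)"
proof -
  have "stage U a b (min (length xs) depth) (foldl (\<lambda>st _. grow G m ul sl st) ([[a], [b]], []) xs)"
    for xs :: "nat list"
  proof (induction xs rule: rev_induct)
    case Nil
    thus ?case using stage_0[OF good U(2)] by simp
  next
    case (snoc x xs)
    let ?st = "foldl (\<lambda>st _. grow G m ul sl st) ([[a], [b]], []) xs"
    show ?case
    proof (cases "length xs < depth")
      case True
      hence "min (length xs) depth = length xs" "min (length (xs @ [x])) depth = Suc (length xs)"
        by auto
      moreover have "320 * m ^ Suc (length xs) < n" using True less_depth_iff by blast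
      ultimately show ?thesis using stage_Suc[OF _ U ab ul sl, of "length xs" ?st] snoc by simp
    next
      case False
      hence "stage U a b depth ?st" using snoc by simp
      hence "length (fst ?st) = 2 * m ^ depth" by (auto simp: stage_def chains_def)
      hence "grow G m ul sl ?st = ?st" using n_le_depth by (simp add: grow_def)
      thus ?thesis using snoc False by simp
    qed
  qed
  from this[of "down_list n"] show ?thesis using depth_le by (simp add: forest_def)
qed

text \<open>\<open>large_sets_adjacent\<close> makes the search succeed, and whichever linked pair
  it finds will do: the branches have different roots, hence are disjoint. The path lies in
  \<open>dom W \<union> {a, b}\<close> and contains with each vertex its centre in \<open>W\<close>,
  as \<open>good_extend\<close> requires.\<close>

lemma join_correct:
  assumes st: "stage U a b depth st" and ab: "a \<in> S - U" "b \<in> S - U" "a \<noteq> b"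
  defines "q \<equiv> join G a b (fst st)"
  shows "is_path E a q b" "path_length q = 2 * depth + 1" "set q \<inter> U = {}"
    "set q \<inter> S = {a, b}" "set q \<subseteq> {..<n}" "good (U \<union> set q)"
proof -
  let ?p = "map_of (snd st)"
  from st obtain La Lb W where L: "fst st = La @ Lb" and La: "chains ?p a depth La"
    and Lb: "chains ?p b depth Lb" and W: "star_system U W" "closed_for U W" "?p \<subseteq>\<^sub>m W"
    and p: "star_system U ?p"
    unfolding stage_def by blast
  have ch: "p \<noteq> [] \<and> length p = Suc depth \<and> last p \<in> {a, b} \<and> chain W p" if "p \<in> set (fst st)" for p
    using that La Lb L chain_mono[OF _ W(3)] by (auto simp: chains_def)
  have domS: "dom W \<inter> S = {}" "dom W \<inter> U = {}" using W(1) by (auto simp: star_system_def)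
  \<comment> \<open>Apart from its root a branch consists of leaves of stars, and these avoid
    \<open>S\<close>. A branch containing \<open>a\<close> is therefore rooted at
    \<open>a\<close>.\<close>
  have S_last: "x = last p" if "p \<in> set (fst st)" "x \<in> set p" "x \<in> S" for p x
    using chain_subset[of W p] ch[OF that(1)] that domS by auto
  define C where "C = concat (map (\<lambda>p. map (\<lambda>q. rev p @ q) (filter (linked G a b p) (fst st))) (fst st))"
  have q_eq: "q = concat (take 1 C)" by (simp add: q_def join_def C_def)
  have "C \<noteq> []"
  proof -
    have tipsA: "hd ` set La \<subseteq> {..<n} - U" and tipsB: "hd ` set Lb \<subseteq> {..<n} - U"
      using chains_tips[OF La p ab(1)] chains_tips[OF Lb p ab(2)] .
    have cA: "card (hd ` set La) = m ^ depth" and cB: "card (hd ` set Lb) = m ^ depth"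
      using La Lb distinct_card[of "map hd La"] distinct_card[of "map hd Lb"] by (auto simp: chains_def)
    have "\<exists>x\<in>hd ` set La. \<exists>y\<in>hd ` set Lb. (x, y) \<in> E"
      using tipsA tipsB n_le_depth m by (intro large_sets_adjacent[OF _ _ cA cB]) auto
    then obtain p r where pr: "p \<in> set La" "r \<in> set Lb" "(hd p, hd r) \<in> E" by auto
    have ne: "p \<noteq> []" "r \<noteq> []" using pr La Lb by (auto simp: chains_def)
    have "last p = a" "last r = b" using pr La Lb by (auto simp: chains_def)
    moreover have "hd p < n" using pr(3) E by auto
    ultimately have "linked G a b p r"
      using pr(3) ne by (auto simp: linked_def take_1_hd set_neighbours nbhd_def)
    hence "rev p @ r \<in> set C" using pr L by (auto simp: C_def)
    thus ?thesis by auto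
  qed
  hence "q \<in> set C" by (cases C) (auto simp: q_eq)
  then obtain p r where q: "q = rev p @ r" and p_in: "p \<in> set (fst st)" and r_in: "r \<in> set (fst st)"
    and lk: "linked G a b p r" unfolding C_def by auto
  note p' = ch[OF p_in] and r' = ch[OF r_in]
  have lp: "last p = a" and lr: "last r = b"
    using lk S_last[OF p_in, of a] S_last[OF r_in, of b] ab by (auto simp: linked_def)
  have ndom: "last p \<notin> dom W" "last r \<notin> dom W" using lp lr ab domS by auto
  have "hd p < n \<and> (hd p, hd r) \<in> E"
  proof -
    have "hd r \<in> set (neighbours G (hd p))" using lk p' r' by (auto simp: linked_def take_1_hd)
    moreover from this have "hd p < n" by (simp add: neighbours_adj_list split: if_splits)
    ultimately show ?thesis by (simp add: set_neighbours nbhd_def)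
  qed
  hence edge: "(hd p, hd r) \<in> E" by simp
  have up: "(v, u) \<in> E \<and> (u, v) \<in> E" if "W u = Some v" for u v
    using W(1) that symE by (auto simp: star_system_def sym_def)
  have "successively (\<lambda>u v. (u, v) \<in> E) (rev p)"
    unfolding successively_rev using p' up by (auto elim: successively_mono)
  moreover have "successively (\<lambda>u v. (u, v) \<in> E) r"
    using r' up by (auto elim: successively_mono)
  ultimately have succ: "successively (\<lambda>u v. (u, v) \<in> E) q"
    using p' r' edge by (simp add: q successively_append_iff last_rev)
  have "distinct p" "distinct r" using chain_distinct p' r' ndom by auto
  moreover have "set p \<inter> set r = {}"
    using chain_meet[of W p r] p' r' ndom lp lr ab by auto
  ultimately have "distinct q" by (simp add: q)
  thus "is_path E a q b" using succ p' r' lp lr by (simp add: is_path_def q hd_rev hd_append)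
  show "path_length q = 2 * depth + 1" using p' r' by (simp add: path_length_def q)
  have sub: "set q \<subseteq> dom W \<union> {a, b}"
    using chain_subset[of W p] chain_subset[of W r] p' r' lp lr by (auto simp: q)
  show "set q \<inter> U = {}" using sub domS ab by auto
  have "a \<in> set q" "b \<in> set q" using lk by (auto simp: q linked_def)
  thus "set q \<inter> S = {a, b}" using sub domS ab by auto
  have "dom W \<subseteq> {..<n}" using W(1) E by (force simp: star_system_def)
  moreover have "{a, b} \<subseteq> {..<n}" using ab S by blast
  ultimately show "set q \<subseteq> {..<n}" using sub by blast
  show "good (U \<union> set q)"
  proof (rule good_extend[OF W(1,2)])
    show "set q \<subseteq> dom W \<union> S" using sub ab by auto
    show "v \<in> set q" if "u \<in> set q" "W u = Some v" for u v
      using that chain_up[of W p u v] chain_up[of W r u v] p' r' ndom by (auto simp: q)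
  qed
qed

end

section \<open>Running time of the routing program\<close>

abbreviation enc_nats :: "nat list \<Rightarrow> sexp" where "enc_nats \<equiv> enc_list enc_nat"
abbreviation enc_natss :: "nat list list \<Rightarrow> sexp" where "enc_natss \<equiv> enc_list enc_nats"
abbreviation enc_arcs :: "(nat \<times> nat) list \<Rightarrow> sexp" where "enc_arcs \<equiv> enc_list (enc_prod enc_nat enc_nat)"

lemma pt_neighbours:
  assumes "poly_time ea enc_natss g" "poly_time ea enc_nat v"
  shows "poly_time ea enc_nats (\<lambda>x. neighbours (g x) (v x))"
  unfolding neighbours_def by (rule pt_intros pt_comp[OF assms(1)] pt_comp[OF assms(2)])+

lemma pt_arcs:
  assumes "poly_time ea enc_natss g"
  shows "poly_time ea enc_arcs (\<lambda>x. arcs (g x))"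
  unfolding arcs_def by (rule pt_intros pt_neighbours pt_comp[OF assms])+

lemma pt_owned_by:
  assumes "poly_time ea enc_arcs par" "poly_time ea enc_nat u" "poly_time ea enc_nat v"
  shows "poly_time ea enc_bool (\<lambda>x. owned_by (par x) (u x) (v x))"
  unfolding owned_by_def
  by (rule pt_intros pt_comp[OF assms(1)] pt_comp[OF assms(2)] pt_comp[OF assms(3)])+

lemma pt_kids:
  assumes "poly_time ea enc_natss g" "poly_time ea enc_arcs par" "poly_time ea enc_nat v"
  shows "poly_time ea enc_nats (\<lambda>x. kids (g x) (par x) (v x))"
  unfolding kids_def
  by (rule pt_intros pt_neighbours pt_owned_by pt_comp[OF assms(1)] pt_comp[OF assms(2)] pt_comp[OF assms(3)])+

lemma pt_blocked:
  assumes "poly_time ea enc_nats us" "poly_time ea enc_arcs par" "poly_time ea enc_nat u"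
  shows "poly_time ea enc_bool (\<lambda>x. blocked (us x) (par x) (u x))"
  unfolding blocked_def
  by (rule pt_intros pt_comp[OF assms(1)] pt_comp[OF assms(2)] pt_comp[OF assms(3)])+

lemma pt_price:
  assumes "poly_time ea enc_arcs H" "poly_time ea enc_nat u"
  shows "poly_time ea enc_nat (\<lambda>x. price (H x) (u x))"
  unfolding price_def by (rule pt_intros pt_comp[OF assms(1)] pt_comp[OF assms(2)])+

lemma pt_in_need:
  assumes "poly_time ea enc_natss g" "poly_time ea enc_nat m" "poly_time ea enc_nats ul"
    "poly_time ea enc_nats sl" "poly_time ea enc_nats phi" "poly_time ea enc_arcs par" "poly_time ea enc_nat v"
  shows "poly_time ea enc_bool (\<lambda>x. in_need (g x) (m x) (ul x) (sl x) (phi x) (par x) (v x))"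
  unfolding in_need_def
  by (rule pt_intros pt_neighbours pt_blocked pt_kids pt_comp[OF assms(1)] pt_comp[OF assms(2)]
      pt_comp[OF assms(3)] pt_comp[OF assms(4)] pt_comp[OF assms(5)] pt_comp[OF assms(6)] pt_comp[OF assms(7)])+

lemma pt_moves:
  assumes "poly_time ea enc_natss g" "poly_time ea enc_nat m" "poly_time ea enc_nats ul"
    "poly_time ea enc_nats sl" "poly_time ea enc_nats phi" "poly_time ea enc_arcs par" "poly_time ea enc_arcs H"
  shows "poly_time ea enc_arcs (\<lambda>x. moves (g x) (m x) (ul x) (sl x) (phi x) (par x) (H x))"
  unfolding moves_def
  by (rule pt_intros pt_neighbours pt_arcs pt_blocked pt_price pt_in_need pt_comp[OF assms(1)] pt_comp[OF assms(2)]
      pt_comp[OF assms(3)] pt_comp[OF assms(4)] pt_comp[OF assms(5)] pt_comp[OF assms(6)] pt_comp[OF assms(7)])+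

lemma pt_clock:
  assumes "poly_time ea enc_natss g"
  shows "poly_time ea enc_nats (\<lambda>x. clock (g x))"
  unfolding clock_def by (rule pt_intros pt_comp[OF assms])+

lemma size_moves_le: "size (enc_arcs (take 1 (moves g m ul sl phi par H))) \<le> size (enc_arcs (arcs g))"
  unfolding moves_def by (rule order_trans[OF size_enc_take size_enc_filter])

lemma pt_auction:
  assumes "poly_time ea enc_natss g" "poly_time ea enc_nat m" "poly_time ea enc_nats ul"
    "poly_time ea enc_nats sl" "poly_time ea enc_nats phi" "poly_time ea enc_arcs par"
  shows "poly_time ea enc_arcs (\<lambda>x. auction (g x) (m x) (ul x) (sl x) (phi x) (par x))"
proof -
  have step: "poly_time (enc_prod ea (enc_prod enc_arcs enc_nat)) enc_arcs
    (\<lambda>z. take 1 (moves (g (fst z)) (m (fst z)) (ul (fst z)) (sl (fst z)) (phi (fst z)) (par (fst z)) (fst (snd z)))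
       @ fst (snd z))"
    by (rule pt_intros pt_moves pt_comp[OF assms(1)] pt_comp[OF assms(2)]
      pt_comp[OF assms(3)] pt_comp[OF assms(4)] pt_comp[OF assms(5)] pt_comp[OF assms(6)])+
  have "poly_time ea enc_arcs (\<lambda>x. foldl
      (\<lambda>H _. take 1 (moves (g x) (m x) (ul x) (sl x) (phi x) (par x) H) @ H) [] (clock (g x)))"
  proof (rule pt_foldl_additive[where ec = enc_nat, OF step pt_clock[OF assms(1)] pt_const])
    show "poly_bounded ea (\<lambda>x. size (enc_arcs (arcs (g x))))"
      by (rule poly_time_size[OF pt_arcs[OF assms(1)]])
    show "size (enc_arcs (take 1 (moves (g x) (m x) (ul x) (sl x) (phi x) (par x) H) @ H))
        \<le> size (enc_arcs H) + size (enc_arcs (arcs (g x)))" for x H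
      using size_moves_le by (simp only: size_enc_list_append add.commute add_le_mono)
  qed
  from pt_append[OF this assms(6)] show ?thesis unfolding auction_def .
qed

lemma pt_tips:
  assumes "poly_time ea enc_natss L"
  shows "poly_time ea enc_nats (\<lambda>x. tips (L x))"
  unfolding tips_def by (rule pt_intros pt_comp[OF assms])+

lemma pt_extend:
  assumes "poly_time ea enc_natss g" "poly_time ea enc_arcs par" "poly_time ea enc_natss L"
  shows "poly_time ea enc_natss (\<lambda>x. extend (g x) (par x) (L x))"
  unfolding extend_def
  by (rule pt_intros pt_kids pt_comp[OF assms(1)] pt_comp[OF assms(2)] pt_comp[OF assms(3)])+

abbreviation enc_state :: "nat list list \<times> (nat \<times> nat) list \<Rightarrow> sexp" where
  "enc_state \<equiv> enc_prod enc_natss enc_arcs"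

lemma pt_grow:
  assumes "poly_time ea enc_natss g" "poly_time ea enc_nat m" "poly_time ea enc_nats ul"
    "poly_time ea enc_nats sl" "poly_time ea enc_state st"
  shows "poly_time ea enc_state (\<lambda>x. grow (g x) (m x) (ul x) (sl x) (st x))"
  unfolding grow_def
  by (rule pt_intros pt_auction pt_extend pt_tips pt_comp[OF assms(1)] pt_comp[OF assms(2)]
      pt_comp[OF assms(3)] pt_comp[OF assms(4)] pt_comp[OF assms(5)])+

lemma neighbours_size:
  "length (neighbours g v) \<le> size (enc_natss g)" "u \<in> set (neighbours g v) \<Longrightarrow> u \<le> size (enc_natss g)"
proof -
  have row: "neighbours g v = [] \<or> neighbours g v \<in> set g"
    unfolding neighbours_def using set_drop_subset[of v g] by (cases "drop v g") auto
  show "length (neighbours g v) \<le> size (enc_natss g)"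
    using row length_le_size_enc[of "neighbours g v" enc_nat] size_enc_elem[of "neighbours g v" g enc_nats] by auto
  show "u \<le> size (enc_natss g)" if "u \<in> set (neighbours g v)"
    using row that size_enc_elem[of u "neighbours g v" enc_nat] size_enc_elem[of "neighbours g v" g enc_nats] by auto
qed

lemma size_auction:
  "size (enc_arcs (auction g m ul sl phi par)) \<le>
     size (enc_arcs par) + length (clock g) * size (enc_arcs (arcs g))"
proof -
  have "size (enc_arcs (foldl (\<lambda>H _. take 1 (moves g m ul sl phi par H) @ H) [] (clock g)))
      \<le> size (enc_arcs []) + length (clock g) * size (enc_arcs (arcs g))"
    using size_moves_le
    by (intro foldl_size_additive) (simp only: size_enc_list_append add.commute add_le_mono)
  thus ?thesis by (simp add: auction_def size_enc_list_append)
qed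

lemma length_extend:
  "length (extend g par L) \<le> length L * size (enc_natss g)"
proof -
  have "length (kids g par v) \<le> size (enc_natss g)" for v
    unfolding kids_def by (rule order_trans[OF length_filter_le neighbours_size(1)])
  hence "length (concat (map (kids g par) (take 1 p))) \<le> size (enc_natss g)" for p
    by (cases p) auto
  thus ?thesis unfolding extend_def by (induction L) (auto intro: add_le_mono)
qed

text \<open>The bounds must hold for arbitrary inputs. An extension multiplies the number of
  branches, but the test in \<open>grow\<close> permits it only while there are fewer than
  \<open>length g\<close> of them, so the factors do not accumulate over the rounds.\<close>

lemma size_grow:
  assumes "length (fst st) \<le> 2 + length g * size (enc_natss g)"
    and bound: "\<And>p. p \<in> set (fst st) \<Longrightarrow> size (enc_nats p) \<le> c"
    and st'_eq: "st' = grow g m ul sl st"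
  shows "length (fst st') \<le> 2 + length g * size (enc_natss g)"
    and "p \<in> set (fst st') \<Longrightarrow> size (enc_nats p) \<le> c + size (enc_natss g) + 1"
    and "size (enc_arcs (snd st')) \<le> size (enc_arcs (snd st)) + length (clock g) * size (enc_arcs (arcs g))"
proof -
  define par where "par = auction g m ul sl (tips (fst st)) (snd st)"
  have st': "st' = (if 0 < m \<and> 160 * m * length (fst st) < length g then (extend g par (fst st), par) else st)"
    by (simp add: st'_eq grow_def par_def Let_def)
  show "size (enc_arcs (snd st')) \<le> size (enc_arcs (snd st)) + length (clock g) * size (enc_arcs (arcs g))"
    using size_auction by (simp add: st' par_def)
  show "length (fst st') \<le> 2 + length g * size (enc_natss g)"
  proof (cases "0 < m \<and> 160 * m * length (fst st) < length g")
    case True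
    have "length (fst st) \<le> 160 * m * length (fst st)" using True by simp
    hence "length (fst st) \<le> length g" using True by linarith
    hence "length (fst st) * size (enc_natss g) \<le> length g * size (enc_natss g)" by (rule mult_le_mono1)
    hence "length (extend g par (fst st)) \<le> length g * size (enc_natss g)"
      by (rule order_trans[OF length_extend])
    thus ?thesis using True by (simp add: st')
  next
    case False
    hence "st' = st" unfolding st' by (rule if_not_P)
    thus ?thesis using assms(1) by simp
  qed
  show "size (enc_nats p) \<le> c + size (enc_natss g) + 1" if "p \<in> set (fst st')"
  proof (cases "p \<in> set (fst st)")
    case True
    thus ?thesis using bound[of p] by simp
  next
    case False
    hence "p \<in> set (extend g par (fst st))" using that by (auto simp: st' split: if_splits)
    then obtain p' u v where p: "p = u # p'" "p' \<in> set (fst st)" "u \<in> set (kids g par v)"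
      unfolding extend_def by auto
    have "u \<le> size (enc_natss g)" using p(3) neighbours_size(2) by (auto simp: kids_def)
    thus ?thesis using p bound[OF p(2)] by simp
  qed
qed

lemma pt_forest:
  assumes "poly_time ea enc_natss g" "poly_time ea enc_nat m" "poly_time ea enc_nats ul"
    "poly_time ea enc_nats sl" "poly_time ea enc_nat a" "poly_time ea enc_nat b"
  shows "poly_time ea enc_state (\<lambda>x. forest (g x) (m x) (ul x) (sl x) (a x) (b x))"
proof -
  have step: "poly_time (enc_prod ea (enc_prod enc_state enc_nat)) enc_state
    (\<lambda>z. grow (g (fst z)) (m (fst z)) (ul (fst z)) (sl (fst z)) (fst (snd z)))"
    by (rule pt_intros pt_grow pt_comp[OF assms(1)] pt_comp[OF assms(2)]
      pt_comp[OF assms(3)] pt_comp[OF assms(4)])+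
  have levels: "poly_time ea enc_nats (\<lambda>x. down_list (length (g x)))"
    by (rule pt_intros pt_comp[OF assms(1)])+
  have init: "poly_time ea enc_state (\<lambda>x. ([[a x], [b x]], []))"
    by (rule pt_intros pt_comp[OF assms(5)] pt_comp[OF assms(6)])+
  define R where "R x = size (enc_natss (g x))" for x
  define A where "A x = size (enc_nats (clock (g x))) * size (enc_arcs (arcs (g x)))" for x
  \<comment> \<open>At most \<open>2 + R x * R x\<close> branches, each gaining at most
    \<open>R x + 1\<close> in size per round, and a log that gains at most \<open>A x\<close> per
    round, for at most \<open>R x\<close> rounds.\<close>
  define B where "B x = (2 + R x * R x) * (R x * (R x + 1) + (a x + b x + 1) + 1) + R x * A x + 1" for x
  have R: "poly_bounded ea R" unfolding R_def by (rule poly_time_size[OF assms(1)])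
  have A: "poly_bounded ea A"
    unfolding A_def by (intro poly_bounded_mult poly_time_size[OF pt_clock[OF assms(1)]]
        poly_time_size[OF pt_arcs[OF assms(1)]])
  have ab: "poly_bounded ea a" "poly_bounded ea b"
    using poly_time_size[OF assms(5)] poly_time_size[OF assms(6)] by simp_all
  show ?thesis
    unfolding forest_def
  proof (rule pt_foldl[where ec = enc_nat, OF step levels init])
    show "poly_bounded ea B" unfolding B_def by (intro poly_bounded_intros R A ab)
    fix x ys zs assume "down_list (length (g x)) = ys @ zs"
    hence "length ys \<le> length (g x)" by (metis le_add1 length_append length_down_list)
    hence len: "length ys \<le> R x" using length_le_size_enc[of "g x" enc_nats] by (simp add: R_def)
    let ?st = "\<lambda>ys. foldl (\<lambda>st _. grow (g x) (m x) (ul x) (sl x) st) ([[a x], [b x]], []) ys"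
    have "length (fst (?st ys)) \<le> 2 + length (g x) * R x \<and>
      (\<forall>p\<in>set (fst (?st ys)). size (enc_nats p) \<le> length ys * (R x + 1) + (a x + b x + 1)) \<and>
      size (enc_arcs (snd (?st ys))) \<le> length ys * A x" for ys :: "nat list"
    proof (induction ys rule: rev_induct)
      case (snoc y ys)
      note G = size_grow[of "?st ys" "g x" "length ys * (R x + 1) + (a x + b x + 1)"
          _ "m x" "ul x" "sl x", OF _ _ refl, folded R_def]
      have "length (clock (g x)) * size (enc_arcs (arcs (g x))) \<le> A x"
        unfolding A_def by (intro mult_le_mono1 length_le_size_enc)
      thus ?case using G snoc by (fastforce simp: algebra_simps)
    qed auto
    note b = this[of ys]
    have "size (enc_natss (fst (?st ys))) \<le>
        length (fst (?st ys)) * (length ys * (R x + 1) + (a x + b x + 1) + 1)"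
      using b by (intro size_enc_list_le) blast
    also have "\<dots> \<le> (2 + R x * R x) * (R x * (R x + 1) + (a x + b x + 1) + 1)"
    proof (rule mult_le_mono)
      have "length (g x) * R x \<le> R x * R x"
        unfolding R_def by (intro mult_le_mono1 length_le_size_enc)
      thus "length (fst (?st ys)) \<le> 2 + R x * R x" using b by linarith
      show "length ys * (R x + 1) + (a x + b x + 1) + 1 \<le> R x * (R x + 1) + (a x + b x + 1) + 1"
        using mult_le_mono1[OF len, of "R x + 1"] by simp
    qed
    finally have "size (enc_natss (fst (?st ys))) \<le> (2 + R x * R x) * (R x * (R x + 1) + (a x + b x + 1) + 1)" .
    moreover have "size (enc_arcs (snd (?st ys))) \<le> R x * A x"
      using b mult_le_mono1[OF len, of "A x"] by linarith
    ultimately show "size (enc_state (?st ys)) \<le> B x"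
      by (simp add: enc_prod_def B_def)
  qed
qed

lemma pt_linked:
  assumes "poly_time ea enc_natss g" "poly_time ea enc_nat a" "poly_time ea enc_nat b"
    "poly_time ea enc_nats p" "poly_time ea enc_nats q"
  shows "poly_time ea enc_bool (\<lambda>x. linked (g x) (a x) (b x) (p x) (q x))"
  unfolding linked_def
  by (rule pt_intros pt_neighbours pt_comp[OF assms(1)] pt_comp[OF assms(2)]
      pt_comp[OF assms(3)] pt_comp[OF assms(4)] pt_comp[OF assms(5)])+

lemma pt_join:
  assumes "poly_time ea enc_natss g" "poly_time ea enc_nat a" "poly_time ea enc_nat b"
    "poly_time ea enc_natss L"
  shows "poly_time ea enc_nats (\<lambda>x. join (g x) (a x) (b x) (L x))"
  unfolding join_def
  by (rule pt_intros pt_linked pt_comp[OF assms(1)] pt_comp[OF assms(2)]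
      pt_comp[OF assms(3)] pt_comp[OF assms(4)])+

text \<open>The integer part of the \<open>q\<close>-th root of the degree, found by counting the
  positive integers below it; vertex 0 represents the regular graph.\<close>

definition branching :: "nat \<Rightarrow> nat list list \<Rightarrow> nat" where
  "branching q g = length (filter (\<lambda>i. 0 < i \<and> i ^ q \<le> length (neighbours g 0)) (down_list (length g)))"

lemma pt_branching:
  assumes "poly_time ea enc_natss g"
  shows "poly_time ea enc_nat (\<lambda>x. branching q (g x))"
  unfolding branching_def by (rule pt_intros pt_neighbours pt_comp[OF assms])+

type_synonym request = "nat list list \<times> nat list \<times> nat list list \<times> nat \<times> nat"

definition route :: "nat \<Rightarrow> request \<Rightarrow> nat list" where
  "route q x = join (fst x) (fst (snd (snd (snd x)))) (snd (snd (snd (snd x))))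
     (fst (forest (fst x) (branching q (fst x)) (concat (fst (snd (snd x)))) (fst (snd x))
       (fst (snd (snd (snd x)))) (snd (snd (snd (snd x))))))"

lemma pt_route:
  "poly_time (enc_prod enc_natss (enc_prod enc_nats (enc_prod enc_natss (enc_prod enc_nat enc_nat))))
     enc_nats (route q)"
proof -
  have "poly_time (enc_prod enc_natss (enc_prod enc_nats (enc_prod enc_natss (enc_prod enc_nat enc_nat))))
     enc_nats (\<lambda>x. route q x)"
    unfolding route_def by (rule pt_intros pt_join pt_forest pt_branching)+
  thus ?thesis by simp
qed

section \<open>Serving the pairs one after the other\<close>

context expander
begin

text \<open>Beyond the claim, the induction carries that the occupied set is good and that each path
  meets \<open>S\<close> in its two endpoints only. The latter keeps the endpoints of later pairs
  free. By \<open>few\<close> the occupied set never exceeds \<open>n / 90\<close>.\<close>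

lemma route_online:
  assumes ps: "disjoint_pairs_in S ps" and few: "90 * (length ps * (2 * depth + 2)) \<le> n"
    and br: "branching k G = m"
  shows "\<exists>qs. length qs = length ps \<and>
    (\<forall>i<length ps. qs ! i = route k (G, sorted_list_of_set S, take i qs, ps ! i) \<and>
       is_path E (fst (ps ! i)) (qs ! i) (snd (ps ! i)) \<and> path_length (qs ! i) = 2 * depth + 1 \<and>
       set (qs ! i) \<subseteq> {..<n}) \<and>
    (\<forall>i<length ps. \<forall>j<length ps. i \<noteq> j \<longrightarrow> set (qs ! i) \<inter> set (qs ! j) = {})"
proof -
  define ok where "ok qs \<longleftrightarrow>
    (\<forall>i<length qs. qs ! i = route k (G, sorted_list_of_set S, take i qs, ps ! i) \<and>
       is_path E (fst (ps ! i)) (qs ! i) (snd (ps ! i)) \<and> path_length (qs ! i) = 2 * depth + 1 \<and>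
       set (qs ! i) \<subseteq> {..<n} \<and> set (qs ! i) \<inter> S = {fst (ps ! i), snd (ps ! i)}) \<and>
    (\<forall>i<length qs. \<forall>j<length qs. i \<noteq> j \<longrightarrow> set (qs ! i) \<inter> set (qs ! j) = {}) \<and>
    good (set (concat qs))" for qs
  have sl: "set (sorted_list_of_set S) = S" using finite_subset[OF S] by simp
  have dist: "distinct (map fst ps @ map snd ps)" and sub: "set (map fst ps @ map snd ps) \<subseteq> S"
    using ps by (auto simp: disjoint_pairs_in_def)
  have "\<exists>qs. length qs = j \<and> ok qs" if "j \<le> length ps" for j
    using that
  proof (induction j)
    case 0
    show ?case using good_empty by (simp add: ok_def)
  next
    case (Suc j)
    then obtain qs where len: "length qs = j" and ok: "ok qs" by auto
    have j: "j < length ps" using Suc.prems by simp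
    have old_route: "qs ! i = route k (G, sorted_list_of_set S, take i qs, ps ! i)"
      and old_path: "is_path E (fst (ps ! i)) (qs ! i) (snd (ps ! i))"
      and old_length: "path_length (qs ! i) = 2 * depth + 1"
      and old_subset: "set (qs ! i) \<subseteq> {..<n}"
      and old_ends: "set (qs ! i) \<inter> S = {fst (ps ! i), snd (ps ! i)}" if "i < j" for i
      using ok that unfolding ok_def len by blast+
    have old_disj: "set (qs ! i) \<inter> set (qs ! i') = {}" if "i < j" "i' < j" "i \<noteq> i'" for i i'
      using ok that unfolding ok_def len by blast
    define U where "U = set (concat qs)"
    define a b where "a = fst (ps ! j)" and "b = snd (ps ! j)"
    have Uin: "\<exists>i<j. u \<in> set (qs ! i)" if "u \<in> U" for u
    proof -
      from that obtain q where "q \<in> set qs" "u \<in> set q" by (auto simp: U_def)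
      thus ?thesis using len by (metis in_set_conv_nth)
    qed
    have Un: "U \<subseteq> {..<n}" using Uin old_subset by blast
    have "length q = 2 * depth + 2" if "q \<in> set qs" for q
    proof -
      from that len obtain i where i: "i < j" "q = qs ! i" by (metis in_set_conv_nth)
      have "q \<noteq> []" "path_length q = 2 * depth + 1"
        using old_path[OF i(1)] old_length[OF i(1)] i(2) by (simp_all add: is_path_def)
      thus ?thesis by (cases q) (auto simp: path_length_def)
    qed
    hence "length (concat qs) = (2 * depth + 2) * j"
      using length_concat_const[of qs "\<lambda>q. q" "2 * depth + 2"] len by simp
    hence "card U \<le> (2 * depth + 2) * j" unfolding U_def by (metis card_length)
    also have "\<dots> \<le> (2 * depth + 2) * length ps" using j by (intro mult_le_mono2) simp
    finally have cardU: "90 * card U \<le> n" using few by (simp add: mult.commute)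
    have "a \<in> set (map fst ps)" "b \<in> set (map snd ps)" using j by (auto simp: a_def b_def)
    hence ab: "a \<in> S" "b \<in> S" "a \<noteq> b"
      using sub dist by (auto simp del: set_map)
    have fresh: "a \<noteq> fst (ps ! i) \<and> a \<noteq> snd (ps ! i) \<and> b \<noteq> fst (ps ! i) \<and> b \<noteq> snd (ps ! i)"
      if i: "i < j" for i
    proof -
      have "fst (ps ! i) \<noteq> fst (ps ! j)" "snd (ps ! i) \<noteq> snd (ps ! j)"
        using dist i j nth_eq_iff_index_eq[of "map fst ps" i j] nth_eq_iff_index_eq[of "map snd ps" i j]
        by auto
      moreover have "fst (ps ! i') \<noteq> snd (ps ! j')" if "i' < length ps" "j' < length ps" for i' j'
      proof -
        have "fst (ps ! i') \<in> set (map fst ps)" "snd (ps ! j') \<in> set (map snd ps)" using that by auto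
        thus ?thesis using dist by (metis disjoint_iff distinct_append)
      qed
      ultimately show ?thesis using i j by (metis a_def b_def order_less_trans)
    qed
    have notU: "a \<notin> U" "b \<notin> U"
    proof -
      have "x \<noteq> a \<and> x \<noteq> b" if "x \<in> U" "x \<in> S" for x
      proof -
        obtain i where i: "i < j" "x \<in> set (qs ! i)" using Uin[OF \<open>x \<in> U\<close>] by blast
        hence "x \<in> {fst (ps ! i), snd (ps ! i)}" using old_ends[OF i(1)] \<open>x \<in> S\<close> by blast
        thus ?thesis using fresh[OF i(1)] by auto
      qed
      thus "a \<notin> U" "b \<notin> U" using ab by auto
    qed
    have "good U" using ok by (simp add: ok_def U_def)
    hence st: "stage U a b depth (forest G m (concat qs) (sorted_list_of_set S) a b)"
      using Un cardU ab notU sl by (intro stage_forest) (auto simp: U_def)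
    define q where "q = join G a b (fst (forest G m (concat qs) (sorted_list_of_set S) a b))"
    have q_route: "q = route k (G, sorted_list_of_set S, qs, ps ! j)"
      by (simp add: q_def route_def br a_def b_def)
    have abU: "a \<in> S - U" "b \<in> S - U" using ab notU by auto
    note J = join_correct[OF st abU ab(3), folded q_def]
    have disj: "set (qs ! i) \<inter> set q = {}" if "i < j" for i
    proof -
      have "qs ! i \<in> set qs" using that len by simp
      hence "set (qs ! i) \<subseteq> U" by (auto simp: U_def)
      thus ?thesis using J(3) by auto
    qed
    have nth: "(qs @ [q]) ! i = qs ! i" if "i < j" for i using that len by (simp add: nth_append)
    have nth_j: "(qs @ [q]) ! j = q" using len by (simp add: nth_append)
    have new: "is_path E (fst (ps ! i)) ((qs @ [q]) ! i) (snd (ps ! i)) \<and>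
        path_length ((qs @ [q]) ! i) = 2 * depth + 1 \<and> set ((qs @ [q]) ! i) \<subseteq> {..<n} \<and>
        set ((qs @ [q]) ! i) \<inter> S = {fst (ps ! i), snd (ps ! i)}" if i: "i < j \<or> i = j" for i
      using i
    proof
      assume less: "i < j"
      show ?thesis
        unfolding nth[OF less] by (intro conjI old_path old_length old_subset old_ends less)
    next
      assume eq: "i = j"
      show ?thesis
        unfolding eq nth_j a_def[symmetric] b_def[symmetric] by (intro conjI J(1,2,4,5))
    qed
    have "ok (qs @ [q])"
      unfolding ok_def
    proof (intro conjI allI impI)
      fix i assume "i < length (qs @ [q])"
      hence i: "i < j \<or> i = j" using len by auto
      show "(qs @ [q]) ! i = route k (G, sorted_list_of_set S, take i (qs @ [q]), ps ! i)"
        using i old_route[of i] q_route len by (auto simp: nth_append)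
      show "is_path E (fst (ps ! i)) ((qs @ [q]) ! i) (snd (ps ! i))"
        "path_length ((qs @ [q]) ! i) = 2 * depth + 1" "set ((qs @ [q]) ! i) \<subseteq> {..<n}"
        "set ((qs @ [q]) ! i) \<inter> S = {fst (ps ! i), snd (ps ! i)}"
        using new[OF i] by blast+
    next
      fix i i' assume "i < length (qs @ [q])" "i' < length (qs @ [q])" "i \<noteq> i'"
      thus "set ((qs @ [q]) ! i) \<inter> set ((qs @ [q]) ! i') = {}"
        using old_disj[of i i'] len disj[of i] disj[of i'] nth[of i] nth[of i'] nth_j
        by (cases "i = j"; cases "i' = j") (simp_all add: Int_commute)
    next
      show "good (set (concat (qs @ [q])))" using J(6) by (simp add: U_def)
    qed
    thus ?case using len by (intro exI[of _ "qs @ [q]"]) simp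
  qed
  from this[of "length ps"] obtain qs where len: "length qs = length ps" and ok: "ok qs" by auto
  show ?thesis
    using ok unfolding ok_def len by (intro exI[of _ qs] conjI len) blast+
qed

end

section \<open>The branching number and the final estimates\<close>

lemma length_filter_card: "distinct xs \<Longrightarrow> length (filter P xs) = card {x \<in> set xs. P x}"
  by (metis distinct_card distinct_filter set_filter)

lemma branching_eq_floor:
  assumes d: "length (neighbours g 0) = d" "0 < d" "d < length g" and k: "0 < k"
  shows "branching k g = nat \<lfloor>real d powr (1 / k)\<rfloor>"
proof -
  define r where "r = nat \<lfloor>real d powr (1 / k)\<rfloor>"
  have iff: "i ^ k \<le> d \<longleftrightarrow> i \<le> r" if i: "0 < i" for i
  proof -
    have "i ^ k \<le> d \<longleftrightarrow> real i ^ k \<le> real d" by (metis of_nat_le_iff of_nat_power)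
    also have "\<dots> \<longleftrightarrow> (real i ^ k) powr (1 / k) \<le> real d powr (1 / k)"
    proof (cases "real i ^ k \<le> real d")
      case True
      thus ?thesis using powr_mono2[of "1 / k" "real i ^ k" "real d"] by simp
    next
      case False
      thus ?thesis using powr_less_mono2[of "1 / k" "real d" "real i ^ k"] k by simp
    qed
    also have "(real i ^ k) powr (1 / k) = real i"
      using i k by (simp add: powr_powr flip: powr_realpow)
    also have "real i \<le> real d powr (1 / k) \<longleftrightarrow> i \<le> r"
      unfolding r_def by (simp add: le_nat_iff le_floor_iff)
    finally show ?thesis .
  qed
  \<comment> \<open>As \<open>d < length g\<close>, the search range of \<open>branching\<close>
    does not cut off the root.\<close>
  have "r \<le> d"
  proof (cases "r = 0")
    case False
    hence "r ^ k \<le> d" using iff[of r] by simp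
    moreover have "r ^ 1 \<le> r ^ k" using False k by (intro power_increasing) auto
    ultimately show ?thesis by simp
  qed simp
  hence "{i \<in> set (down_list (length g)). 0 < i \<and> i ^ k \<le> length (neighbours g 0)} = {1..r}"
    using iff d by auto
  thus ?thesis
    by (simp add: branching_def length_filter_card r_def down_list_def)
qed

text \<open>\<open>(m + 1) / m \<le> 4 / 3\<close>, and \<open>(4 / 3) ^ 5 = 1024 / 243\<close> is
  below \<open>27 \<le> m ^ 3\<close>.\<close>

lemma Suc_pow5_le: "3 \<le> m \<Longrightarrow> Suc m ^ 5 \<le> m ^ 8"
proof -
  assume m: "3 \<le> m"
  have "(3 * Suc m) ^ 5 \<le> (4 * m) ^ 5" using m by (intro power_mono) auto
  hence 1: "243 * Suc m ^ 5 \<le> 1024 * m ^ 5" by (simp only: power_mult_distrib) simp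
  have "3 ^ 3 \<le> m ^ 3" using m by (intro power_mono) auto
  hence "3 ^ 3 * m ^ 5 \<le> m ^ 3 * m ^ 5" by (rule mult_le_mono1)
  also have "\<dots> = m ^ 8" by (simp flip: power_add)
  finally have "27 * m ^ 5 \<le> m ^ 8" by simp
  thus ?thesis using 1 by linarith
qed

text \<open>With \<open>x = d\<^sup>\<epsilon>\<close> and \<open>y\<close> the root that is rounded down to \<open>m\<close>, the last claim is
  \<open>x\<^sup>4 \<le> y\<^sup>5 < (m + 1)\<^sup>5 \<le> m\<^sup>8\<close>; the first step is \<open>1 / \<lceil>1 / \<epsilon>\<rceil> \<ge> 4 / 5 * \<epsilon>\<close>, as \<open>\<epsilon> < 1 / 4\<close>.\<close>

lemma branching_bounds:
  fixes \<epsilon> :: real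
  assumes eps: "0 < \<epsilon>" "\<epsilon> < 1 / 4" and d: "real d powr \<epsilon> \<ge> 5"
  defines "m \<equiv> nat \<lfloor>real d powr (1 / real (nat \<lceil>1 / \<epsilon>\<rceil>))\<rfloor>"
  shows "3 \<le> m" "real m \<le> real d powr \<epsilon>" "real d powr \<epsilon> \<le> (real m)\<^sup>2"
proof -
  define k where "k = nat \<lceil>1 / \<epsilon>\<rceil>"
  define x where "x = real d powr \<epsilon>"
  define y where "y = real d powr (1 / k)"
  have d0: "0 < real d" using d by (cases "d = 0") auto
  have d1: "1 \<le> real d" using d0 by simp
  have inv4: "4 < 1 / \<epsilon>" using eps by (simp add: field_simps)
  have k: "1 / \<epsilon> \<le> k" "k < 1 / \<epsilon> + 1"
    unfolding k_def using inv4 ceiling_correct[of "1 / \<epsilon>"] by linarith+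
  have kpos: "0 < real k" using k inv4 by linarith
  have "\<epsilon> * k \<ge> 1" using k(1) eps by (simp add: field_simps)
  hence low: "1 / k \<le> \<epsilon>" using kpos by (simp add: field_simps)
  have "\<epsilon> * k < 1 + \<epsilon>" using k(2) eps by (simp add: field_simps)
  hence "4 * (\<epsilon> * k) \<le> 5" using eps by linarith
  hence high: "\<epsilon> * (4 / 5) \<le> 1 / k" using kpos by (simp add: field_simps)
  have yx: "y \<le> x" unfolding y_def x_def using low d1 by (intro powr_mono) auto
  have "x powr (4 / 5) = real d powr (\<epsilon> * (4 / 5))" by (simp add: x_def powr_powr)
  also have "\<dots> \<le> y" unfolding y_def using high d1 by (intro powr_mono) auto
  finally have xy: "x powr (4 / 5) \<le> y" .
  have x5: "5 \<le> x" using d by (simp add: x_def)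
  have "(x powr (4 / 5)) ^ 5 = (x powr (4 / 5)) powr 5" using x5 by simp
  also have "\<dots> = x powr 4" by (subst powr_powr) simp
  also have "\<dots> = x ^ 4" using x5 by simp
  finally have x4: "x ^ 4 \<le> y ^ 5" using power_mono[OF xy, of 5] by simp
  have y0: "0 \<le> y" by (simp add: y_def)
  \<comment> \<open>243 against 625: the assumption \<open>d powr \<epsilon> \<ge> 5\<close> enters
    here to give \<open>3 \<le> m\<close>.\<close>
  have "3 ^ 5 \<le> (5 :: real) ^ 4" by simp
  also have "\<dots> \<le> x ^ 4" using x5 by (intro power_mono) auto
  finally have "3 ^ 5 \<le> y ^ 5" using x4 by linarith
  hence y3: "3 \<le> y" using power_le_imp_le_base[of 3 4 y] y0 by (simp add: numeral_eq_Suc)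
  have m: "real m \<le> y" "y < real m + 1"
    using y3 unfolding m_def k_def[symmetric] y_def[symmetric] by linarith+
  show m3: "3 \<le> m" using y3 unfolding m_def k_def[symmetric] y_def[symmetric]
    by (simp add: le_nat_iff le_floor_iff)
  show "real m \<le> real d powr \<epsilon>" using m yx by (simp add: x_def)
  have "y ^ 5 \<le> real (Suc m) ^ 5" using m y0 by (intro power_mono) auto
  also have "\<dots> \<le> real m ^ 8"
    using Suc_pow5_le[OF m3] by (metis of_nat_le_iff of_nat_power)
  finally have "x ^ 4 \<le> ((real m)\<^sup>2) ^ 4" using x4 by (simp flip: power_mult)
  hence "x \<le> (real m)\<^sup>2" using power_le_imp_le_base[of x 3 "(real m)\<^sup>2"] by (simp add: numeral_eq_Suc)
  thus "real d powr \<epsilon> \<le> (real m)\<^sup>2" by (simp add: x_def)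
qed

lemma size_enc_nats_le:
  assumes "distinct xs" "set xs \<subseteq> {..<n}" shows "size (enc_nats xs) \<le> n * (n + 1)"
proof -
  have "length xs \<le> n"
    using assms distinct_card[of xs] card_mono[of "{..<n}" "set xs"] by simp
  moreover have "size (enc_nats xs) \<le> length xs * (n + 1)"
    using assms(2) by (intro size_enc_list_le) (auto simp: less_imp_le)
  ultimately show ?thesis by (meson mult_le_mono1 order_trans)
qed

lemma enc_request_eq:
  "enc_request n E S qs ab =
     enc_prod enc_natss (enc_prod enc_nats (enc_prod enc_natss (enc_prod enc_nat enc_nat)))
       (adj_list n E, sorted_list_of_set S, qs, ab)"
proof -
  have "enc_list (\<lambda>x. enc_vset (nbhd E x)) xs = enc_natss (map (\<lambda>x. sorted_list_of_set (nbhd E x)) xs)" for xs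
    by (induction xs) (auto simp: enc_vset_def)
  moreover have "enc_path = enc_nats" by (rule ext) (simp add: enc_path_def)
  ultimately show ?thesis
    by (simp add: enc_request_def enc_prod_def enc_graph_def adj_list_def enc_vset_def enc_pair_def)
qed

text \<open>The graph and the earlier paths are each at most \<open>n\<close> lists of at most
  \<open>n\<close> numbers below \<open>n\<close>, hence a cubic bound; the coefficients come from
  multiplying out.\<close>

lemma size_enc_request_le:
  assumes E: "E \<subseteq> {..<n} \<times> {..<n}" and S: "S \<subseteq> {..<n}"
    and qs: "length qs \<le> n" "\<And>q. q \<in> set qs \<Longrightarrow> distinct q \<and> set q \<subseteq> {..<n}"
    and ab: "fst ab < n" "snd ab < n"
  shows "size (enc_request n E S qs ab) + 2 \<le> poly [:10, 5, 3, 2:] n"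
proof -
  have "size (enc_natss (adj_list n E)) \<le> length (adj_list n E) * (n * (n + 1) + 1)"
  proof (rule size_enc_list_le)
    fix xs assume "xs \<in> set (adj_list n E)"
    then obtain x where "xs = sorted_list_of_set (nbhd E x)" by (auto simp: adj_list_def)
    moreover have sub: "nbhd E x \<subseteq> {..<n}" using E by (auto simp: nbhd_def)
    ultimately show "size (enc_nats xs) \<le> n * (n + 1)"
      using finite_subset[OF sub] by (intro size_enc_nats_le) auto
  qed
  moreover have "size (enc_natss qs) \<le> length qs * (n * (n + 1) + 1)"
    using qs(2) by (intro size_enc_list_le size_enc_nats_le) auto
  moreover have "length qs * (n * (n + 1) + 1) \<le> n * (n * (n + 1) + 1)"
    using qs(1) by (rule mult_le_mono1)
  moreover have "size (enc_nats (sorted_list_of_set S)) \<le> n * (n + 1)"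
    using S finite_subset[OF S] by (intro size_enc_nats_le) auto
  ultimately have "size (enc_request n E S qs ab) + 2 \<le>
      n * (n * (n + 1) + 1) + n * (n + 1) + n * (n * (n + 1) + 1) + n + n + 10"
    using ab by (simp add: enc_request_eq enc_prod_def)
  also have "\<dots> \<le> poly [:10, 5, 3, 2:] n" by (simp add: algebra_simps)
  finally show ?thesis .
qed

text \<open>Turns a bound in the size of the request into one in \<open>n\<close>. The program and
  the polynomial depend on \<open>k\<close> alone, so they are fixed before the graph is
  given.\<close>

lemma route_algorithm:
  "\<exists>A T. \<forall>n E S qs ab. E \<subseteq> {..<n} \<times> {..<n} \<longrightarrow> S \<subseteq> {..<n} \<longrightarrow> length qs \<le> n \<longrightarrow>
     (\<forall>q\<in>set qs. distinct q \<and> set q \<subseteq> {..<n}) \<longrightarrow> fst ab < n \<longrightarrow> snd ab < n \<longrightarrow>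
     (\<exists>t\<le>poly T n. runs A (enc_request n E S qs ab) t
        (enc_path (route k (adj_list n E, sorted_list_of_set S, qs, ab))))"
proof -
  let ?e = "enc_prod enc_natss (enc_prod enc_nats (enc_prod enc_natss (enc_prod enc_nat enc_nat)))"
  from pt_route[of k] obtain A g where g: "poly_bounded ?e g"
    and A: "\<And>x. \<exists>t\<le>g x. runs A (?e x) t (enc_nats (route k x))"
    unfolding poly_time_def by blast
  from g obtain c where c: "\<And>x. g x \<le> (size (?e x) + 2) ^ c" unfolding poly_bounded_def by blast
  show ?thesis
  proof (intro exI[of _ A] exI[of _ "[:10, 5, 3, 2:] ^ c"] allI impI)
    fix n E S qs and ab :: "nat \<times> nat"
    assume *: "E \<subseteq> {..<n} \<times> {..<n}" "S \<subseteq> {..<n}" "length qs \<le> n"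
      "\<forall>q\<in>set qs. distinct q \<and> set q \<subseteq> {..<n}" "fst ab < n" "snd ab < n"
    let ?x = "(adj_list n E, sorted_list_of_set S, qs, ab)"
    have "g ?x \<le> (size (enc_request n E S qs ab) + 2) ^ c" using c[of ?x] by (simp add: enc_request_eq)
    also have "\<dots> \<le> poly [:10, 5, 3, 2:] n ^ c"
      using * by (intro power_mono size_enc_request_le) auto
    also have "\<dots> = poly ([:10, 5, 3, 2:] ^ c) n" by (simp add: poly_power)
    finally have "g ?x \<le> poly ([:10, 5, 3, 2:] ^ c) n" .
    moreover obtain t where t: "t \<le> g ?x" "runs A (?e ?x) t (enc_nats (route k ?x))" using A by blast
    ultimately have "t \<le> poly ([:10, 5, 3, 2:] ^ c) n" by linarith
    moreover have "runs A (enc_request n E S qs ab) t (enc_path (route k ?x))"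
      using t(2) by (simp only: enc_path_def enc_request_eq)
    ultimately show "\<exists>t\<le>poly ([:10, 5, 3, 2:] ^ c) n. runs A (enc_request n E S qs ab) t
        (enc_path (route k ?x))" by blast
  qed
qed

lemma online_paths_exist:
  fixes \<epsilon> lam :: real
  assumes eps: "0 < \<epsilon>" "\<epsilon> < 1 / 4" and G: "ndl_graph n d lam E"
    and lam: "lam < real d powr (1 - \<epsilon>) / 320" and d: "real d powr \<epsilon> \<ge> 5"
    and S: "S \<subseteq> {..<n}" and degS: "\<forall>x<n. real (card (nbhd E x \<inter> S)) \<le> real d / 4"
    and ps: "disjoint_pairs_in S ps"
    and few: "real (length ps) \<le> \<epsilon> * real n * ln (real d) / (480 * ln (real n))"
  defines "k \<equiv> nat \<lceil>1 / \<epsilon>\<rceil>"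
  shows "\<exists>qs l. length qs = length ps \<and>
    (\<forall>i<length ps. qs ! i = route k (adj_list n E, sorted_list_of_set S, take i qs, ps ! i) \<and>
       is_path E (fst (ps ! i)) (qs ! i) (snd (ps ! i)) \<and> path_length (qs ! i) = l \<and>
       set (qs ! i) \<subseteq> {..<n}) \<and>
    (\<forall>i<length ps. \<forall>j<length ps. i \<noteq> j \<longrightarrow> set (qs ! i) \<inter> set (qs ! j) = {}) \<and>
    real l < 5 * (ln (real n) / (\<epsilon> * ln (real d)))"
proof -
  from G have n0: "0 < n" and E: "E \<subseteq> {..<n} \<times> {..<n}" and sym: "sym E" and irr: "irrefl E"
    and deg: "\<And>x. x < n \<Longrightarrow> card (nbhd E x) = d"
    by (auto simp: ndl_graph_def regular_graph_def simple_graph_def)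
  have d0: "0 < d" using d by (cases "d = 0") auto
  have dn: "d < n"
  proof -
    have "nbhd E 0 \<subseteq> {..<n} - {0}" using E irr by (auto simp: nbhd_def irrefl_def)
    hence "card (nbhd E 0) \<le> card ({..<n} - {0})" by (intro card_mono) auto
    thus ?thesis using deg[OF n0] n0 by simp
  qed
  have ln5: "ln 5 \<le> \<epsilon> * ln d"
    using d d0 ln_mono[of 5 "real d powr \<epsilon>"] by (simp add: ln_powr)
  have lnd: "0 < ln (real d)"
    using ln5 eps by (smt (verit) ln_gt_zero mult_nonneg_nonpos)
  have d1: "1 < real d" using lnd d0 by simp
  \<comment> \<open>\<open>5 ^ 4 = 625\<close> and \<open>4 * \<epsilon> < 1\<close>; together with
    \<open>d < n\<close> this provides \<open>28 \<le> n\<close>.\<close>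
  have d625: "625 \<le> d"
  proof -
    have "(5 :: real) ^ 4 \<le> (real d powr \<epsilon>) ^ 4" using d by (intro power_mono) auto
    also have "\<dots> = (real d powr \<epsilon>) powr 4" using d0 by simp
    also have "\<dots> = real d powr (\<epsilon> * 4)" by (rule powr_powr)
    also have "\<dots> \<le> real d powr 1" using d1 eps by (intro powr_mono) auto
    finally show ?thesis using d0 by simp
  qed
  define m where "m = nat \<lfloor>real d powr (1 / real k)\<rfloor>"
  note mb = branching_bounds[OF eps d, folded k_def, folded m_def]
  have kpos: "0 < k" using eps by (simp add: k_def)
  define mu where "mu = max lam 0"
  have mu_small: "320 * m * mu < d"
  proof (cases "0 < lam")
    case True
    have "m * lam \<le> real d powr \<epsilon> * lam" using mb(2) True by (intro mult_right_mono) auto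
    also have "\<dots> < real d powr \<epsilon> * (real d powr (1 - \<epsilon>) / 320)"
      using lam d0 by (intro mult_strict_left_mono) auto
    also have "\<dots> = real d / 320" using d0 by (simp flip: powr_add)
    finally show ?thesis using True by (simp add: mu_def)
  next
    case False
    thus ?thesis using d0 by (simp add: mu_def)
  qed
  interpret expander n d m E mu S
  proof
    fix X Y assume "X \<subseteq> {..<n}" "Y \<subseteq> {..<n}"
    from expander_mixing[OF G this]
    show "\<bar>real (card (E \<inter> X \<times> Y)) - d * card X * card Y / n\<bar> \<le> mu * sqrt (card X * card Y)"
      by (simp add: mu_def)
  next
    fix x assume "x < n"
    hence "real (card (nbhd E x \<inter> S)) \<le> real d / 4" using degS by blast
    hence "real (4 * card (nbhd E x \<inter> S)) \<le> real d" by simp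
    thus "4 * card (nbhd E x \<inter> S) \<le> d" by (simp only: of_nat_le_iff)
  qed (use E sym deg mu_small mb(1) dn d625 S in \<open>auto simp: mu_def\<close>)
  have br: "branching k (adj_list n E) = m"
    unfolding m_def
  proof (rule branching_eq_floor)
    show "length (neighbours (adj_list n E) 0) = d" using length_neighbours[OF n0] .
  qed (use d0 dn kpos in auto)
  define L where "L = ln n / (\<epsilon> * ln d)"
  have lnn: "0 < ln (real n)" using d1 dn by simp
  have "4 < 1 / \<epsilon>" using eps by (simp add: field_simps)
  also have "\<dots> = ln d / (\<epsilon> * ln d)" using lnd by simp
  also have "\<dots> \<le> L" unfolding L_def using eps lnd dn d0 by (intro divide_right_mono) auto
  finally have L4: "4 < L" .
  \<comment> \<open>Minimality of \<open>depth\<close> gives \<open>m ^ depth \<le> n\<close>, and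
    \<open>d powr \<epsilon> \<le> m\<^sup>2\<close> converts \<open>ln m\<close> into
    \<open>\<epsilon> * ln d / 2\<close>.\<close>
  have depth: "depth \<le> 2 * L"
  proof (cases "depth = 0")
    case True
    thus ?thesis using L4 by simp
  next
    case False
    hence "320 * m ^ Suc (depth - 1) < n" using less_depth_iff[of "depth - 1"] by simp
    hence "m ^ depth \<le> n" using False by simp
    hence "real m ^ depth \<le> real n" by (metis of_nat_le_iff of_nat_power)
    hence "ln (real m ^ depth) \<le> ln (real n)" using mb(1) by (subst ln_le_cancel_iff) (auto simp: n0)
    hence 1: "depth * ln m \<le> ln n" using mb(1) by (simp add: ln_realpow)
    have "ln (real d powr \<epsilon>) \<le> ln ((real m)\<^sup>2)" using mb(1,3) d0 by (subst ln_le_cancel_iff) auto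
    hence "\<epsilon> * ln d \<le> 2 * ln m" using mb(1) d0 by (simp add: ln_realpow ln_powr)
    hence "depth * (\<epsilon> * ln d) \<le> depth * (2 * ln m)" by (intro mult_left_mono) auto
    also have "\<dots> \<le> 2 * ln n" using 1 by simp
    finally show ?thesis using eps lnd by (simp add: L_def field_simps)
  qed
  have "real (length ps) \<le> n / (480 * L)"
    using few lnn lnd eps by (simp add: L_def field_simps)
  hence "real (length ps) * (480 * L) \<le> n" using L4 by (simp add: field_simps)
  \<comment> \<open>By \<open>depth \<le> 2 * L\<close> and \<open>4 < L\<close>:
    \<open>90 * (4 * L + 2) \<le> 405 * L\<close>, within the 480 of the hypothesis.\<close>
  moreover have "real (length ps) * (90 * (2 * depth + 2)) \<le> real (length ps) * (480 * L)"
    using depth L4 by (intro mult_left_mono) auto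
  ultimately have "real (90 * (length ps * (2 * depth + 2))) \<le> real n" by (simp add: algebra_simps)
  hence "90 * (length ps * (2 * depth + 2)) \<le> n" by (simp only: of_nat_le_iff)
  from route_online[OF ps this br] obtain qs where qs: "length qs = length ps"
    "\<forall>i<length ps. qs ! i = route k (adj_list n E, sorted_list_of_set S, take i qs, ps ! i) \<and>
       is_path E (fst (ps ! i)) (qs ! i) (snd (ps ! i)) \<and> path_length (qs ! i) = 2 * depth + 1 \<and>
       set (qs ! i) \<subseteq> {..<n}"
    "\<forall>i<length ps. \<forall>j<length ps. i \<noteq> j \<longrightarrow> set (qs ! i) \<inter> set (qs ! j) = {}" by blast
  moreover have "real (2 * depth + 1) < 5 * (ln (real n) / (\<epsilon> * ln (real d)))"
    using depth L4 unfolding L_def[symmetric] by simp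
  ultimately show ?thesis by (intro exI[of _ qs] exI[of _ "2 * depth + 1"]) blast
qed

theorem theorem1p6:
  fixes \<epsilon> :: real
  assumes "0 < \<epsilon>" and "\<epsilon> < 1 / 4"
  shows "\<exists>(A :: prog) (T :: nat poly).
    \<forall>(n :: nat) (d :: nat) (lam :: real) (E :: (nat \<times> nat) set) (S :: nat set)
      (ps :: (nat \<times> nat) list).
      ndl_graph n d lam E \<longrightarrow>
      lam < real d powr (1 - \<epsilon>) / 320 \<longrightarrow>
      real d powr \<epsilon> \<ge> 5 \<longrightarrow>
      S \<subseteq> {..<n} \<longrightarrow>
      (\<forall>x<n. real (card (nbhd E x \<inter> S)) \<le> real d / 4) \<longrightarrow>
      disjoint_pairs_in S ps \<longrightarrow>
      real (length ps) \<le> \<epsilon> * real n * ln (real d) / (480 * ln (real n)) \<longrightarrow>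
      (\<exists>(qs :: nat list list) (l :: nat).
        serves_online A (poly T n) n E S ps qs \<and>
        (\<forall>i<length ps. is_path E (fst (ps ! i)) (qs ! i) (snd (ps ! i)) \<and> path_length (qs ! i) = l) \<and>
        (\<forall>i<length ps. \<forall>j<length ps. i \<noteq> j \<longrightarrow> set (qs ! i) \<inter> set (qs ! j) = {}) \<and>
        real l < 5 * (ln (real n) / (\<epsilon> * ln (real d))))"
proof -
  define k where "k = nat \<lceil>1 / \<epsilon>\<rceil>"
  obtain A T where A: "\<forall>n E S qs ab. E \<subseteq> {..<n} \<times> {..<n} \<longrightarrow> S \<subseteq> {..<n} \<longrightarrow> length qs \<le> n \<longrightarrow>
     (\<forall>q\<in>set qs. distinct q \<and> set q \<subseteq> {..<n}) \<longrightarrow> fst ab < n \<longrightarrow> snd ab < n \<longrightarrow>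
     (\<exists>t\<le>poly T n. runs A (enc_request n E S qs ab) t
        (enc_path (route k (adj_list n E, sorted_list_of_set S, qs, ab))))"
    using route_algorithm[of k] by blast
  show ?thesis
  proof (intro exI[of _ A] exI[of _ T] allI impI)
    fix n d :: nat and lam :: real and E and S :: "nat set" and ps
    assume G: "ndl_graph n d lam E"
      and *: "lam < real d powr (1 - \<epsilon>) / 320" "real d powr \<epsilon> \<ge> 5"
      and S: "S \<subseteq> {..<n}" and degS: "\<forall>x<n. real (card (nbhd E x \<inter> S)) \<le> real d / 4"
      and ps: "disjoint_pairs_in S ps"
      and few: "real (length ps) \<le> \<epsilon> * real n * ln (real d) / (480 * ln (real n))"
    from online_paths_exist[OF assms G * S degS ps few, folded k_def]
    obtain qs l where len: "length qs = length ps"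
      and qs: "\<And>i. i < length ps \<Longrightarrow>
        qs ! i = route k (adj_list n E, sorted_list_of_set S, take i qs, ps ! i) \<and>
        is_path E (fst (ps ! i)) (qs ! i) (snd (ps ! i)) \<and> path_length (qs ! i) = l \<and>
        set (qs ! i) \<subseteq> {..<n}"
      and disj: "\<forall>i<length ps. \<forall>j<length ps. i \<noteq> j \<longrightarrow> set (qs ! i) \<inter> set (qs ! j) = {}"
      and l: "real l < 5 * (ln (real n) / (\<epsilon> * ln (real d)))" by blast
    have E: "E \<subseteq> {..<n} \<times> {..<n}"
      using G by (auto simp: ndl_graph_def regular_graph_def simple_graph_def)
    have lenn: "length ps \<le> n"
    proof -
      have dist: "distinct (map fst ps)" and "set (map fst ps) \<subseteq> {..<n}"
        using ps S by (auto simp: disjoint_pairs_in_def)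
      hence "card (set (map fst ps)) \<le> card {..<n}" by (intro card_mono) auto
      thus ?thesis using distinct_card[OF dist] by simp
    qed
    have "serves_online A (poly T n) n E S ps qs"
      unfolding serves_online_def
    proof (intro conjI len allI impI)
      fix i assume i: "i < length ps"
      have "distinct q \<and> set q \<subseteq> {..<n}" if "q \<in> set (take i qs)" for q
      proof -
        from that obtain j where "j < length qs" "q = qs ! j"
          by (auto simp: in_set_conv_nth)
        thus ?thesis using qs[of j] len by (auto simp: is_path_def)
      qed
      moreover have "fst (ps ! i) < n" "snd (ps ! i) < n"
        using ps S i by (auto simp: disjoint_pairs_in_def subset_iff)
      ultimately have "\<exists>t\<le>poly T n. runs A (enc_request n E S (take i qs) (ps ! i)) t
          (enc_path (route k (adj_list n E, sorted_list_of_set S, take i qs, ps ! i)))"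
        using A[rule_format, OF E S, of "take i qs" "ps ! i"] i len lenn by simp
      thus "\<exists>t\<le>poly T n. runs A (enc_request n E S (take i qs) (ps ! i)) t (enc_path (qs ! i))"
        using qs[OF i] by simp
    qed
    moreover have "\<forall>i<length ps. is_path E (fst (ps ! i)) (qs ! i) (snd (ps ! i)) \<and> path_length (qs ! i) = l"
      using qs by blast
    ultimately show "\<exists>qs l. serves_online A (poly T n) n E S ps qs \<and>
        (\<forall>i<length ps. is_path E (fst (ps ! i)) (qs ! i) (snd (ps ! i)) \<and> path_length (qs ! i) = l) \<and>
        (\<forall>i<length ps. \<forall>j<length ps. i \<noteq> j \<longrightarrow> set (qs ! i) \<inter> set (qs ! j) = {}) \<and>
        real l < 5 * (ln (real n) / (\<epsilon> * ln (real d)))"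
      using disj l by blast
  qed
qed

end
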